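(* Let $\ell>0$, $g,h\in C^2([0,\ell],\mathbb R)$, and let $N=\begin{pmatrix}0&-L_-\\L_+&0\end{pmatrix}$ with $L_+=-\partial_{xx}-g(x)$, $L_-=-\partial_{xx}-h(x)$ on $[0,\ell]$ with Dirichlet boundary conditions. Let $P$, $Q$ be the numbers of negative eigenvalues of $L_+$, $L_-$, and let $n_+(N)$ be the number of positive real eigenvalues of $N$. If (a) $0\in\operatorname{Spec}(L_+)\setminus\operatorname{Spec}(L_-)$ and $P-Q\notin\{-1,0\}$, or (b) $0\in\operatorname{Spec}(L_-)\setminus\operatorname{Spec}(L_+)$ and $P-Q\notin\{0,1\}$, then $n_+(N)\ge1$. In particular, if $g,h$ arise from the linearisation of the nonlinear Schrödinger equation about a standing wave $\widehat\psi$ and $0\notin\operatorname{Spec}(L_-)\cap\operatorname{Spec}(L_+)$, then $\widehat\psi$ is spectrally unstable in these cases.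
   Context: $L_\pm$ are unbounded operators in $L^2(0,\ell)$ with domain $H^2(0,\ell)\cap H^1_0(0,\ell)$, and $N$ acts in $L^2(0,\ell)\times L^2(0,\ell)$ with domain $(H^2(0,\ell)\cap H^1_0(0,\ell))^2$. NLS setting: $f:[0,\infty)\to\mathbb R$ is $C^3$, $\beta\in\mathbb R$, and $\phi:[0,\ell]\to\mathbb R$ solves $\phi_{xx}+f(\phi^2)\phi+\beta\phi=0$, so that $\widehat\psi(x,t)=e^{i\beta t}\phi(x)$ is a standing wave solution of $i\psi_t=\psi_{xx}+f(|\psi|^2)\psi$. Linearisation about $\widehat\psi$ gives $N$ with $g(x)=2f'(\phi^2(x))\phi^2(x)+f(\phi^2(x))+\beta$ and $h(x)=f(\phi^2(x))+\beta$. The wave $\widehat\psi$ is spectrally unstable if $N$ has spectrum in the open right half plane, and spectrally stable otherwise. *)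

theory Defs
  imports "HOL-Analysis.Analysis" "HOL-Library.Function_Algebras" "HOL-Library.Extended_Nat"
begin

text \<open>At boundary points of \<open>S\<close> the derivatives are one-sided.\<close>

definition Ck_on :: "nat \<Rightarrow> (real \<Rightarrow> real) \<Rightarrow> real set \<Rightarrow> bool" where
  "Ck_on k f S \<longleftrightarrow>
     (\<exists>D :: nat \<Rightarrow> real \<Rightarrow> real.
        (\<forall>x\<in>S. D 0 x = f x) \<and>
        (\<forall>i<k. \<forall>x\<in>S. (D i has_real_derivative D (Suc i) x) (at x within S)) \<and>
        continuous_on S (D k))"

class complex_vec = ab_group_add +
  fixes cscale :: "complex \<Rightarrow> 'a \<Rightarrow> 'a"  (infixr "\<odot>" 75)
  assumes cscale_add_right: "z \<odot> (u + v) = z \<odot> u + z \<odot> v"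
    and cscale_add_left: "(z + w) \<odot> u = z \<odot> u + w \<odot> u"
    and cscale_cscale: "z \<odot> w \<odot> u = (z * w) \<odot> u"
    and cscale_one: "1 \<odot> u = u"

instantiation complex :: complex_vec
begin
definition cscale_complex_def: "z \<odot> (u :: complex) = z * u"
instance by standard (simp_all add: cscale_complex_def algebra_simps)
end

instantiation "fun" :: (type, complex_vec) complex_vec
begin
definition cscale_fun_def: "z \<odot> u = (\<lambda>x. z \<odot> u x)"
instance
  by standard
    (simp_all add: cscale_fun_def fun_eq_iff cscale_add_right cscale_add_left cscale_cscale cscale_one)
end

instantiation prod :: (complex_vec, complex_vec) complex_vec
begin
definition cscale_prod_def: "z \<odot> p = (z \<odot> fst p, z \<odot> snd p)"
instance
  by standard
    (simp_all add: cscale_prod_def prod_eq_iff cscale_add_right cscale_add_left cscale_cscale cscale_one)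
end

text \<open>
  A Hilbert space of equivalence classes modulo null functions is represented by its space \<open>X\<close> of
  representatives with the seminorm \<open>nrm\<close>; two elements are equal in the Hilbert space iff their
  difference has seminorm zero. An unbounded operator is represented by its graph
  \<open>T u w\<close> (read: \<open>u\<close> represents an element of the domain and \<open>w\<close> represents its image), which
  is closed under change of representatives in both arguments. Hence \<open>(T - z) u = w\<close> in the
  Hilbert space is written \<open>T u (w + z \<odot> u)\<close>.

  A number \<open>z\<close> is in the resolvent set iff \<open>T - z\<close> is injective and surjective from the domain
  onto the space and the inverse is bounded. The eigenvalues are those \<open>z\<close> with \<open>T u = z u\<close> for
  some \<open>u\<close> that is nonzero in the Hilbert space.
\<close>

definition resolvent_set ::
  "'a::complex_vec set \<Rightarrow> ('a \<Rightarrow> real) \<Rightarrow> ('a \<Rightarrow> 'a \<Rightarrow> bool) \<Rightarrow> complex set" where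
  "resolvent_set X nrm T = {z.
     (\<forall>u. T u (z \<odot> u) \<longrightarrow> nrm u = 0) \<and>
     (\<forall>w\<in>X. \<exists>u. T u (w + z \<odot> u)) \<and>
     (\<exists>C. \<forall>w\<in>X. \<forall>u. T u (w + z \<odot> u) \<longrightarrow> nrm u \<le> C * nrm w)}"

definition spectrum ::
  "'a::complex_vec set \<Rightarrow> ('a \<Rightarrow> real) \<Rightarrow> ('a \<Rightarrow> 'a \<Rightarrow> bool) \<Rightarrow> complex set" where
  "spectrum X nrm T = - resolvent_set X nrm T"

definition eigenvalues ::
  "('a::complex_vec \<Rightarrow> real) \<Rightarrow> ('a \<Rightarrow> 'a \<Rightarrow> bool) \<Rightarrow> complex set" where
  "eigenvalues nrm T = {z. \<exists>u. T u (z \<odot> u) \<and> nrm u \<noteq> 0}"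

definition L2 :: "real \<Rightarrow> (real \<Rightarrow> complex) set" where
  "L2 l = {u \<in> borel_measurable (lebesgue_on {0<..<l}).
              integrable (lebesgue_on {0<..<l}) (\<lambda>x. (cmod (u x))\<^sup>2)}"

definition L2_norm :: "real \<Rightarrow> (real \<Rightarrow> complex) \<Rightarrow> real" where
  "L2_norm l u = sqrt (LINT x|lebesgue_on {0<..<l}. (cmod (u x))\<^sup>2)"

text \<open>
  In one dimension $u \in L^2$ has the weak derivative $v \in L^2$ iff $u$ has an absolutely
  continuous representative, namely an indefinite integral of $v$.
\<close>

definition has_L2_deriv :: "real \<Rightarrow> (real \<Rightarrow> complex) \<Rightarrow> (real \<Rightarrow> complex) \<Rightarrow> bool" where
  "has_L2_deriv l u v \<longleftrightarrow> u \<in> L2 l \<and> v \<in> L2 l \<and>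
     (\<exists>c. AE x in lebesgue_on {0<..<l}. u x = c + integral {0..x} v)"

definition H1 :: "real \<Rightarrow> (real \<Rightarrow> complex) set" where
  "H1 l = {u. \<exists>v. has_L2_deriv l u v}"

definition H2 :: "real \<Rightarrow> (real \<Rightarrow> complex) set" where
  "H2 l = {u. \<exists>v w. has_L2_deriv l u v \<and> has_L2_deriv l v w}"

text \<open>Boundary values are those of the continuous representative on $[0,l]$.\<close>

definition H10 :: "real \<Rightarrow> (real \<Rightarrow> complex) set" where
  "H10 l = {u \<in> H1 l. \<exists>u'. continuous_on {0..l} u' \<and>
              (AE x in lebesgue_on {0<..<l}. u x = u' x) \<and> u' 0 = 0 \<and> u' l = 0}"

text \<open>
  \<open>Lop l q\<close> is the graph of $-\partial_{xx} - q(x)$ with Dirichlet boundary conditions, so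
  $L_+$ is \<open>Lop l g\<close> and $L_-$ is \<open>Lop l h\<close>. The second derivative is the weak one.
\<close>

definition Lop :: "real \<Rightarrow> (real \<Rightarrow> real) \<Rightarrow> (real \<Rightarrow> complex) \<Rightarrow> (real \<Rightarrow> complex) \<Rightarrow> bool" where
  "Lop l q u w \<longleftrightarrow> u \<in> H2 l \<inter> H10 l \<and> w \<in> L2 l \<and>
     (\<exists>v v'. has_L2_deriv l u v \<and> has_L2_deriv l v v' \<and>
        (AE x in lebesgue_on {0<..<l}. w x = - v' x - of_real (q x) * u x))"

text \<open>$N(u,v) = (-L_- v, L_+ u)$\<close>

definition Nop :: "real \<Rightarrow> (real \<Rightarrow> real) \<Rightarrow> (real \<Rightarrow> real) \<Rightarrow>
    (real \<Rightarrow> complex) \<times> (real \<Rightarrow> complex) \<Rightarrow> (real \<Rightarrow> complex) \<times> (real \<Rightarrow> complex) \<Rightarrow> bool" where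
  "Nop l g h = (\<lambda>(u, v) (a, b). Lop l h v (\<lambda>x. - a x) \<and> Lop l g u b)"

definition L2_pair_norm :: "real \<Rightarrow> (real \<Rightarrow> complex) \<times> (real \<Rightarrow> complex) \<Rightarrow> real" where
  "L2_pair_norm l = (\<lambda>(u, v). sqrt ((L2_norm l u)\<^sup>2 + (L2_norm l v)\<^sup>2))"

definition Spec_L :: "real \<Rightarrow> (real \<Rightarrow> real) \<Rightarrow> complex set" where
  "Spec_L l q = spectrum (L2 l) (L2_norm l) (Lop l q)"

definition Spec_N :: "real \<Rightarrow> (real \<Rightarrow> real) \<Rightarrow> (real \<Rightarrow> real) \<Rightarrow> complex set" where
  "Spec_N l g h = spectrum (L2 l \<times> L2 l) (L2_pair_norm l) (Nop l g h)"

text \<open>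
  Eigenvalues are counted without multiplicity. For $L_\pm$ this makes no difference: the
  eigenvalues of a Dirichlet problem for a second-order equation are simple, and only finitely
  many of them are negative, so that \<open>card\<close> is the true number.
\<close>

definition n_neg_L :: "real \<Rightarrow> (real \<Rightarrow> real) \<Rightarrow> nat" where
  "n_neg_L l q = card {r::real. r < 0 \<and> complex_of_real r \<in> eigenvalues (L2_norm l) (Lop l q)}"

definition n_plus_N :: "real \<Rightarrow> (real \<Rightarrow> real) \<Rightarrow> (real \<Rightarrow> real) \<Rightarrow> enat" where
  "n_plus_N l g h =
     (let E = {r::real. r > 0 \<and> complex_of_real r \<in> eigenvalues (L2_pair_norm l) (Nop l g h)}
      in if finite E then enat (card E) else \<infinity>)"

text \<open>
  $\widehat\psi(x,t) = e^{i\beta t}\phi(x)$ solves $i\psi_t = \psi_{xx} + f(|\psi|^2)\psi$ iff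
  $\phi_{xx} + f(\phi^2)\phi + \beta\phi = 0$. No boundary condition is imposed on $\phi$.
\<close>

definition standing_wave :: "real \<Rightarrow> (real \<Rightarrow> real) \<Rightarrow> real \<Rightarrow> (real \<Rightarrow> real) \<Rightarrow> bool" where
  "standing_wave l f \<beta> \<phi> \<longleftrightarrow>
     (\<exists>\<phi>x \<phi>xx. \<forall>x\<in>{0..l}.
        (\<phi> has_real_derivative \<phi>x x) (at x within {0..l}) \<and>
        (\<phi>x has_real_derivative \<phi>xx x) (at x within {0..l}) \<and>
        \<phi>xx x + f ((\<phi> x)\<^sup>2) * \<phi> x + \<beta> * \<phi> x = 0)"

text \<open>Since $f$ lives on $[0,\infty)$, its derivative at $0$ is one-sided.\<close>

definition nls_g :: "(real \<Rightarrow> real) \<Rightarrow> real \<Rightarrow> (real \<Rightarrow> real) \<Rightarrow> real \<Rightarrow> real" where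
  "nls_g f \<beta> \<phi> x =
     2 * vector_derivative f (at ((\<phi> x)\<^sup>2) within {0..}) * (\<phi> x)\<^sup>2 + f ((\<phi> x)\<^sup>2) + \<beta>"

definition nls_h :: "(real \<Rightarrow> real) \<Rightarrow> real \<Rightarrow> (real \<Rightarrow> real) \<Rightarrow> real \<Rightarrow> real" where
  "nls_h f \<beta> \<phi> x = f ((\<phi> x)\<^sup>2) + \<beta>"

definition spectrally_unstable :: "real \<Rightarrow> (real \<Rightarrow> real) \<Rightarrow> real \<Rightarrow> (real \<Rightarrow> real) \<Rightarrow> bool" where
  "spectrally_unstable l f \<beta> \<phi> \<longleftrightarrow> (\<exists>z \<in> Spec_N l (nls_g f \<beta> \<phi>) (nls_h f \<beta> \<phi>). Re z > 0)"

end

theory Submission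
  imports Defs "HOL-Complex_Analysis.Great_Picard"
begin

text \<open>
  \<open>N (u, v) = \<sigma> (u, v)\<close> says that \<open>L\<^sub>+ u = \<sigma> v\<close> and \<open>L\<^sub>- v = - \<sigma> u\<close>. When \<open>L\<^sub>-\<close> is invertible with
  inverse \<open>G\<close>, a positive eigenvalue \<open>\<sigma>\<close> of \<open>N\<close> therefore exists iff the symmetric pencil
  \<open>A \<mu> = L\<^sub>+ + \<mu> G\<close> has a kernel for some \<open>\<mu> = \<sigma>\<^sup>2 > 0\<close>. Suppose that it never has one. Then no
  eigenvalue of \<open>A \<mu>\<close> crosses zero, and the number of its negative eigenvalues is the same for all
  \<open>\<mu> > 0\<close>. For small \<open>\<mu>\<close> it is \<open>P\<close> or \<open>P + 1\<close>, since \<open>L\<^sub>+\<close> has \<open>P\<close> negative eigenvalues and a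
  kernel of dimension at most one. For large \<open>\<mu>\<close> it is \<open>Q\<close>: on the span of the negative
  eigenfunctions of \<open>L\<^sub>-\<close> the term \<open>\<mu> G\<close> wins, and on the complement the inequality of the means
  gives \<open>L\<^sub>- + \<mu> G \<ge> 2 sqrt \<mu>\<close>, against which the bounded difference \<open>L\<^sub>+ - L\<^sub>-\<close> is harmless. Hence
  \<open>P - Q\<close> is \<open>0\<close> or \<open>-1\<close>, which case (a) excludes. Case (b) is the same with \<open>L\<^sub>+\<close> and \<open>L\<^sub>-\<close>
  exchanged, and instability follows because eigenvalues lie in the spectrum.

  The abstract form of this argument is \<open>kernel_free_pencil_index\<close>. It rests on
  \<open>gap_eigensystem_exists\<close>, the spectral decomposition at the bottom of the spectrum of a symmetric
  operator with compact resolvent on a space that need not be complete. That hypothesis is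
  verified, in the locale \<open>bounded_symmetric_potential\<close>, for \<open>- \<partial>\<^sub>x\<^sub>x + S\<close> on continuous functions, where \<open>S\<close>
  may be the nonlocal operator in the pencil. Finally \<open>Lop_classical\<close> and \<open>Lop_regularity\<close>
  translate between the weak formulation in \<open>L\<^sup>2\<close> and classical boundary value problems,
  and \<open>n_neg_L_eq\<close> identifies \<open>P\<close> and \<open>Q\<close> with the counts of the decomposition.
\<close>

section \<open>Semi-inner products and symmetric operators\<close>

lemma underdetermined_homogeneous_system:
  fixes a :: "'j \<Rightarrow> 'i \<Rightarrow> real"
  assumes "finite J" "finite I" "card J < card I"
  shows "\<exists>c. (\<exists>i\<in>I. c i \<noteq> 0) \<and> (\<forall>j\<in>J. (\<Sum>i\<in>I. a j i * c i) = 0)"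
  using assms
proof (induction J arbitrary: I a rule: finite_induct)
  case empty
  then have "I \<noteq> {}" by auto
  then show ?case by (intro exI[of _ "\<lambda>_. 1"]) auto
next
  case (insert j0 J)
  show ?case
  proof (cases "\<forall>i\<in>I. a j0 i = 0")
    case True
    have "card J < card I" using insert by simp
    then obtain c where "\<exists>i\<in>I. c i \<noteq> 0" "\<forall>j\<in>J. (\<Sum>i\<in>I. a j i * c i) = 0"
      using insert.IH[of I a] insert.prems by blast
    then show ?thesis using True by (intro exI[of _ c]) auto
  next
    case False
    then obtain i0 where i0: "i0 \<in> I" "a j0 i0 \<noteq> 0" by blast
    define I' where "I' = I - {i0}"
    have fI': "finite I'" and cI': "card J < card I'"
      using insert i0 by (auto simp: I'_def)
    obtain c where c: "\<exists>i\<in>I'. c i \<noteq> 0"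
      "\<forall>j\<in>J. (\<Sum>i\<in>I'. (a j i - a j i0 * a j0 i / a j0 i0) * c i) = 0"
      using insert.IH[OF fI' cI', of "\<lambda>j i. a j i - a j i0 * a j0 i / a j0 i0"] by blast
    define s where "s = (\<Sum>i\<in>I'. a j0 i * c i)"
    define c' where "c' = c(i0 := - s / a j0 i0)"
    have split: "(\<Sum>i\<in>I. b i * c' i) = (\<Sum>i\<in>I'. b i * c i) - b i0 * s / a j0 i0" for b
    proof -
      have "(\<Sum>i\<in>I. b i * c' i) = b i0 * c' i0 + (\<Sum>i\<in>I'. b i * c' i)"
        unfolding I'_def using insert.prems i0 by (simp add: sum.remove)
      moreover have "(\<Sum>i\<in>I'. b i * c' i) = (\<Sum>i\<in>I'. b i * c i)"
        by (intro sum.cong) (auto simp: c'_def I'_def)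
      ultimately show ?thesis by (simp add: c'_def)
    qed
    have "(\<Sum>i\<in>I. a j i * c' i) = 0" if "j \<in> insert j0 J" for j
    proof (cases "j = j0")
      case True
      then show ?thesis using i0 by (simp add: split flip: s_def)
    next
      case False
      then have "(\<Sum>i\<in>I'. (a j i - a j i0 * a j0 i / a j0 i0) * c i) = 0" using that c by auto
      moreover have "(\<Sum>i\<in>I'. (a j i - a j i0 * a j0 i / a j0 i0) * c i)
          = (\<Sum>i\<in>I'. a j i * c i) - a j i0 / a j0 i0 * s"
        unfolding s_def sum_distrib_left sum_subtractf[symmetric]
        by (intro sum.cong) (auto simp: algebra_simps)
      ultimately show ?thesis by (simp add: split)
    qed
    moreover have "\<exists>i\<in>I. c' i \<noteq> 0" using c by (auto simp: c'_def I'_def)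
    ultimately show ?thesis by blast
  qed
qed

text \<open>
  The form is only assumed semidefinite, because the intended vectors are functions on the whole
  line of which only the values on an interval matter. Null vectors play the role of \<open>0\<close>.
\<close>

locale semi_inner =
  fixes ip :: "'a::real_vector \<Rightarrow> 'a \<Rightarrow> real"
  assumes ip_commute: "ip u v = ip v u"
    and ip_add_left: "ip (u + v) w = ip u w + ip v w"
    and ip_scaleR_left: "ip (r *\<^sub>R u) v = r * ip u v"
    and ip_self_nonneg [simp]: "0 \<le> ip u u"
begin

lemma ip_add_right: "ip w (u + v) = ip w u + ip w v"
  by (metis ip_commute ip_add_left)

lemma ip_scaleR_right: "ip v (r *\<^sub>R u) = r * ip v u"
  by (metis ip_commute ip_scaleR_left)

lemma ip_zero [simp]: "ip 0 v = 0" "ip v 0 = 0"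
  using ip_scaleR_left[of 0 0 v] ip_scaleR_right[of v 0 0] by simp_all

lemma ip_minus: "ip (- u) v = - ip u v" "ip v (- u) = - ip v u"
  using ip_scaleR_left[of "-1" u v] ip_scaleR_right[of v "-1" u] by simp_all

lemma ip_diff: "ip (u - v) w = ip u w - ip v w" "ip w (u - v) = ip w u - ip w v"
  using ip_add_left[of u "-v" w] ip_add_right[of w u "-v"] by (simp_all add: ip_minus)

lemma ip_sum_left: "ip (sum f A) w = (\<Sum>a\<in>A. ip (f a) w)"
  by (induction A rule: infinite_finite_induct) (simp_all add: ip_add_left)

lemma ip_sum_right: "ip w (sum f A) = (\<Sum>a\<in>A. ip w (f a))"
  by (induction A rule: infinite_finite_induct) (simp_all add: ip_add_right)

lemmas ip_linear = ip_add_left ip_add_right ip_scaleR_left ip_scaleR_right ip_minus ip_diff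

lemma ip_diff_self: "ip (u - v) (u - v) = ip u u - 2 * ip u v + ip v v"
  by (simp add: ip_linear ip_commute)

lemma ip_diff_self_le: "ip (u - v) (u - v) \<le> 2 * ip u u + 2 * ip v v"
  using ip_self_nonneg[of "u + v"] by (simp add: ip_linear ip_commute)

lemma cauchy_schwarz: "(ip u v)\<^sup>2 \<le> ip u u * ip v v"
proof (cases "ip v v = 0")
  case True
  have *: "0 \<le> ip u u - 2 * t * ip u v" for t
    using ip_self_nonneg[of "u - t *\<^sub>R v"] True by (simp add: ip_linear ip_commute algebra_simps)
  have "ip u v = 0"
  proof (rule ccontr)
    assume "ip u v \<noteq> 0"
    then show False using *[of "(ip u u + 1) / (2 * ip u v)"] by simp
  qed
  then show ?thesis using True by simp
next
  case False
  then have pos: "ip v v > 0" using ip_self_nonneg[of v] by linarith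
  have "0 \<le> ip (u - (ip u v / ip v v) *\<^sub>R v) (u - (ip u v / ip v v) *\<^sub>R v)" by simp
  also have "\<dots> = ip u u - (ip u v)\<^sup>2 / ip v v"
    using pos by (simp add: ip_linear ip_commute field_simps power2_eq_square)
  finally show ?thesis using pos by (simp add: field_simps)
qed

lemma ip_null: "ip u u = 0 \<Longrightarrow> ip u v = 0" "ip u u = 0 \<Longrightarrow> ip v u = 0"
  using cauchy_schwarz[of u v] by (simp_all add: ip_commute)

lemma ip_le_of_bound:
  assumes "ip v v \<le> C\<^sup>2 * ip u u" "C \<ge> 0"
  shows "\<bar>ip v u\<bar> \<le> C * ip u u"
proof -
  have "(ip v u)\<^sup>2 \<le> ip v v * ip u u" by (rule cauchy_schwarz)
  also have "\<dots> \<le> (C\<^sup>2 * ip u u) * ip u u" using assms by (intro mult_right_mono) auto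
  also have "\<dots> = (C * ip u u)\<^sup>2" by (simp add: power2_eq_square)
  finally show ?thesis using assms(2) by (simp add: abs_le_square_iff[symmetric] abs_mult)
qed

lemma ip_null_add: "ip a a = 0 \<Longrightarrow> ip b b = 0 \<Longrightarrow> ip (a + b) (a + b) = 0"
  using ip_null(1)[of a] ip_null(1)[of b] by (simp add: ip_add_left)

lemma ip_null_diff: "ip a a = 0 \<Longrightarrow> ip b b = 0 \<Longrightarrow> ip (a - b) (a - b) = 0"
  using ip_null(1)[of a] ip_null(1)[of b] by (simp add: ip_diff(1))

lemma ip_add_bound:
  assumes "ip a a \<le> A\<^sup>2 * n" "ip b b \<le> B\<^sup>2 * n" "0 \<le> A" "0 \<le> B" "0 \<le> n"
  shows "ip (a + b) (a + b) \<le> (A + B)\<^sup>2 * n"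
proof -
  have "(ip a b)\<^sup>2 \<le> ip a a * ip b b" by (rule cauchy_schwarz)
  also have "\<dots> \<le> (A\<^sup>2 * n) * (B\<^sup>2 * n)" using assms by (intro mult_mono) auto
  also have "\<dots> = (A * B * n)\<^sup>2" by (simp add: power2_eq_square mult_ac)
  finally have "ip a b \<le> A * B * n" by (rule power2_le_imp_le) (use assms in simp)
  moreover have "(A + B)\<^sup>2 * n = A\<^sup>2 * n + B\<^sup>2 * n + 2 * (A * B * n)"
    by (simp add: power2_eq_square algebra_simps)
  ultimately show ?thesis using assms(1,2) by (simp add: ip_add_left ip_add_right ip_commute[of b a])
qed

definition orthonormal :: "'a set \<Rightarrow> bool" where
  "orthonormal E \<longleftrightarrow> (\<forall>e\<in>E. \<forall>e'\<in>E. ip e e' = (if e = e' then 1 else 0))"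

lemma ip_orthonormal_sum:
  assumes "finite E" "orthonormal E"
  shows "ip (\<Sum>e\<in>E. c e *\<^sub>R e) (\<Sum>e\<in>E. d e *\<^sub>R e) = (\<Sum>e\<in>E. c e * d e)"
proof -
  have "ip (\<Sum>e\<in>E. c e *\<^sub>R e) (\<Sum>e\<in>E. d e *\<^sub>R e)
      = (\<Sum>e\<in>E. \<Sum>e'\<in>E. c e * (d e' * ip e e'))"
    by (simp only: ip_sum_left) (simp only: ip_sum_right ip_scaleR_left ip_scaleR_right sum_distrib_left mult.left_commute)
  also have "\<dots> = (\<Sum>e\<in>E. \<Sum>e'\<in>E. if e' = e then c e * d e else 0)"
    using assms(2) unfolding orthonormal_def by (intro sum.cong refl) auto
  also have "\<dots> = (\<Sum>e\<in>E. c e * d e)" using assms(1) by simp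
  finally show ?thesis .
qed

text \<open>
  Every comparison of numbers of negative eigenvalues below is an instance of this. More
  vectors in \<open>E\<close> than in \<open>F\<close> would leave a nonzero combination of \<open>E\<close> orthogonal to \<open>F\<close>;
  in the applications a quadratic form has contradictory signs on such a combination.
\<close>

lemma card_le_if_combinations_not_orthogonal:
  assumes "finite E" "finite F" "orthonormal E"
    and "\<And>c u. u = (\<Sum>e\<in>E. c e *\<^sub>R e) \<Longrightarrow> 0 < ip u u \<Longrightarrow> \<exists>f\<in>F. ip u f \<noteq> 0"
  shows "card E \<le> card F"
proof (rule ccontr)
  assume "\<not> card E \<le> card F"
  then obtain c where c: "\<exists>e\<in>E. c e \<noteq> 0" "\<forall>f\<in>F. (\<Sum>e\<in>E. ip e f * c e) = 0"
    using underdetermined_homogeneous_system[OF assms(2,1), of "\<lambda>f e. ip e f"] by auto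
  define u where "u = (\<Sum>e\<in>E. c e *\<^sub>R e)"
  have "ip u u = (\<Sum>e\<in>E. c e * c e)"
    unfolding u_def by (rule ip_orthonormal_sum[OF assms(1,3)])
  also have "\<dots> > 0" using c(1) assms(1) by (auto intro!: sum_pos2 simp: zero_less_mult_iff linorder_neq_iff)
  finally have "\<exists>f\<in>F. ip u f \<noteq> 0" using assms(4) u_def by blast
  moreover have "ip u f = 0" if "f \<in> F" for f
    using c(2) that by (simp add: u_def ip_sum_left ip_scaleR_left mult.commute)
  ultimately show False by blast
qed

text \<open>
  As in the definition of \<open>Lop\<close>, an unbounded operator is given by its graph: \<open>L u f\<close> reads
  \<open>L u = f\<close>, and \<open>f\<close> matters only up to null vectors.
\<close>

definition symmetric_op :: "('a \<Rightarrow> 'a \<Rightarrow> bool) \<Rightarrow> bool" where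
  "symmetric_op L \<longleftrightarrow> L 0 0 \<and>
     (\<forall>u f v g. L u f \<and> L v g \<longrightarrow> L (u + v) (f + g)) \<and>
     (\<forall>r u f. L u f \<longrightarrow> L (r *\<^sub>R u) (r *\<^sub>R f)) \<and>
     (\<forall>u f v g. L u f \<and> L v g \<longrightarrow> ip f v = ip u g) \<and>
     (\<forall>u f f'. L u f \<and> ip (f - f') (f - f') = 0 \<longrightarrow> L u f')"

lemma symmetric_opD:
  assumes "symmetric_op L"
  shows symmetric_op_zero: "L 0 0"
    and symmetric_op_add: "L u f \<Longrightarrow> L v g \<Longrightarrow> L (u + v) (f + g)"
    and symmetric_op_scaleR: "L u f \<Longrightarrow> L (r *\<^sub>R u) (r *\<^sub>R f)"
    and symmetric_op_sym: "L u f \<Longrightarrow> L v g \<Longrightarrow> ip f v = ip u g"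
    and symmetric_op_null: "L u f \<Longrightarrow> ip (f - f') (f - f') = 0 \<Longrightarrow> L u f'"
  using assms unfolding symmetric_op_def by blast+

lemma symmetric_op_diff:
  assumes "symmetric_op L" "L u f" "L v g"
  shows "L (u - v) (f - g)"
  using symmetric_op_add[OF assms(1) assms(2) symmetric_op_scaleR[OF assms(1,3), of "-1"]] by simp

lemma symmetric_op_sum:
  assumes "symmetric_op L" "\<And>a. a \<in> A \<Longrightarrow> L (u a) (f a)"
  shows "L (sum u A) (sum f A)"
  using assms(2)
  by (induction A rule: infinite_finite_induct)
     (auto simp: symmetric_op_zero[OF assms(1)] intro: symmetric_op_add[OF assms(1)])

section \<open>Spectral gaps from compactness\<close>

text \<open>
  The relation \<open>R\<close> is a positive shift \<open>L + c\<close> of the operator of interest, so that \<open>R u f\<close> says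
  that \<open>u\<close> is the image of \<open>f\<close> under the compact resolvent. Let \<open>\<kappa>\<close> be the supremum of the form
  of the resolvent over the unit ball of the orthogonal complement of \<open>E\<close>. If \<open>\<kappa> < 1 / c\<close>, this
  is the gap. Otherwise \<open>\<kappa> > 0\<close>, and compactness makes a maximizing sequence converge to an
  eigenvector of \<open>R\<close> with eigenvalue \<open>1 / \<kappa> \<le> c\<close>, that is, of \<open>L\<close> with eigenvalue at most \<open>0\<close>.
  The limit is supplied by the compactness of the resolvent, so that incomplete spaces, such as that
  of continuous functions with the \<open>L\<^sup>2\<close> product, are covered.
\<close>

lemma gap_or_new_eigenvector:
  fixes R :: "'a \<Rightarrow> 'a \<Rightarrow> bool"
  assumes sym: "symmetric_op R"
    and coercive: "\<And>u f. R u f \<Longrightarrow> ip u u \<le> ip f u"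
    and surj: "\<And>f. \<exists>u. R u f"
    and compact: "\<And>u f. (\<And>n::nat. R (u n) (f n)) \<Longrightarrow> (\<And>n. ip (f n) (f n) \<le> 1) \<Longrightarrow>
        \<exists>r v. strict_mono r \<and> (\<lambda>n. ip (u (r n) - v) (u (r n) - v)) \<longlonglongrightarrow> 0"
    and eig: "\<And>e. e \<in> E \<Longrightarrow> \<exists>\<nu>. R e (\<nu> *\<^sub>R e)"
    and nz: "\<And>e. e \<in> E \<Longrightarrow> ip e e = 1"
    and "c > 0"
  shows "(\<exists>\<kappa>>0. \<kappa> < 1 / c \<and> (\<forall>u f. R u f \<longrightarrow> (\<forall>e\<in>E. ip u e = 0) \<longrightarrow> ip u u \<le> \<kappa> * ip f u)) \<or>
     (\<exists>e \<nu>. \<nu> \<le> c \<and> R e (\<nu> *\<^sub>R e) \<and> ip e e = 1 \<and> (\<forall>e'\<in>E. ip e e' = 0))"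
proof -
  note sy = symmetric_op_sym[OF sym]
  have orth: "(\<forall>e\<in>E. ip u e = 0) \<longleftrightarrow> (\<forall>e\<in>E. ip f e = 0)" if "R u f" for u f
  proof -
    have "ip f e = 0 \<longleftrightarrow> ip u e = 0" if e: "e \<in> E" for e
    proof -
      obtain \<nu> where \<nu>: "R e (\<nu> *\<^sub>R e)" using eig e by blast
      have "ip e e \<le> \<nu> * ip e e" using coercive[OF \<nu>] by (simp add: ip_linear)
      then have "\<nu> \<ge> 1" using nz[OF e] by simp
      moreover have "ip f e = \<nu> * ip u e" using sy[OF \<open>R u f\<close> \<nu>] by (simp add: ip_linear)
      ultimately show ?thesis by auto
    qed
    then show ?thesis by auto
  qed
  have le1: "ip f u \<le> ip f f" if "R u f" for u f
  proof -
    have "(ip f u)\<^sup>2 \<le> ip f f * ip u u" by (rule cauchy_schwarz)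
    also have "\<dots> \<le> ip f f * ip f u"
      using coercive[OF that] by (intro mult_left_mono) auto
    finally have 1: "ip f u * ip f u \<le> ip f f * ip f u" by (simp add: power2_eq_square)
    have 2: "0 \<le> ip f u" using order_trans[OF ip_self_nonneg coercive[OF that]] .
    show ?thesis
    proof (cases "ip f u = 0")
      case False
      then have "0 < ip f u" using 2 by simp
      then show ?thesis using 1 by (simp only: mult_le_cancel_right_pos)
    qed simp
  qed
  define T where "T = {t. \<exists>u f. R u f \<and> (\<forall>e\<in>E. ip f e = 0) \<and> ip f f \<le> 1 \<and> t = ip f u}"
  define \<kappa> where "\<kappa> = Sup T"
  have bdd: "bdd_above T" unfolding T_def using le1 by (intro bdd_aboveI[of _ 1]) (blast intro: order_trans)
  have T0: "0 \<in> T" unfolding T_def using symmetric_op_zero[OF sym] by (auto intro!: exI[of _ 0])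
  then have \<kappa>0: "\<kappa> \<ge> 0" unfolding \<kappa>_def using bdd by (intro cSup_upper)
  have le\<kappa>: "ip f u \<le> \<kappa> * ip f f" if R: "R u f" and o: "\<forall>e\<in>E. ip f e = 0" for u f
  proof (cases "ip f f = 0")
    case True
    then show ?thesis using ip_null(1)[OF True] by simp
  next
    case False
    then have pos: "ip f f > 0" using ip_self_nonneg[of f] by linarith
    define s where "s = 1 / sqrt (ip f f)"
    have s: "s > 0" "s * s * ip f f = 1" unfolding s_def using pos by auto
    have "R (s *\<^sub>R u) (s *\<^sub>R f)" by (rule symmetric_op_scaleR[OF sym R])
    then have "s * s * ip f u \<in> T" unfolding T_def using o s
      by (intro CollectI exI[of _ "s *\<^sub>R u"] exI[of _ "s *\<^sub>R f"]) (auto simp: ip_linear mult.assoc)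
    then have "s * s * ip f u \<le> \<kappa>" unfolding \<kappa>_def using bdd by (intro cSup_upper)
    then have "s * s * ip f u \<le> s * s * (\<kappa> * ip f f)" using s(2) by (simp add: mult.left_commute mult.assoc)
    then show ?thesis using s(1) by simp
  qed
  \<comment> \<open>On the complement of \<open>E\<close> a bound for the form of the resolvent is one for its norm:
      the form is nonnegative at \<open>f - u / k\<close>, and at \<open>u\<close> at most \<open>k * ip u u\<close>.\<close>
  have norm\<kappa>: "ip u u \<le> k * ip f u"
    if R: "R u f" and o: "\<forall>e\<in>E. ip u e = 0" and k: "k \<ge> \<kappa>" "k > 0" for u f k
  proof -
    obtain z where z: "R z u" using surj by blast
    have "R (u - (1/k) *\<^sub>R z) (f - (1/k) *\<^sub>R u)"
      by (intro symmetric_op_diff[OF sym] symmetric_op_scaleR[OF sym] R z)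
    from coercive[OF this] have "0 \<le> ip (f - (1/k) *\<^sub>R u) (u - (1/k) *\<^sub>R z)"
      by (meson ip_self_nonneg order_trans)
    also have "\<dots> = ip f u - 2 / k * ip u u + 1 / k\<^sup>2 * ip u z"
      using sy[OF R z] by (simp add: ip_linear ip_commute algebra_simps power2_eq_square)
    also have "\<dots> \<le> ip f u - 2 / k * ip u u + 1 / k\<^sup>2 * (k * ip u u)"
    proof -
      have "ip u z \<le> \<kappa> * ip u u" using le\<kappa>[OF z o] .
      also have "\<dots> \<le> k * ip u u" using k by (intro mult_right_mono) auto
      finally show ?thesis using k by (intro add_left_mono mult_left_mono) auto
    qed
    also have "\<dots> = ip f u - ip u u / k" using k by (simp add: field_simps power2_eq_square)
    finally show ?thesis using k by (simp add: field_simps)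
  qed
  show ?thesis
  proof (cases "\<kappa> < 1 / c")
    case True
    define k where "k = max \<kappa> (1 / (2 * c))"
    have "k \<ge> \<kappa>" "k > 0" "k < 1 / c" using True \<open>c > 0\<close> by (auto simp: k_def field_simps less_max_iff_disj)
    then show ?thesis using norm\<kappa> by blast
  next
    case False
    then have \<kappa>c: "\<kappa> \<ge> 1 / c" by simp
    then have \<kappa>pos: "\<kappa> > 0" using \<open>c > 0\<close> by (meson divide_pos_pos less_le_trans zero_less_one)
    have "\<exists>u f. R u f \<and> (\<forall>e\<in>E. ip f e = 0) \<and> ip f f \<le> 1 \<and> \<kappa> - 1 / Suc n < ip f u" for n :: nat
    proof -
      have "\<kappa> - 1 / Suc n < Sup T" unfolding \<kappa>_def by simp
      then obtain t where "t \<in> T" "\<kappa> - 1 / Suc n < t"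
        using less_cSup_iff[OF _ bdd] T0 by blast
      then show ?thesis unfolding T_def by blast
    qed
    then obtain u f where uf: "\<And>n::nat. R (u n) (f n)" "\<And>n e. e \<in> E \<Longrightarrow> ip (f n) e = 0"
      "\<And>n. ip (f n) (f n) \<le> 1" "\<And>n. \<kappa> - 1 / Suc n < ip (f n) (u n)"
      by metis
    obtain r v where r: "strict_mono r" and
      lim: "(\<lambda>n. ip (u (r n) - v) (u (r n) - v)) \<longlonglongrightarrow> 0"
      using compact[of u f] uf(1,3) by blast
    \<comment> \<open>So a maximizing sequence consists of approximate eigenvectors, and \<open>f n\<close> converges along
      with \<open>u n\<close>.\<close>
    have close: "ip (u n - \<kappa> *\<^sub>R f n) (u n - \<kappa> *\<^sub>R f n) \<le> \<kappa> * (1 / Suc n)" for n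
    proof -
      have "\<forall>e\<in>E. ip (u n) e = 0" using orth[OF uf(1)] uf(2) by blast
      then have "ip (u n) (u n) \<le> \<kappa> * ip (f n) (u n)" using norm\<kappa>[OF uf(1)] \<kappa>pos by blast
      moreover have "\<kappa>\<^sup>2 * ip (f n) (f n) \<le> \<kappa>\<^sup>2 * 1" using uf(3) by (intro mult_left_mono) auto
      ultimately have "ip (u n - \<kappa> *\<^sub>R f n) (u n - \<kappa> *\<^sub>R f n) \<le> \<kappa> * (\<kappa> - ip (f n) (u n))"
        by (simp add: ip_linear ip_commute algebra_simps power2_eq_square)
      also have "\<dots> \<le> \<kappa> * (1 / Suc n)" using uf(4)[of n] \<kappa>pos by (intro mult_left_mono) auto
      finally show ?thesis .
    qed
    define d where "d n = \<kappa> *\<^sub>R f (r n) - v" for n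
    have dlim: "(\<lambda>n. ip (d n) (d n)) \<longlonglongrightarrow> 0"
    proof (rule tendsto_sandwich)
      show "\<forall>\<^sub>F n in sequentially. 0 \<le> ip (d n) (d n)" by simp
      have "ip (d n) (d n) \<le> 2 * (\<kappa> * (1 / Suc n)) + 2 * ip (u (r n) - v) (u (r n) - v)" for n
      proof -
        let ?a = "u (r n) - \<kappa> *\<^sub>R f (r n)" and ?b = "u (r n) - v"
        have "d n = ?b - ?a" by (simp add: d_def)
        then have "ip (d n) (d n) \<le> 2 * ip ?b ?b + 2 * ip ?a ?a" by (simp only: ip_diff_self_le)
        also have "ip ?a ?a \<le> \<kappa> * (1 / Suc (r n))" by (rule close)
        also have "\<dots> \<le> \<kappa> * (1 / Suc n)" using \<kappa>pos seq_suble[OF r, of n]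
          by (intro mult_left_mono divide_left_mono) auto
        finally show ?thesis by simp
      qed
      then show "\<forall>\<^sub>F n in sequentially. ip (d n) (d n) \<le> 2 * (\<kappa> * (1 / Suc n)) + 2 * ip (u (r n) - v) (u (r n) - v)"
        by simp
      show "(\<lambda>n. 2 * (\<kappa> * (1 / real (Suc n))) + 2 * ip (u (r n) - v) (u (r n) - v)) \<longlonglongrightarrow> 0"
        using tendsto_add[OF tendsto_mult_left[OF tendsto_mult_left[OF LIMSEQ_Suc[OF lim_1_over_n]], of 2 \<kappa>] tendsto_mult_left[OF lim, of 2]] by simp
    qed simp
    obtain z where z: "R z v" using surj by blast
    have "ip (v - (1/\<kappa>) *\<^sub>R z) (v - (1/\<kappa>) *\<^sub>R z) \<le> 0"
    proof (rule tendsto_lowerbound)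
      show "(\<lambda>n. 2 * ip (u (r n) - v) (u (r n) - v) + 2 * (1 / \<kappa>\<^sup>2 * ip (d n) (d n))) \<longlonglongrightarrow> 0"
        using tendsto_add[OF tendsto_mult_left[OF lim, of 2] tendsto_mult_left[OF tendsto_mult_left[OF dlim], of 2 "1/\<kappa>\<^sup>2"]] by simp
      have "ip (v - (1/\<kappa>) *\<^sub>R z) (v - (1/\<kappa>) *\<^sub>R z)
          \<le> 2 * ip (u (r n) - v) (u (r n) - v) + 2 * (1 / \<kappa>\<^sup>2 * ip (d n) (d n))" for n
      proof -
        let ?a = "u (r n) - v" and ?b = "u (r n) - (1/\<kappa>) *\<^sub>R z"
        let ?g = "f (r n) - (1/\<kappa>) *\<^sub>R v"
        have g: "?g = (1/\<kappa>) *\<^sub>R d n" unfolding d_def using \<kappa>pos by (simp add: scaleR_diff_right)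
        have Rb: "R ?b ?g" by (intro symmetric_op_diff[OF sym] symmetric_op_scaleR[OF sym] uf z)
        have "ip ?b ?b \<le> ip ?g ?g" using coercive[OF Rb] le1[OF Rb] by linarith
        also have "\<dots> = 1 / \<kappa>\<^sup>2 * ip (d n) (d n)" unfolding g by (simp add: ip_linear power2_eq_square)
        finally have "ip ?b ?b \<le> 1 / \<kappa>\<^sup>2 * ip (d n) (d n)" .
        moreover have "ip (v - (1/\<kappa>) *\<^sub>R z) (v - (1/\<kappa>) *\<^sub>R z) = ip (?b - ?a) (?b - ?a)" by simp
        moreover have "\<dots> \<le> 2 * ip ?b ?b + 2 * ip ?a ?a" by (rule ip_diff_self_le)
        ultimately show ?thesis by linarith
      qed
      then show "\<forall>\<^sub>F n in sequentially. ip (v - (1/\<kappa>) *\<^sub>R z) (v - (1/\<kappa>) *\<^sub>R z)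
          \<le> 2 * ip (u (r n) - v) (u (r n) - v) + 2 * (1 / \<kappa>\<^sup>2 * ip (d n) (d n))" by simp
    qed simp
    then have null: "ip (v - (1/\<kappa>) *\<^sub>R z) (v - (1/\<kappa>) *\<^sub>R z) = 0"
      using ip_self_nonneg[of "v - (1/\<kappa>) *\<^sub>R z"] by linarith
    have Rz: "R z ((1/\<kappa>) *\<^sub>R z)" by (rule symmetric_op_null[OF sym z null])
    have vz: "ip v w = 1 / \<kappa> * ip z w" for w
      using ip_null(1)[OF null, of w] by (simp add: ip_linear)
    have vE: "ip v e = 0" if e: "e \<in> E" for e
    proof -
      have "ip (d n) e = - ip v e" for n unfolding d_def using uf(2)[OF e] by (simp add: ip_linear)
      then have "(ip v e)\<^sup>2 \<le> ip (d n) (d n)" for n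
        using cauchy_schwarz[of "d n" e] nz[OF e] by simp
      then have "(ip v e)\<^sup>2 \<le> 0" by (intro tendsto_lowerbound[OF dlim]) auto
      then show ?thesis by simp
    qed
    have vv: "ip v v \<noteq> 0"
    proof
      assume v0: "ip v v = 0"
      have "(ip (u (r n)) (u (r n))) \<le> ip (u (r n) - v) (u (r n) - v)" for n
        using ip_null[OF v0] v0 by (simp add: ip_linear)
      then have "\<kappa> * \<kappa> \<le> 0"
      proof -
        have "(\<lambda>n. \<kappa> - 1 / real (Suc (r n))) \<longlonglongrightarrow> \<kappa> - 0"
          by (intro tendsto_diff tendsto_const LIMSEQ_subseq_LIMSEQ[OF LIMSEQ_Suc[OF lim_1_over_n] r, unfolded comp_def])
        then have 1: "(\<lambda>n. \<kappa> * (\<kappa> - 1 / real (Suc (r n)))) \<longlonglongrightarrow> \<kappa> * \<kappa>"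
          by (intro tendsto_mult_left) simp
        have ipd: "ip (d n) (d n) = \<kappa> * \<kappa> * ip (f (r n)) (f (r n))" for n
          unfolding d_def using ip_null[OF v0] v0 by (simp add: ip_linear)
        have "\<kappa> * (\<kappa> - 1 / real (Suc (r n))) \<le> (1 / \<kappa>) * \<kappa> * ip (d n) (d n)" for n
        proof -
          have "\<kappa> - 1 / real (Suc (r n)) \<le> ip (f (r n)) (u (r n))" using uf(4)[of "r n"] by simp
          also have "\<dots> \<le> \<kappa> * ip (f (r n)) (f (r n))" using le\<kappa>[OF uf(1)] uf(2) by blast
          finally show ?thesis using \<kappa>pos by (simp add: ipd mult.assoc)
        qed
        then have "\<kappa> * (\<kappa> - 1 / real (Suc (r n))) \<le> ip (d n) (d n)" for n using \<kappa>pos by simp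
        then show ?thesis by (intro LIMSEQ_le[OF 1 dlim]) auto
      qed
      then show False using \<kappa>pos by (simp add: mult_le_0_iff)
    qed
    have zz: "ip z z > 0"
    proof (rule ccontr)
      assume "\<not> ip z z > 0"
      then have "ip z z = 0" using ip_self_nonneg[of z] by linarith
      then show False using vv vz[of v] ip_null(1) by simp
    qed
    define s where "s = 1 / sqrt (ip z z)"
    have s: "s * (s * ip z z) = 1" unfolding s_def using zz by auto
    have "R (s *\<^sub>R z) (s *\<^sub>R (1/\<kappa>) *\<^sub>R z)" by (rule symmetric_op_scaleR[OF sym Rz])
    then have "R (s *\<^sub>R z) ((1/\<kappa>) *\<^sub>R (s *\<^sub>R z))" by (simp add: scaleR_left_commute)
    moreover have "1 / \<kappa> \<le> c" using \<kappa>c \<kappa>pos \<open>c > 0\<close> by (simp add: field_simps)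
    moreover have "ip (s *\<^sub>R z) (s *\<^sub>R z) = 1" using s by (simp add: ip_linear)
    moreover have "ip (s *\<^sub>R z) e = 0" if "e \<in> E" for e
      using vE[OF that] vz[of e] \<kappa>pos by (simp add: ip_linear)
    ultimately show ?thesis by blast
  qed
qed

text \<open>
  A full set of orthonormal eigenvectors for the eigenvalues \<open>\<le> 0\<close>: beyond their span the operator
  is bounded below by \<open>\<delta> > 0\<close>. Its cardinality counts the nonpositive eigenvalues with multiplicity.
\<close>

definition gap_eigensystem :: "('a \<Rightarrow> 'a \<Rightarrow> bool) \<Rightarrow> 'a set \<Rightarrow> real \<Rightarrow> bool" where
  "gap_eigensystem L E \<delta> \<longleftrightarrow> finite E \<and> orthonormal E \<and> (\<forall>e\<in>E. \<exists>\<nu>\<le>0. L e (\<nu> *\<^sub>R e)) \<and> 0 < \<delta> \<and>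
     (\<forall>u f. L u f \<longrightarrow> (\<forall>e\<in>E. ip u e = 0) \<longrightarrow> \<delta> * ip u u \<le> ip f u)"

lemma symmetric_op_perturb:
  assumes sym: "symmetric_op L"
    and add: "\<And>u v. M (u + v) = M u + M v" and scale: "\<And>r u. M (r *\<^sub>R u) = r *\<^sub>R M u"
    and msym: "\<And>u v. ip (M u) v = ip u (M v)"
  shows "symmetric_op (\<lambda>u f. L u (f - M u))"
  unfolding symmetric_op_def
proof (intro conjI allI impI; (elim conjE)?)
  have "M 0 = 0" using scale[of 0 0] by simp
  then show "L 0 (0 - M 0)" using symmetric_op_zero[OF sym] by simp
next
  fix u f v g assume "L u (f - M u)" "L v (g - M v)"
  from symmetric_op_add[OF sym this] show "L (u + v) (f + g - M (u + v))"
    by (simp add: add algebra_simps)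
next
  fix r u f assume "L u (f - M u)"
  from symmetric_op_scaleR[OF sym this, of r] show "L (r *\<^sub>R u) (r *\<^sub>R f - M (r *\<^sub>R u))"
    by (simp add: scale scaleR_diff_right)
next
  fix u f v g assume "L u (f - M u)" "L v (g - M v)"
  from symmetric_op_sym[OF sym this] show "ip f v = ip u g"
    by (simp add: ip_diff msym)
next
  fix u f f' assume "L u (f - M u)" "ip (f - f') (f - f') = 0"
  moreover have "f - M u - (f' - M u) = f - f'" by simp
  ultimately show "L u (f' - M u)" using symmetric_op_null[OF sym, of u "f - M u" "f' - M u"] by metis
qed

text \<open>
  Eigenvectors are split off one at a time. An infinite orthonormal sequence of eigenvectors with
  eigenvalues in \<open>[-c, 0]\<close> would, by compactness, have a convergent subsequence, although its
  members have distance \<open>sqrt 2\<close>; hence the process stops with a gap.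
\<close>

lemma gap_eigensystem_exists:
  assumes sym: "symmetric_op L" and c: "0 < c"
    and coercive: "\<And>u f. L u f \<Longrightarrow> ip u u \<le> ip f u + c * ip u u"
    and surj: "\<And>f. \<exists>u. L u (f - c *\<^sub>R u)"
    and compact: "\<And>B u f. (\<And>n::nat. L (u n) (f n - c *\<^sub>R u n)) \<Longrightarrow> (\<And>n. ip (f n) (f n) \<le> B) \<Longrightarrow>
        \<exists>r v. strict_mono r \<and> (\<lambda>n. ip (u (r n) - v) (u (r n) - v)) \<longlonglongrightarrow> 0"
  shows "\<exists>E \<delta>. gap_eigensystem L E \<delta>"
proof (rule ccontr)
  assume no: "\<nexists>E \<delta>. gap_eigensystem L E \<delta>"
  define R where "R u f \<longleftrightarrow> L u (f - c *\<^sub>R u)" for u f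
  have symR: "symmetric_op R"
    unfolding R_def[abs_def] by (rule symmetric_op_perturb[OF sym]) (auto simp: ip_linear scaleR_add_right)
  have coR: "ip u u \<le> ip f u" if "R u f" for u f
    using coercive[OF that[unfolded R_def]] by (simp add: ip_linear)
  define good where "good E \<longleftrightarrow> finite E \<and> orthonormal E \<and> (\<forall>e\<in>E. \<exists>\<nu>\<le>0. L e (\<nu> *\<^sub>R e))" for E
  have step: "\<exists>E'. good E' \<and> (\<exists>e. e \<notin> E \<and> E' = insert e E)" if g: "good E" for E
  proof -
    have 1: "\<exists>\<nu>. R e (\<nu> *\<^sub>R e)" if e: "e \<in> E" for e
    proof -
      obtain \<nu> where "L e (\<nu> *\<^sub>R e)" using g e unfolding good_def by blast
      then have "R e ((\<nu> + c) *\<^sub>R e)" unfolding R_def by (simp add: scaleR_add_left)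
      then show ?thesis by blast
    qed
    have 2: "ip e e = 1" if e: "e \<in> E" for e
      using g e unfolding good_def orthonormal_def by simp
    have "(\<exists>\<kappa>>0. \<kappa> < 1 / c \<and> (\<forall>u f. R u f \<longrightarrow> (\<forall>e\<in>E. ip u e = 0) \<longrightarrow> ip u u \<le> \<kappa> * ip f u)) \<or>
     (\<exists>e \<nu>. \<nu> \<le> c \<and> R e (\<nu> *\<^sub>R e) \<and> ip e e = 1 \<and> (\<forall>e'\<in>E. ip e e' = 0))"
    proof (rule gap_or_new_eigenvector[OF symR coR _ _ 1 2 c])
      show "\<exists>u. R u f" for f using surj by (simp add: R_def)
      show "\<exists>r v. strict_mono r \<and> (\<lambda>n. ip (u (r n) - v) (u (r n) - v)) \<longlonglongrightarrow> 0"
        if "\<And>n::nat. R (u n) (f n)" "\<And>n. ip (f n) (f n) \<le> 1" for u f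
        using compact[of u f 1] that by (simp add: R_def)
    qed
    then show ?thesis
    proof
      assume "\<exists>\<kappa>>0. \<kappa> < 1 / c \<and> (\<forall>u f. R u f \<longrightarrow> (\<forall>e\<in>E. ip u e = 0) \<longrightarrow> ip u u \<le> \<kappa> * ip f u)"
      then obtain \<kappa> where \<kappa>: "\<kappa> > 0" "\<kappa> < 1 / c"
        "\<And>u f. R u f \<Longrightarrow> (\<forall>e\<in>E. ip u e = 0) \<Longrightarrow> ip u u \<le> \<kappa> * ip f u" by blast
      have "gap_eigensystem L E (1 / \<kappa> - c)"
        unfolding gap_eigensystem_def
      proof (intro conjI allI impI)
        show "0 < 1 / \<kappa> - c" using \<kappa>(1,2) c by (simp add: field_simps)
        fix u f assume u: "L u f" "\<forall>e\<in>E. ip u e = 0"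
        then have "R u (f + c *\<^sub>R u)" by (simp add: R_def)
        from \<kappa>(3)[OF this u(2)] show "(1 / \<kappa> - c) * ip u u \<le> ip f u"
          using \<kappa>(1) by (simp add: ip_linear field_simps)
      qed (use g in \<open>auto simp: good_def\<close>)
      then show ?thesis using no by blast
    next
      assume "\<exists>e \<nu>. \<nu> \<le> c \<and> R e (\<nu> *\<^sub>R e) \<and> ip e e = 1 \<and> (\<forall>e'\<in>E. ip e e' = 0)"
      then obtain e \<nu> where e: "\<nu> \<le> c" "R e (\<nu> *\<^sub>R e)" "ip e e = 1" "\<forall>e'\<in>E. ip e e' = 0" by blast
      have "L e ((\<nu> - c) *\<^sub>R e)" using e(2) unfolding R_def by (simp add: scaleR_diff_left)
      then have "\<exists>\<nu>\<le>0. L e (\<nu> *\<^sub>R e)" using e(1) by (intro exI[of _ "\<nu> - c"]) auto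
      moreover have "orthonormal (insert e E)"
        using g e(3,4) unfolding good_def orthonormal_def by (auto simp: ip_commute)
      ultimately have "good (insert e E)" using g unfolding good_def by auto
      moreover have "e \<notin> E" using e(3,4) by auto
      ultimately show ?thesis by blast
    qed
  qed
  have "good {}" by (simp add: good_def orthonormal_def)
  then obtain X where X: "\<And>n::nat. good (X n)" "\<And>n. \<exists>e. e \<notin> X n \<and> X (Suc n) = insert e (X n)"
    using dependent_nat_choice[of "\<lambda>_. good" "\<lambda>_ E E'. \<exists>e. e \<notin> E \<and> E' = insert e E"] step by blast
  then obtain e where e: "\<And>n. e n \<notin> X n" "\<And>n. X (Suc n) = insert (e n) (X n)" by metis
  have mono: "X m \<subseteq> X n" if "m \<le> n" for m n using e(2) by (intro lift_Suc_mono_le[OF _ that]) blast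
  have orth: "ip (e m) (e n) = 0" if "m < n" for m n
  proof -
    have "e m \<in> X n" using mono[of "Suc m" n] that e(2) by auto
    then have "e m \<noteq> e n" "e m \<in> X (Suc n)" "e n \<in> X (Suc n)" using e by auto
    then show ?thesis using X(1)[of "Suc n"] unfolding good_def orthonormal_def by auto
  qed
  have unit: "ip (e n) (e n) = 1" for n
    using X(1)[of "Suc n"] e(2)[of n] unfolding good_def orthonormal_def by auto
  have "\<exists>\<nu>\<le>0. L (e n) (\<nu> *\<^sub>R e n)" for n using X(1)[of "Suc n"] e(2)[of n] unfolding good_def by auto
  then obtain \<nu> where \<nu>: "\<And>n. \<nu> n \<le> 0" "\<And>n. L (e n) (\<nu> n *\<^sub>R e n)" by metis
  have \<nu>c: "1 \<le> \<nu> n + c" for n using coercive[OF \<nu>(2)[of n]] unit by (simp add: ip_linear)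
  have "\<exists>r v. strict_mono r \<and> (\<lambda>n. ip (e (r n) - v) (e (r n) - v)) \<longlonglongrightarrow> 0"
  proof (rule compact[of e "\<lambda>n. (\<nu> n + c) *\<^sub>R e n" "c\<^sup>2"])
    show "L (e n) ((\<nu> n + c) *\<^sub>R e n - c *\<^sub>R e n)" for n using \<nu>(2)[of n] by (simp add: scaleR_add_left)
    show "ip ((\<nu> n + c) *\<^sub>R e n) ((\<nu> n + c) *\<^sub>R e n) \<le> c\<^sup>2" for n
    proof -
      have "(\<nu> n + c)\<^sup>2 \<le> c\<^sup>2" using \<nu>(1)[of n] \<nu>c[of n] by (intro power_mono) auto
      then show ?thesis by (simp add: ip_linear unit power2_eq_square)
    qed
  qed
  then obtain r v where r: "strict_mono r" and lim: "(\<lambda>n. ip (e (r n) - v) (e (r n) - v)) \<longlonglongrightarrow> 0"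
    by blast
  have "(2::real) \<le> 2 * 0 + 2 * 0"
  proof (rule tendsto_lowerbound)
    show "(\<lambda>n. 2 * ip (e (r n) - v) (e (r n) - v) + 2 * ip (e (r (Suc n)) - v) (e (r (Suc n)) - v))
        \<longlonglongrightarrow> 2 * 0 + 2 * 0"
      by (intro tendsto_intros lim LIMSEQ_Suc[OF lim])
    have "2 \<le> 2 * ip (e (r n) - v) (e (r n) - v) + 2 * ip (e (r (Suc n)) - v) (e (r (Suc n)) - v)" for n
    proof -
      let ?a = "e (r n) - v" and ?b = "e (r (Suc n)) - v"
      have "r n < r (Suc n)" using r by (simp add: strict_mono_def)
      then have "2 = ip (e (r n) - e (r (Suc n))) (e (r n) - e (r (Suc n)))"
        using orth unit by (simp add: ip_diff_self)
      also have "\<dots> = ip (?a - ?b) (?a - ?b)" by simp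
      also have "\<dots> \<le> 2 * ip ?a ?a + 2 * ip ?b ?b" by (rule ip_diff_self_le)
      finally show ?thesis .
    qed
    then show "\<forall>\<^sub>F n in sequentially. 2 \<le> 2 * ip (e (r n) - v) (e (r n) - v)
        + 2 * ip (e (r (Suc n)) - v) (e (r (Suc n)) - v)" by simp
  qed simp
  then show False by simp
qed

lemma negative_on_combinations:
  assumes sym: "symmetric_op L" and E: "finite E" "orthonormal E" "\<And>e. e \<in> E \<Longrightarrow> \<exists>\<nu><0. L e (\<nu> *\<^sub>R e)"
  obtains \<eta> where "\<eta> > 0"
    "\<And>c. \<exists>f. L (\<Sum>e\<in>E. c e *\<^sub>R e) f \<and>
       ip f (\<Sum>e\<in>E. c e *\<^sub>R e) \<le> - \<eta> * ip (\<Sum>e\<in>E. c e *\<^sub>R e) (\<Sum>e\<in>E. c e *\<^sub>R e)"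
proof -
  obtain \<nu> where \<nu>: "\<And>e. e \<in> E \<Longrightarrow> \<nu> e < 0" "\<And>e. e \<in> E \<Longrightarrow> L e (\<nu> e *\<^sub>R e)" using E(3) by metis
  define \<eta> where "\<eta> = Min (insert 1 ((\<lambda>e. - \<nu> e) ` E))"
  have \<eta>: "\<eta> > 0" unfolding \<eta>_def using E(1) \<nu>(1) by (subst Min_gr_iff) auto
  have le: "\<nu> e \<le> - \<eta>" if "e \<in> E" for e
  proof -
    have "\<eta> \<le> - \<nu> e" unfolding \<eta>_def using that E(1) by (intro Min_le) auto
    then show ?thesis by simp
  qed
  have "\<exists>f. L (\<Sum>e\<in>E. c e *\<^sub>R e) f \<and>
       ip f (\<Sum>e\<in>E. c e *\<^sub>R e) \<le> - \<eta> * ip (\<Sum>e\<in>E. c e *\<^sub>R e) (\<Sum>e\<in>E. c e *\<^sub>R e)" for c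
  proof (intro exI conjI)
    have "L (\<Sum>e\<in>E. c e *\<^sub>R e) (\<Sum>e\<in>E. c e *\<^sub>R (\<nu> e *\<^sub>R e))"
      by (intro symmetric_op_sum[OF sym] symmetric_op_scaleR[OF sym] \<nu>)
    then show "L (\<Sum>e\<in>E. c e *\<^sub>R e) (\<Sum>e\<in>E. (c e * \<nu> e) *\<^sub>R e)" by simp
    have "(\<Sum>e\<in>E. c e * \<nu> e * c e) \<le> (\<Sum>e\<in>E. - \<eta> * (c e * c e))"
    proof (intro sum_mono)
      fix e assume "e \<in> E"
      then have "\<nu> e * (c e * c e) \<le> - \<eta> * (c e * c e)" by (intro mult_right_mono le) auto
      then show "c e * \<nu> e * c e \<le> - \<eta> * (c e * c e)" by (simp add: mult_ac)
    qed
    then show "ip (\<Sum>e\<in>E. (c e * \<nu> e) *\<^sub>R e) (\<Sum>e\<in>E. c e *\<^sub>R e)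
        \<le> - \<eta> * ip (\<Sum>e\<in>E. c e *\<^sub>R e) (\<Sum>e\<in>E. c e *\<^sub>R e)"
      by (simp only: ip_orthonormal_sum[OF E(1,2)] sum_distrib_left)
  qed
  with \<eta> show thesis by (rule that)
qed

section \<open>The index of a pencil without kernel\<close>

text \<open>
  The pencil is \<open>A \<mu> = L1 + \<mu> G\<close> with \<open>G\<close> the inverse of \<open>L2\<close>, and \<open>N \<mu>\<close> is its number of
  negative eigenvalues. Moving from \<open>\<mu>0\<close> to \<open>\<mu>\<close> changes the form at \<open>u\<close> by at most
  \<open>C * \<bar>\<mu> - \<mu>0\<bar> * ip u u\<close>, which for \<open>\<mu>\<close> close to \<open>\<mu>0\<close> reverses neither the sign on the span of the
  negative eigenvectors nor the sign on the complement, where there is a gap. Without kernel, \<open>N\<close> is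
  therefore locally constant on \<open>\<mu> > 0\<close>, hence constant, and near \<open>\<mu> = 0\<close> it lies between the numbers of negative and of nonpositive eigenvalues of \<open>L1\<close>.

  For large \<open>\<mu>\<close> it equals the number of negative eigenvalues of \<open>L2\<close>. On their span \<open>\<mu> G\<close> is
  as negative as desired. On the orthogonal complement the form of \<open>L2\<close> is nonnegative; at
  \<open>u - sqrt \<mu> *\<^sub>R G u\<close> this reads \<open>ip (L2 u) u + \<mu> * ip (G u) u \<ge> 2 * sqrt \<mu> * ip u u\<close>, which
  eventually exceeds the contribution of the bounded operator \<open>B = L1 - L2\<close>.
\<close>

theorem kernel_free_pencil_index:
  fixes L1 L2 :: "'a \<Rightarrow> 'a \<Rightarrow> bool" and G B :: "'a \<Rightarrow> 'a"
  assumes sym1: "symmetric_op L1" and sym2: "symmetric_op L2"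
    and G: "\<And>f. L2 (G f) f"
    and G_add: "\<And>u v. G (u + v) = G u + G v" and G_scale: "\<And>r u. G (r *\<^sub>R u) = r *\<^sub>R G u"
    and G_bound: "\<And>f. ip (G f) (G f) \<le> C\<^sup>2 * ip f f" and C: "C \<ge> 0"
    and dom: "\<And>u f. L1 u f \<longleftrightarrow> L2 u (f - B u)"
    and B_bound: "\<And>u. ip (B u) (B u) \<le> K\<^sup>2 * ip u u" and K: "K \<ge> 0"
    and gap: "\<And>\<mu>. \<mu> > 0 \<Longrightarrow> \<exists>E \<delta>. gap_eigensystem (\<lambda>u f. L1 u (f - \<mu> *\<^sub>R G u)) E \<delta>"
    and gap1: "gap_eigensystem L1 E1 \<delta>1" and gap2: "gap_eigensystem L2 E2 \<delta>2"
    and no_kernel: "\<And>\<mu> u. \<mu> > 0 \<Longrightarrow> L1 u (- \<mu> *\<^sub>R G u) \<Longrightarrow> ip u u = 0"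
  shows "card {e \<in> E1. \<exists>\<nu><0. L1 e (\<nu> *\<^sub>R e)} \<le> card E2" "card E2 \<le> card E1"
proof -
  define A where "A \<mu> u f \<longleftrightarrow> L1 u (f - \<mu> *\<^sub>R G u)" for \<mu> u f
  have symA: "symmetric_op (A \<mu>)" for \<mu>
    unfolding A_def[abs_def]
  proof (rule symmetric_op_perturb[OF sym1])
    show "ip (\<mu> *\<^sub>R G u) v = ip u (\<mu> *\<^sub>R G v)" for u v
      using symmetric_op_sym[OF sym2 G[of u] G[of v]] by (simp add: ip_linear)
  qed (auto simp: G_add G_scale scaleR_add_right)
  have A_shift: "A \<mu> u (f + (\<mu> - \<mu>') *\<^sub>R G u)" if "A \<mu>' u f" for \<mu> \<mu>' u f
    using that unfolding A_def by (simp add: algebra_simps)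
  have G_form: "\<bar>ip (G u) u\<bar> \<le> C * ip u u" for u by (rule ip_le_of_bound[OF G_bound C])
  have B_form: "\<bar>ip (B u) u\<bar> \<le> K * ip u u" for u by (rule ip_le_of_bound[OF B_bound K])
  obtain E D where ED: "\<And>\<mu>. \<mu> > 0 \<Longrightarrow> gap_eigensystem (A \<mu>) (E \<mu>) (D \<mu>)"
  proof -
    have "\<exists>E \<delta>. gap_eigensystem (A \<mu>) E \<delta>" if "\<mu> > 0" for \<mu>
      using gap[OF that] unfolding A_def[abs_def] .
    then have "\<exists>E D. \<forall>\<mu>. \<mu> > 0 \<longrightarrow> gap_eigensystem (A \<mu>) (E \<mu>) (D \<mu>)" by metis
    then show thesis using that by blast
  qed
  have E_fin: "finite (E \<mu>)" "orthonormal (E \<mu>)" if "\<mu> > 0" for \<mu>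
    using ED[OF that] unfolding gap_eigensystem_def by auto
  have E_neg: "\<exists>\<nu><0. A \<mu> e (\<nu> *\<^sub>R e)" if \<mu>: "\<mu> > 0" and e: "e \<in> E \<mu>" for \<mu> e
  proof -
    obtain \<nu> where \<nu>: "\<nu> \<le> 0" "A \<mu> e (\<nu> *\<^sub>R e)" and "ip e e = 1"
      using ED[OF \<mu>] e unfolding gap_eigensystem_def orthonormal_def by auto
    moreover have "\<nu> \<noteq> 0"
    proof
      assume "\<nu> = 0"
      then have "ip e e = 0" using no_kernel[OF \<mu>] \<nu>(2) by (simp add: A_def)
      with \<open>ip e e = 1\<close> show False by simp
    qed
    ultimately show ?thesis by (intro exI[of _ \<nu>]) auto
  qed
  have E_gap: "0 < ip f u" if "\<mu> > 0" "A \<mu> u f" "\<forall>e\<in>E \<mu>. ip u e = 0" "0 < ip u u" for \<mu> u f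
  proof -
    have "0 < D \<mu> * ip u u" "D \<mu> * ip u u \<le> ip f u"
      using ED[OF that(1)] that unfolding gap_eigensystem_def by auto
    then show ?thesis by linarith
  qed
  define N where "N \<mu> = card (E \<mu>)" for \<mu>

  \<comment> \<open>Stated for every \<open>\<mu>0\<close> so that it serves both for \<open>\<mu>0 > 0\<close>, where \<open>A \<mu>0\<close> has no kernel
    and the two bounds agree, and for the end point \<open>\<mu>0 = 0\<close>.\<close>
  have semicontinuity: "\<exists>\<epsilon>>0. \<forall>\<mu>>0. \<bar>\<mu> - \<mu>0\<bar> < \<epsilon> \<longrightarrow>
      card {e \<in> F. \<exists>\<nu><0. A \<mu>0 e (\<nu> *\<^sub>R e)} \<le> N \<mu> \<and> N \<mu> \<le> card F"
    if F: "gap_eigensystem (A \<mu>0) F \<delta>" for \<mu>0 F \<delta>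
  proof -
    define F' where "F' = {e \<in> F. \<exists>\<nu><0. A \<mu>0 e (\<nu> *\<^sub>R e)}"
    have fF: "finite F" "orthonormal F" "\<delta> > 0" using F unfolding gap_eigensystem_def by auto
    have F': "finite F'" "orthonormal F'" "\<And>e. e \<in> F' \<Longrightarrow> \<exists>\<nu><0. A \<mu>0 e (\<nu> *\<^sub>R e)"
      using fF unfolding F'_def orthonormal_def by auto
    obtain \<eta> where \<eta>: "\<eta> > 0" "\<And>c. \<exists>f. A \<mu>0 (\<Sum>e\<in>F'. c e *\<^sub>R e) f \<and>
       ip f (\<Sum>e\<in>F'. c e *\<^sub>R e) \<le> - \<eta> * ip (\<Sum>e\<in>F'. c e *\<^sub>R e) (\<Sum>e\<in>F'. c e *\<^sub>R e)"
      using negative_on_combinations[OF symA F'] by blast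
    define \<epsilon> where "\<epsilon> = min \<eta> \<delta> / (C + 1)"
    have \<epsilon>: "\<epsilon> > 0" using \<eta> fF C by (simp add: \<epsilon>_def)
    have small: "\<bar>(\<mu> - \<mu>0) * ip (G u) u\<bar> < \<eta> * ip u u \<and> \<bar>(\<mu> - \<mu>0) * ip (G u) u\<bar> < \<delta> * ip u u"
      if "\<bar>\<mu> - \<mu>0\<bar> < \<epsilon>" "0 < ip u u" for \<mu> u
    proof -
      have "\<bar>(\<mu> - \<mu>0) * ip (G u) u\<bar> \<le> \<epsilon> * (C * ip u u)"
        unfolding abs_mult using that G_form[of u] by (intro mult_mono) auto
      also have "\<dots> < \<epsilon> * ((C + 1) * ip u u)" using \<epsilon> that by (intro mult_strict_left_mono) auto
      also have "\<dots> = min \<eta> \<delta> * ip u u" unfolding \<epsilon>_def using C by simp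
      finally have "\<bar>(\<mu> - \<mu>0) * ip (G u) u\<bar> < min \<eta> \<delta> * ip u u" .
      moreover have "min \<eta> \<delta> * ip u u \<le> \<eta> * ip u u" "min \<eta> \<delta> * ip u u \<le> \<delta> * ip u u"
        using that by (auto intro: mult_right_mono)
      ultimately show ?thesis by linarith
    qed
    have "card F' \<le> N \<mu>" if \<mu>: "\<mu> > 0" "\<bar>\<mu> - \<mu>0\<bar> < \<epsilon>" for \<mu>
      unfolding N_def
    proof (rule card_le_if_combinations_not_orthogonal[OF F'(1) E_fin(1)[OF \<mu>(1)] F'(2)], rule ccontr)
      fix c u assume u: "u = (\<Sum>e\<in>F'. c e *\<^sub>R e)" "0 < ip u u" "\<not> (\<exists>f\<in>E \<mu>. ip u f \<noteq> 0)"
      obtain f where f: "A \<mu>0 u f" "ip f u \<le> - \<eta> * ip u u" using \<eta>(2)[of c] u(1) by blast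
      have "0 < ip (f + (\<mu> - \<mu>0) *\<^sub>R G u) u" using E_gap[OF \<mu>(1) A_shift[OF f(1)]] u by blast
      then show False using f(2) small[OF \<mu>(2) u(2)] by (simp add: ip_linear abs_less_iff)
    qed
    moreover have "N \<mu> \<le> card F" if \<mu>: "\<mu> > 0" "\<bar>\<mu> - \<mu>0\<bar> < \<epsilon>" for \<mu>
      unfolding N_def
    proof (rule card_le_if_combinations_not_orthogonal[OF E_fin(1)[OF \<mu>(1)] fF(1) E_fin(2)[OF \<mu>(1)]], rule ccontr)
      fix c u assume u: "u = (\<Sum>e\<in>E \<mu>. c e *\<^sub>R e)" "0 < ip u u" "\<not> (\<exists>f\<in>F. ip u f \<noteq> 0)"
      obtain \<eta>' where "\<eta>' > 0" and comb: "\<And>c. \<exists>f. A \<mu> (\<Sum>e\<in>E \<mu>. c e *\<^sub>R e) f \<and>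
        ip f (\<Sum>e\<in>E \<mu>. c e *\<^sub>R e) \<le> - \<eta>' * ip (\<Sum>e\<in>E \<mu>. c e *\<^sub>R e) (\<Sum>e\<in>E \<mu>. c e *\<^sub>R e)"
        using negative_on_combinations[OF symA E_fin[OF \<mu>(1)] E_neg[OF \<mu>(1)]] by blast
      obtain f where f: "A \<mu> u f" "ip f u \<le> - \<eta>' * ip u u"
      using comb[of c] u(1) by blast
      have "- \<eta>' * ip u u \<le> 0" using \<open>\<eta>' > 0\<close> u(2) by simp
      then have neg: "ip f u \<le> 0" using f(2) by linarith
      have "\<delta> * ip u u \<le> ip (f + (\<mu>0 - \<mu>) *\<^sub>R G u) u"
        using F A_shift[OF f(1), of \<mu>0] u(3) unfolding gap_eigensystem_def by blast
      then show False using neg small[OF \<mu>(2) u(2)] by (simp add: ip_linear abs_less_iff algebra_simps)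
    qed
    ultimately show ?thesis using \<epsilon> unfolding F'_def by blast
  qed

  have "\<forall>\<^sub>F \<mu> in at \<mu>0 within {0<..}. N \<mu>0 = N \<mu>" if \<mu>0: "\<mu>0 > 0" for \<mu>0
  proof -
    have "{e \<in> E \<mu>0. \<exists>\<nu><0. A \<mu>0 e (\<nu> *\<^sub>R e)} = E \<mu>0" using E_neg[OF \<mu>0] by auto
    then obtain \<epsilon> where "\<epsilon> > 0" "\<And>\<mu>. \<mu> > 0 \<Longrightarrow> \<bar>\<mu> - \<mu>0\<bar> < \<epsilon> \<Longrightarrow> N \<mu>0 = N \<mu>"
      using semicontinuity[OF ED[OF \<mu>0]] unfolding N_def by fastforce
    then show ?thesis by (auto simp: eventually_at dist_real_def)
  qed
  then have const: "N \<mu> = N \<mu>'" if "\<mu> > 0" "\<mu>' > 0" for \<mu> \<mu>'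
    using connected_local_const[of "{0::real<..}" \<mu> \<mu>' N] that by auto

  have E2: "finite E2" "orthonormal E2" "\<And>e. e \<in> E2 \<Longrightarrow> ip e e = 1"
    using gap2 unfolding gap_eigensystem_def orthonormal_def by auto
  have "\<exists>\<nu><0. L2 e (\<nu> *\<^sub>R e)" if e: "e \<in> E2" for e
  proof -
    obtain \<nu> where \<nu>: "\<nu> \<le> 0" "L2 e (\<nu> *\<^sub>R e)"
      using gap2 e unfolding gap_eigensystem_def by auto
    have "\<nu> * ip e (G e) = 1"
      using symmetric_op_sym[OF sym2 \<nu>(2) G[of e]] E2(3)[OF e] by (simp add: ip_linear)
    then have "\<nu> \<noteq> 0" by auto
    with \<nu> show ?thesis by (intro exI[of _ \<nu>]) auto
  qed
  then obtain \<nu>2 where \<nu>2: "\<And>e. e \<in> E2 \<Longrightarrow> \<nu>2 e < 0" "\<And>e. e \<in> E2 \<Longrightarrow> L2 e (\<nu>2 e *\<^sub>R e)" by metis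
  have Ge: "ip (G u) e = ip u e / \<nu>2 e" if "e \<in> E2" for u e
    using symmetric_op_sym[OF sym2 G[of u] \<nu>2(2)[OF that]] \<nu>2(1)[OF that]
    by (simp add: ip_linear field_simps)
  have L2_nonneg: "0 \<le> ip f u" if "L2 u f" "\<forall>e\<in>E2. ip u e = 0" for u f
  proof -
    have "0 \<le> \<delta>2 * ip u u" "\<delta>2 * ip u u \<le> ip f u"
      using gap2 that unfolding gap_eigensystem_def by auto
    then show ?thesis by linarith
  qed

  have upper: "N \<mu> \<le> card E2" if \<mu>: "\<mu> > 0" "K < 2 * sqrt \<mu>" for \<mu>
    unfolding N_def
  proof (rule card_le_if_combinations_not_orthogonal[OF E_fin(1)[OF \<mu>(1)] E2(1) E_fin(2)[OF \<mu>(1)]], rule ccontr)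
    fix c u assume u: "u = (\<Sum>e\<in>E \<mu>. c e *\<^sub>R e)" "0 < ip u u" "\<not> (\<exists>f\<in>E2. ip u f \<noteq> 0)"
    obtain \<eta>' where "\<eta>' > 0" and comb: "\<And>c. \<exists>f. A \<mu> (\<Sum>e\<in>E \<mu>. c e *\<^sub>R e) f \<and>
      ip f (\<Sum>e\<in>E \<mu>. c e *\<^sub>R e) \<le> - \<eta>' * ip (\<Sum>e\<in>E \<mu>. c e *\<^sub>R e) (\<Sum>e\<in>E \<mu>. c e *\<^sub>R e)"
      using negative_on_combinations[OF symA E_fin[OF \<mu>(1)] E_neg[OF \<mu>(1)]] by blast
    obtain f where f: "A \<mu> u f" "ip f u \<le> - \<eta>' * ip u u"
      using comb[of c] u(1) by blast
    have "- \<eta>' * ip u u \<le> 0" using \<open>\<eta>' > 0\<close> u(2) by simp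
    then have neg: "ip f u \<le> 0" using f(2) by linarith
    define g where "g = f - \<mu> *\<^sub>R G u - B u"
    define t where "t = sqrt \<mu>"
    have t: "t * t = \<mu>" using \<mu> by (simp add: t_def)
    have g: "L2 u g" using f(1) dom unfolding A_def g_def by simp
    have "L2 (u - t *\<^sub>R G u) (g - t *\<^sub>R u)"
      by (intro symmetric_op_diff[OF sym2] symmetric_op_scaleR[OF sym2] g G)
    moreover have "\<forall>e\<in>E2. ip (u - t *\<^sub>R G u) e = 0" using u(3) Ge by (simp add: ip_linear)
    ultimately have "0 \<le> ip (g - t *\<^sub>R u) (u - t *\<^sub>R G u)" by (rule L2_nonneg)
    also have "\<dots> = ip g u - 2 * t * ip u u + \<mu> * ip (G u) u"
      using symmetric_op_sym[OF sym2 g G[of u]] t[symmetric] by (simp add: ip_linear ip_commute algebra_simps)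
    also have "\<dots> = ip f u - ip (B u) u - 2 * t * ip u u" by (simp add: g_def ip_linear)
    also have "\<dots> \<le> (K - 2 * t) * ip u u" using neg B_form[of u] by (simp add: algebra_simps abs_le_iff)
    also have "\<dots> < 0" using \<mu>(2) u(2) by (simp add: t_def mult_neg_pos)
    finally show False by simp
  qed

  have lower: "\<exists>M>0. \<forall>\<mu>>M. card E2 \<le> N \<mu>"
  proof -
    \<comment> \<open>The eigenvectors of \<open>L2\<close> are eigenvectors of \<open>G\<close>, for the reciprocal eigenvalues.\<close>
    have symG: "symmetric_op (\<lambda>u f. ip (f - G u) (f - G u) = 0)"
      unfolding symmetric_op_def
    proof (intro conjI allI impI; (elim conjE)?)
      show "ip (0 - G 0) (0 - G 0) = 0" using G_scale[of 0 0] by simp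
    next
      fix u f v g assume "ip (f - G u) (f - G u) = 0" "ip (g - G v) (g - G v) = 0"
      moreover have "f + g - G (u + v) = (f - G u) + (g - G v)" by (simp add: G_add)
      ultimately show "ip (f + g - G (u + v)) (f + g - G (u + v)) = 0"
        using ip_null_add by metis
    next
      fix r u f assume "ip (f - G u) (f - G u) = 0"
      moreover have "r *\<^sub>R f - G (r *\<^sub>R u) = r *\<^sub>R (f - G u)" by (simp add: G_scale scaleR_diff_right)
      ultimately show "ip (r *\<^sub>R f - G (r *\<^sub>R u)) (r *\<^sub>R f - G (r *\<^sub>R u)) = 0"
        by (simp add: ip_scaleR_left ip_scaleR_right)
    next
      fix u f v g assume "ip (f - G u) (f - G u) = 0" "ip (g - G v) (g - G v) = 0"
      then have "ip f v = ip (G u) v" "ip u g = ip u (G v)" using ip_null[of "f - G u" v] ip_null[of "g - G v" u]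
        by (simp_all add: ip_diff)
      then show "ip f v = ip u g" using symmetric_op_sym[OF sym2 G[of u] G[of v]] by simp
    next
      fix u f f' assume "ip (f - G u) (f - G u) = 0" "ip (f - f') (f - f') = 0"
      moreover have "f' - G u = (f - G u) - (f - f')" by simp
      ultimately show "ip (f' - G u) (f' - G u) = 0" using ip_null_diff by metis
    qed
    have "\<exists>\<nu><0. ip (\<nu> *\<^sub>R e - G e) (\<nu> *\<^sub>R e - G e) = 0" if e: "e \<in> E2" for e
    proof (intro exI conjI)
      show "1 / \<nu>2 e < 0" using \<nu>2(1)[OF e] by simp
      define d where "d = (1 / \<nu>2 e) *\<^sub>R e - G e"
      have "L2 ((1 / \<nu>2 e) *\<^sub>R e) e"
        using symmetric_op_scaleR[OF sym2 \<nu>2(2)[OF e], of "1 / \<nu>2 e"] \<nu>2(1)[OF e] by simp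
      from symmetric_op_diff[OF sym2 this G[of e]] have "L2 d 0" by (simp add: d_def)
      from symmetric_op_sym[OF sym2 this G[of d]] have "ip d d = 0" by simp
      then show "ip ((1 / \<nu>2 e) *\<^sub>R e - G e) ((1 / \<nu>2 e) *\<^sub>R e - G e) = 0" by (simp add: d_def)
    qed
    then obtain \<eta> where \<eta>: "\<eta> > 0" "\<And>c. \<exists>f. ip (f - G (\<Sum>e\<in>E2. c e *\<^sub>R e)) (f - G (\<Sum>e\<in>E2. c e *\<^sub>R e)) = 0 \<and>
       ip f (\<Sum>e\<in>E2. c e *\<^sub>R e) \<le> - \<eta> * ip (\<Sum>e\<in>E2. c e *\<^sub>R e) (\<Sum>e\<in>E2. c e *\<^sub>R e)"
      using negative_on_combinations[OF symG E2(1,2)] by blast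
    obtain \<eta>' where \<eta>': "\<eta>' > 0" "\<And>c. \<exists>f. L2 (\<Sum>e\<in>E2. c e *\<^sub>R e) f \<and>
       ip f (\<Sum>e\<in>E2. c e *\<^sub>R e) \<le> - \<eta>' * ip (\<Sum>e\<in>E2. c e *\<^sub>R e) (\<Sum>e\<in>E2. c e *\<^sub>R e)"
      using negative_on_combinations[OF sym2 E2(1,2)] \<nu>2 by blast
    have "card E2 \<le> N \<mu>" if \<mu>: "\<mu> > (K + 1) / \<eta>" for \<mu>
    proof -
      have \<mu>0: "\<mu> > 0" using \<mu> K \<eta>(1) by (meson add_nonneg_pos divide_pos_pos less_trans zero_less_one)
      show ?thesis
        unfolding N_def
      proof (rule card_le_if_combinations_not_orthogonal[OF E2(1) E_fin(1)[OF \<mu>0] E2(2)], rule ccontr)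
        fix c u assume u: "u = (\<Sum>e\<in>E2. c e *\<^sub>R e)" "0 < ip u u" "\<not> (\<exists>f\<in>E \<mu>. ip u f \<noteq> 0)"
        obtain h where h: "ip (h - G u) (h - G u) = 0" "ip h u \<le> - \<eta> * ip u u"
          using \<eta>(2)[of c] u(1) by blast
        have Gu: "ip (G u) u \<le> - \<eta> * ip u u" using h(2) ip_null(1)[OF h(1), of u] by (simp add: ip_diff)
        obtain f where f: "L2 u f" "ip f u \<le> - \<eta>' * ip u u" using \<eta>'(2)[of c] u(1) by blast
        have "A \<mu> u (f + B u + \<mu> *\<^sub>R G u)" unfolding A_def using f(1) by (simp add: dom)
        then have "0 < ip (f + B u + \<mu> *\<^sub>R G u) u" using E_gap[OF \<mu>0] u by blast
        also have "\<dots> \<le> 0 + K * ip u u + \<mu> * (- \<eta> * ip u u)"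
          unfolding ip_add_left ip_scaleR_left
        proof (intro add_mono mult_left_mono Gu)
          have "- \<eta>' * ip u u \<le> 0" using \<eta>'(1) u(2) by simp
          then show "ip f u \<le> 0" using f(2) by linarith
          show "ip (B u) u \<le> K * ip u u" using B_form[of u] by simp
        qed (use \<mu>0 in simp)
        also have "\<dots> = (K - \<mu> * \<eta>) * ip u u" by (simp add: algebra_simps)
        also have "\<dots> < 0"
        proof (rule mult_neg_pos)
          show "K - \<mu> * \<eta> < 0" using \<mu> \<eta>(1) by (simp add: field_simps)
        qed (rule u(2))
        finally show False .
      qed
    qed
    moreover have "(K + 1) / \<eta> > 0" using K \<eta>(1) by simp
    ultimately show ?thesis by blast
  qed
  then obtain M where M: "M > 0" "\<And>\<mu>. \<mu> > M \<Longrightarrow> card E2 \<le> N \<mu>" by blast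
  define \<mu>1 where "\<mu>1 = max (M + 1) (K\<^sup>2 + 1)"
  have "N \<mu>1 = card E2"
  proof (rule antisym)
    have "K < sqrt \<mu>1" unfolding \<mu>1_def using K by (intro real_less_rsqrt) auto
    then show "N \<mu>1 \<le> card E2" using M(1) K by (intro upper) (auto simp: \<mu>1_def)
    show "card E2 \<le> N \<mu>1" by (rule M(2)) (simp add: \<mu>1_def)
  qed
  then have NE2: "N \<mu> = card E2" if "\<mu> > 0" for \<mu> using const[OF that, of \<mu>1] M(1) by (simp add: \<mu>1_def)
  have "gap_eigensystem (A 0) E1 \<delta>1" using gap1 unfolding A_def[abs_def] by simp
  from semicontinuity[OF this] obtain \<epsilon> where \<epsilon>: "\<epsilon> > 0"
    "\<And>\<mu>. \<mu> > 0 \<Longrightarrow> \<bar>\<mu> - 0\<bar> < \<epsilon> \<Longrightarrow> card {e \<in> E1. \<exists>\<nu><0. A 0 e (\<nu> *\<^sub>R e)} \<le> N \<mu> \<and> N \<mu> \<le> card E1"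
    by blast
  from \<epsilon>(2)[of "\<epsilon> / 2"] \<epsilon>(1) NE2[of "\<epsilon> / 2"]
  have "card {e \<in> E1. \<exists>\<nu><0. L1 e (\<nu> *\<^sub>R e)} \<le> card E2 \<and> card E2 \<le> card E1"
    by (simp add: A_def)
  then show "card {e \<in> E1. \<exists>\<nu><0. L1 e (\<nu> *\<^sub>R e)} \<le> card E2" "card E2 \<le> card E1" by auto
qed

end

section \<open>Continuous functions on an interval\<close>

text \<open>
  Functions on \<open>[0, l]\<close> are represented by bounded continuous functions on the line, usually constant
  outside the interval. This gives a real vector space with a complete supremum norm for every
  \<open>l\<close>, on which the \<open>L\<^sup>2\<close> product over \<open>[0, l]\<close> is a semi-inner product.
\<close>

type_synonym cfun = "real \<Rightarrow>\<^sub>C real"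

definition L2_ip :: "real \<Rightarrow> real \<Rightarrow> cfun \<Rightarrow> cfun \<Rightarrow> real" where
  "L2_ip a b u v = integral {a..b} (\<lambda>x. u x * v x)"

lemma cfun_integrable [simp, intro]: "(\<lambda>x. apply_bcontfun (u :: cfun) x * apply_bcontfun (v :: cfun) x) integrable_on {a..b}"
  by (intro integrable_continuous_interval continuous_intros continuous_on_apply_bcontfun)

interpretation L2: semi_inner "L2_ip a b" for a b
proof
  fix u v w :: cfun and r :: real
  show "L2_ip a b u v = L2_ip a b v u" by (simp add: L2_ip_def mult.commute)
  show "L2_ip a b (u + v) w = L2_ip a b u w + L2_ip a b v w"
    by (simp add: L2_ip_def distrib_right integral_add)
  show "L2_ip a b (r *\<^sub>R u) v = r * L2_ip a b u v"
    by (simp add: L2_ip_def mult.assoc)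
  show "0 \<le> L2_ip a b u u"
    unfolding L2_ip_def by (intro integral_nonneg) auto
qed

definition clamp_ext :: "real \<Rightarrow> (real \<Rightarrow> real) \<Rightarrow> cfun" where
  "clamp_ext l f = Bcontfun (\<lambda>x. f (max 0 (min l x)))"

lemma clamp_ext_apply:
  assumes "0 < l" "continuous_on {0..l} f"
  shows "apply_bcontfun (clamp_ext l f) x = f (max 0 (min l x))"
proof -
  have "continuous_on UNIV (\<lambda>x. f (max 0 (min l x)))"
    by (rule continuous_on_compose2[OF assms(2)]) (use assms(1) in \<open>auto intro!: continuous_intros\<close>)
  moreover have "bounded (f ` {0..l})"
    using assms(2) by (intro compact_imp_bounded compact_continuous_image) auto
  then have "bounded (range (\<lambda>x. f (max 0 (min l x))))"
    by (rule bounded_subset) (use assms(1) in auto)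
  ultimately show ?thesis unfolding clamp_ext_def by (subst Bcontfun_inverse) (auto simp: bcontfun_def)
qed

lemma clamp_ext_on:
  assumes "0 < l" "continuous_on {0..l} f" "x \<in> {0..l}"
  shows "apply_bcontfun (clamp_ext l f) x = f x"
  using assms by (simp add: clamp_ext_apply)

lemma L2_ip_null:
  assumes "0 < l" "L2_ip 0 l u u = 0" "x \<in> {0..l}"
  shows "apply_bcontfun u x = 0"
proof -
  have "continuous_on {0..l} (\<lambda>x. u x * u x)"
    by (intro continuous_intros continuous_on_apply_bcontfun)
  from integral_eq_0_iff[OF this assms(1)] assms show ?thesis by (simp add: L2_ip_def)
qed

section \<open>The second derivative with Dirichlet conditions\<close>

text \<open>
  The classical counterpart of \<open>Lop\<close> with zero potential, up to sign: the graph of the second derivative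
  on twice continuously differentiable functions that vanish at both ends.
\<close>

definition dirichlet2 :: "real \<Rightarrow> (real \<Rightarrow> real) \<Rightarrow> (real \<Rightarrow> real) \<Rightarrow> bool" where
  "dirichlet2 l u w \<longleftrightarrow> u 0 = 0 \<and> u l = 0 \<and> continuous_on {0..l} w \<and>
     (\<exists>v. \<forall>x\<in>{0..l}. (u has_real_derivative v x) (at x within {0..l}) \<and>
                      (v has_real_derivative w x) (at x within {0..l}))"

lemma dirichlet2_cong:
  assumes "dirichlet2 l u w" "\<And>x. x \<in> {0..l} \<Longrightarrow> u' x = u x" "\<And>x. x \<in> {0..l} \<Longrightarrow> w' x = w x" "0 < l"
  shows "dirichlet2 l u' w'"
proof -
  obtain v where v: "\<And>x. x \<in> {0..l} \<Longrightarrow> (u has_real_derivative v x) (at x within {0..l})"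
    "\<And>x. x \<in> {0..l} \<Longrightarrow> (v has_real_derivative w x) (at x within {0..l})"
    using assms(1) unfolding dirichlet2_def by blast
  have "(u' has_real_derivative v x) (at x within {0..l})" if "x \<in> {0..l}" for x
    by (rule has_field_derivative_transform_within[OF v(1)[OF that] zero_less_one that]) (use assms(2) in auto)
  moreover have "continuous_on {0..l} w'"
  proof (rule continuous_on_eq)
    show "continuous_on {0..l} w" using assms(1) unfolding dirichlet2_def by blast
  qed (simp add: assms(3))
  ultimately show ?thesis
    using assms v(2) unfolding dirichlet2_def by (auto intro!: exI[of _ v])
qed

lemma dirichlet2_zero: "dirichlet2 l (\<lambda>_. 0) (\<lambda>_. 0)"
  unfolding dirichlet2_def by (auto intro!: exI[of _ "\<lambda>_. 0"] derivative_eq_intros)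

lemma dirichlet2_add:
  assumes "dirichlet2 l u w" "dirichlet2 l u' w'"
  shows "dirichlet2 l (\<lambda>x. u x + u' x) (\<lambda>x. w x + w' x)"
proof -
  obtain v v' where "\<forall>x\<in>{0..l}. (u has_real_derivative v x) (at x within {0..l}) \<and> (v has_real_derivative w x) (at x within {0..l})"
    "\<forall>x\<in>{0..l}. (u' has_real_derivative v' x) (at x within {0..l}) \<and> (v' has_real_derivative w' x) (at x within {0..l})"
    using assms unfolding dirichlet2_def by blast
  then show ?thesis using assms unfolding dirichlet2_def
    by (auto intro!: exI[of _ "\<lambda>x. v x + v' x"] DERIV_add continuous_intros)
qed

lemma dirichlet2_scale:
  assumes "dirichlet2 l u w"
  shows "dirichlet2 l (\<lambda>x. r * u x) (\<lambda>x. r * w x)"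
proof -
  obtain v where "\<forall>x\<in>{0..l}. (u has_real_derivative v x) (at x within {0..l}) \<and> (v has_real_derivative w x) (at x within {0..l})"
    using assms unfolding dirichlet2_def by blast
  then show ?thesis using assms unfolding dirichlet2_def
    by (auto intro!: exI[of _ "\<lambda>x. r * v x"] DERIV_cmult continuous_intros)
qed

lemma dirichlet2_continuous:
  assumes "dirichlet2 l u w"
  shows "continuous_on {0..l} u" "continuous_on {0..l} w"
  using assms DERIV_continuous_on[of "{0..l}" u] unfolding dirichlet2_def by blast+

lemma dirichlet2_green:
  assumes "dirichlet2 l u w" "dirichlet2 l z y" "0 < l"
  shows "integral {0..l} (\<lambda>x. w x * z x) = integral {0..l} (\<lambda>x. u x * y x)"
proof -
  obtain v v' where v: "\<And>x. x\<in>{0..l} \<Longrightarrow> (u has_real_derivative v x) (at x within {0..l})"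
     "\<And>x. x\<in>{0..l} \<Longrightarrow> (v has_real_derivative w x) (at x within {0..l})"
    "\<And>x. x\<in>{0..l} \<Longrightarrow> (z has_real_derivative v' x) (at x within {0..l})"
    "\<And>x. x\<in>{0..l} \<Longrightarrow> (v' has_real_derivative y x) (at x within {0..l})"
    using assms unfolding dirichlet2_def by metis
  have bc: "u 0 = 0" "u l = 0" "z 0 = 0" "z l = 0" using assms unfolding dirichlet2_def by auto
  have "((\<lambda>x. w x * z x - u x * y x) has_integral (v l * z l - u l * v' l) - (v 0 * z 0 - u 0 * v' 0)) {0..l}"
  proof (rule fundamental_theorem_of_calculus)
    fix x assume x: "x \<in> {0..l}"
    show "((\<lambda>x. v x * z x - u x * v' x) has_vector_derivative w x * z x - u x * y x) (at x within {0..l})"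
      unfolding has_real_derivative_iff_has_vector_derivative[symmetric]
      using v[OF x] by (auto intro!: derivative_eq_intros)
  qed (use assms in auto)
  then have "integral {0..l} (\<lambda>x. w x * z x - u x * y x) = 0" using bc by (auto dest: integral_unique)
  moreover have "(\<lambda>x. w x * z x) integrable_on {0..l}" "(\<lambda>x. u x * y x) integrable_on {0..l}"
    using dirichlet2_continuous[OF assms(1)] dirichlet2_continuous[OF assms(2)]
    by (auto intro!: integrable_continuous_interval continuous_intros)
  ultimately show ?thesis by (simp add: integral_diff)
qed

text \<open>
  The last factor is the Dirichlet energy of \<open>u\<close>, integrated by parts, and the inequality is
  Cauchy-Schwarz for \<open>u y - u x\<close> as an integral of the derivative. It yields the coercivity of
  Schroedinger operators (the left-hand side is nonnegative), uniform bounds (\<open>x = 0\<close>) and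
  equicontinuity.
\<close>

lemma dirichlet2_holder:
  assumes "dirichlet2 l u w" "0 < l" "x \<in> {0..l}" "y \<in> {0..l}"
  shows "(u y - u x)\<^sup>2 \<le> \<bar>y - x\<bar> * (- integral {0..l} (\<lambda>x. w x * u x))"
proof -
  obtain v where v: "\<And>x. x\<in>{0..l} \<Longrightarrow> (u has_real_derivative v x) (at x within {0..l})"
     "\<And>x. x\<in>{0..l} \<Longrightarrow> (v has_real_derivative w x) (at x within {0..l})"
    using assms unfolding dirichlet2_def by metis
  have bc: "u 0 = 0" "u l = 0" using assms unfolding dirichlet2_def by auto
  have cu: "continuous_on {0..l} u" "continuous_on {0..l} w" using dirichlet2_continuous[OF assms(1)] .
  have cv: "continuous_on {0..l} v" using v(2) by (rule DERIV_continuous_on)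
  have "((\<lambda>x. w x * u x + v x * v x) has_integral v l * u l - v 0 * u 0) {0..l}"
  proof (rule fundamental_theorem_of_calculus)
    fix x assume x: "x \<in> {0..l}"
    show "((\<lambda>x. v x * u x) has_vector_derivative w x * u x + v x * v x) (at x within {0..l})"
      unfolding has_real_derivative_iff_has_vector_derivative[symmetric]
      using v[OF x] by (auto intro!: derivative_eq_intros)
  qed (use assms in auto)
  then have "integral {0..l} (\<lambda>x. w x * u x + v x * v x) = 0" using bc by (auto dest: integral_unique)
  moreover have "(\<lambda>x. w x * u x) integrable_on {0..l}" and iv: "(\<lambda>x. v x * v x) integrable_on {0..l}"
    using cu cv by (auto intro!: integrable_continuous_interval continuous_intros)
  ultimately have energy: "integral {0..l} (\<lambda>x. v x * v x) = - integral {0..l} (\<lambda>x. w x * u x)"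
    by (simp add: integral_add)
  have main: "(u b - u a)\<^sup>2 \<le> (b - a) * (- integral {0..l} (\<lambda>x. w x * u x))"
    if ab: "0 \<le> a" "a \<le> b" "b \<le> l" for a b
  proof -
    define V where "V = clamp_ext l v"
    have V: "apply_bcontfun V t = v t" if "t \<in> {a..b}" for t
      using clamp_ext_on[OF assms(2) cv, of t] that ab by (simp add: V_def)
    have "(v has_integral u b - u a) {a..b}"
    proof (rule fundamental_theorem_of_calculus)
      fix t assume "t \<in> {a..b}"
      then have "(u has_real_derivative v t) (at t within {a..b})"
        using ab by (intro DERIV_subset[OF v(1)[of t]]) auto
      then show "(u has_vector_derivative v t) (at t within {a..b})"
        by (simp add: has_real_derivative_iff_has_vector_derivative)
    qed (rule ab)
    then have "u b - u a = integral {a..b} v" by (simp add: integral_unique)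
    also have "\<dots> = L2_ip a b V (const_bcontfun 1)"
      unfolding L2_ip_def using V by (intro integral_cong) (auto simp: const_bcontfun.rep_eq)
    finally have "(u b - u a)\<^sup>2 \<le> L2_ip a b V V * L2_ip a b (const_bcontfun 1) (const_bcontfun 1)"
      using L2.cauchy_schwarz by metis
    also have "L2_ip a b (const_bcontfun 1) (const_bcontfun 1) = b - a"
      unfolding L2_ip_def using ab by (simp add: const_bcontfun.rep_eq)
    also have "L2_ip a b V V = integral {a..b} (\<lambda>x. v x * v x)"
      unfolding L2_ip_def using V by (intro integral_cong) auto
    also have "integral {a..b} (\<lambda>x. v x * v x) * (b - a) \<le> integral {0..l} (\<lambda>x. v x * v x) * (b - a)"
    proof (intro mult_right_mono integral_subset_le iv)
      show "(\<lambda>x. v x * v x) integrable_on {a..b}" by (rule integrable_subinterval_real[OF iv]) (use ab in auto)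
    qed (use ab in auto)
    finally show ?thesis by (simp add: energy mult.commute)
  qed
  show ?thesis
  proof (cases "x \<le> y")
    case True
    then show ?thesis using main[of x y] assms by auto
  next
    case False
    then show ?thesis using main[of y x] assms by (auto simp: power2_commute)
  qed
qed

text \<open>
  The solution of \<open>- u'' + k\<^sup>2 u = f\<close> with Dirichlet conditions, written with the Green function.
\<close>

definition dirichlet_green :: "real \<Rightarrow> real \<Rightarrow> (real \<Rightarrow> real) \<Rightarrow> real \<Rightarrow> real" where
  "dirichlet_green l k f x =
     (sinh (k * (l - x)) * integral {0..x} (\<lambda>y. sinh (k * y) * f y) +
      sinh (k * x) * integral {x..l} (\<lambda>y. sinh (k * (l - y)) * f y)) / (k * sinh (k * l))"

lemma dirichlet_green_solves:
  assumes "0 < l" "0 < k" "continuous_on {0..l} f"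
  shows "dirichlet2 l (dirichlet_green l k f) (\<lambda>x. k\<^sup>2 * dirichlet_green l k f x - f x)"
proof -
  define I where "I x = integral {0..x} (\<lambda>y. sinh (k * y) * f y)" for x
  define J where "J x = integral {x..l} (\<lambda>y. sinh (k * (l - y)) * f y)" for x
  define d where "d = k * sinh (k * l)"
  have d: "d \<noteq> 0" "sinh (k * l) \<noteq> 0" using assms by (auto simp: d_def)
  have u: "dirichlet_green l k f = (\<lambda>x. (sinh (k * (l - x)) * I x + sinh (k * x) * J x) / d)"
    by (simp add: fun_eq_iff dirichlet_green_def I_def J_def d_def)
  define v where "v x = (- k * cosh (k * (l - x)) * I x + k * cosh (k * x) * J x) / d" for x
  have I: "(I has_real_derivative sinh (k * x) * f x) (at x within {0..l})" if "x \<in> {0..l}" for x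
    unfolding I_def by (rule integral_has_real_derivative) (use that assms in \<open>auto intro!: continuous_intros\<close>)
  have J: "(J has_real_derivative - (sinh (k * (l - x)) * f x)) (at x within {0..l})" if "x \<in> {0..l}" for x
    unfolding J_def by (rule integral_has_real_derivative') (use that assms in \<open>auto intro!: continuous_intros\<close>)
  have "(dirichlet_green l k f has_real_derivative v x) (at x within {0..l})" if x: "x \<in> {0..l}" for x
    unfolding u v_def using d(1)
    by (auto intro!: derivative_eq_intros I[OF x] J[OF x] simp: field_simps)
  moreover have "(v has_real_derivative k\<^sup>2 * dirichlet_green l k f x - f x) (at x within {0..l})"
    if x: "x \<in> {0..l}" for x
  proof -
    have "(v has_real_derivative
       (k\<^sup>2 * (sinh (k * (l - x)) * I x + sinh (k * x) * J x)
         - k * (sinh (k * x) * cosh (k * (l - x)) + cosh (k * x) * sinh (k * (l - x))) * f x) / d)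
       (at x within {0..l})"
      unfolding v_def using d(1)
      by (auto intro!: derivative_eq_intros I[OF x] J[OF x] simp: field_simps power2_eq_square)
    also have "sinh (k * x) * cosh (k * (l - x)) + cosh (k * x) * sinh (k * (l - x)) = sinh (k * l)"
      using sinh_add[of "k * x" "k * (l - x)"] by (simp add: right_diff_distrib)
    also have "(k\<^sup>2 * (sinh (k * (l - x)) * I x + sinh (k * x) * J x) - k * sinh (k * l) * f x) / d
        = k\<^sup>2 * dirichlet_green l k f x - f x"
      using d(1) by (simp add: u diff_divide_distrib flip: d_def)
    finally show ?thesis .
  qed
  moreover have "dirichlet_green l k f 0 = 0" "dirichlet_green l k f l = 0"
    by (simp_all add: dirichlet_green_def)
  moreover from calculation(1) have "continuous_on {0..l} (dirichlet_green l k f)"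
    by (rule DERIV_continuous_on)
  then have "continuous_on {0..l} (\<lambda>x. k\<^sup>2 * dirichlet_green l k f x - f x)"
    using assms by (intro continuous_intros)
  ultimately show ?thesis unfolding dirichlet2_def by blast
qed

text \<open>
  The constant \<open>1 / k\<^sup>2\<close> is what makes a fixed-point iteration contract once \<open>k\<^sup>2\<close> exceeds the norm of
  the potential.
\<close>

lemma dirichlet_green_bound:
  assumes "0 < l" "0 < k" "continuous_on {0..l} f" "\<And>y. y \<in> {0..l} \<Longrightarrow> \<bar>f y\<bar> \<le> M" "x \<in> {0..l}"
  shows "\<bar>dirichlet_green l k f x\<bar> \<le> M / k\<^sup>2"
proof -
  have M: "0 \<le> M" using assms(4)[of 0] assms(1) by auto
  have pos: "sinh (k * l) > 0" "sinh (k * x) \<ge> 0" "sinh (k * (l - x)) \<ge> 0" using assms by auto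
  have I: "((\<lambda>y. sinh (k * y) * M) has_integral cosh (k * x) * M / k - cosh (k * 0) * M / k) {0..x}"
    by (rule fundamental_theorem_of_calculus)
      (use assms in \<open>auto intro!: derivative_eq_intros simp flip: has_real_derivative_iff_has_vector_derivative\<close>)
  have J: "((\<lambda>y. sinh (k * (l - y)) * M) has_integral - (cosh (k * (l - l)) * M / k) - - (cosh (k * (l - x)) * M / k)) {x..l}"
    by (rule fundamental_theorem_of_calculus)
      (use assms in \<open>auto intro!: derivative_eq_intros simp flip: has_real_derivative_iff_has_vector_derivative\<close>)
  have 1: "\<bar>integral {0..x} (\<lambda>y. sinh (k * y) * f y)\<bar> \<le> cosh (k * x) * M / k - M / k"
  proof -
    have "norm (integral {0..x} (\<lambda>y. sinh (k * y) * f y)) \<le> integral {0..x} (\<lambda>y. sinh (k * y) * M)"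
    proof (rule integral_norm_bound_integral)
      show "(\<lambda>y. sinh (k * y) * f y) integrable_on {0..x}"
        using assms by (auto intro!: integrable_continuous_interval continuous_intros intro: continuous_on_subset)
      show "(\<lambda>y. sinh (k * y) * M) integrable_on {0..x}" using I by blast
      show "norm (sinh (k * y) * f y) \<le> sinh (k * y) * M" if "y \<in> {0..x}" for y
        using assms that by (auto simp: abs_mult intro!: mult_mono)
    qed
    then show ?thesis using integral_unique[OF I] by simp
  qed
  have 2: "\<bar>integral {x..l} (\<lambda>y. sinh (k * (l - y)) * f y)\<bar> \<le> cosh (k * (l - x)) * M / k - M / k"
  proof -
    have "norm (integral {x..l} (\<lambda>y. sinh (k * (l - y)) * f y)) \<le> integral {x..l} (\<lambda>y. sinh (k * (l - y)) * M)"
    proof (rule integral_norm_bound_integral)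
      show "(\<lambda>y. sinh (k * (l - y)) * f y) integrable_on {x..l}"
        using assms by (auto intro!: integrable_continuous_interval continuous_intros intro: continuous_on_subset)
      show "(\<lambda>y. sinh (k * (l - y)) * M) integrable_on {x..l}" using J by blast
      show "norm (sinh (k * (l - y)) * f y) \<le> sinh (k * (l - y)) * M" if "y \<in> {x..l}" for y
        using assms that by (auto simp: abs_mult intro!: mult_mono)
    qed
    then show ?thesis using integral_unique[OF J] by simp
  qed
  have "\<bar>sinh (k * (l - x)) * integral {0..x} (\<lambda>y. sinh (k * y) * f y) +
      sinh (k * x) * integral {x..l} (\<lambda>y. sinh (k * (l - y)) * f y)\<bar>
    \<le> sinh (k * (l - x)) * (cosh (k * x) * M / k - M / k) + sinh (k * x) * (cosh (k * (l - x)) * M / k - M / k)"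
    by (intro order_trans[OF abs_triangle_ineq] add_mono)
       (use 1 2 pos in \<open>auto simp: abs_mult intro!: mult_left_mono\<close>)
  also have "\<dots> = M / k * (sinh (k * x) * cosh (k * (l - x)) + cosh (k * x) * sinh (k * (l - x)))
      - M / k * (sinh (k * (l - x)) + sinh (k * x))"
  proof -
    have "s * (c * M / k - M / k) + t * (c' * M / k - M / k) = M / k * (t * c' + c * s) - M / k * (s + t)"
      for s t c c' :: real using assms(2) by (simp add: field_simps)
    then show ?thesis .
  qed
  also have "sinh (k * x) * cosh (k * (l - x)) + cosh (k * x) * sinh (k * (l - x)) = sinh (k * l)"
    using sinh_add[of "k * x" "k * (l - x)"] by (simp add: right_diff_distrib)
  also have "M / k * sinh (k * l) - M / k * (sinh (k * (l - x)) + sinh (k * x)) \<le> M / k * sinh (k * l)"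
    using M pos assms(2) by simp
  finally have "\<bar>sinh (k * (l - x)) * integral {0..x} (\<lambda>y. sinh (k * y) * f y) +
      sinh (k * x) * integral {x..l} (\<lambda>y. sinh (k * (l - y)) * f y)\<bar> \<le> M / k * sinh (k * l)" .
  then show ?thesis using pos(1) assms(2)
    by (simp add: dirichlet_green_def field_simps power2_eq_square abs_mult)
qed

lemma dirichlet_green_diff:
  assumes "x \<in> {0..l}" "continuous_on {0..l} f" "continuous_on {0..l} g"
  shows "dirichlet_green l k (\<lambda>y. f y - g y) x = dirichlet_green l k f x - dirichlet_green l k g x"
proof -
  have gen: "(s * (a - b) + t * (c - d)) / q = (s * a + t * c) / q - (s * b + t * d) / q"
    for s t a b c d q :: real by (simp add: algebra_simps add_divide_distrib diff_divide_distrib)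
  have 1: "integral {0..x} (\<lambda>y. sinh (k * y) * (f y - g y))
     = integral {0..x} (\<lambda>y. sinh (k * y) * f y) - integral {0..x} (\<lambda>y. sinh (k * y) * g y)"
    unfolding right_diff_distrib using assms
    by (intro integral_diff integrable_continuous_interval continuous_intros)
       (auto intro: continuous_on_subset)
  have 2: "integral {x..l} (\<lambda>y. sinh (k * (l - y)) * (f y - g y))
     = integral {x..l} (\<lambda>y. sinh (k * (l - y)) * f y) - integral {x..l} (\<lambda>y. sinh (k * (l - y)) * g y)"
    unfolding right_diff_distrib using assms
    by (intro integral_diff integrable_continuous_interval continuous_intros)
       (auto intro: continuous_on_subset)
  show ?thesis unfolding dirichlet_green_def 1 2 by (rule gen)
qed

section \<open>Schroedinger operators with bounded symmetric potentials\<close>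

text \<open>
  The graph of \<open>- u'' + S u\<close>. The potential \<open>S\<close> need not be a multiplication operator: the pencil
  \<open>- u'' - q u + \<mu> G u\<close> with the nonlocal term \<open>G\<close> is of this kind too.
\<close>

definition schrodinger_op :: "real \<Rightarrow> (cfun \<Rightarrow> cfun) \<Rightarrow> cfun \<Rightarrow> cfun \<Rightarrow> bool" where
  "schrodinger_op l S u f \<longleftrightarrow> dirichlet2 l u (\<lambda>x. S u x - f x)"

text \<open>
  The \<open>L\<^sup>2\<close> bound serves the estimates of quadratic forms, the supremum bound the
  construction of the resolvent by iteration in the Banach space of continuous functions.
\<close>

locale bounded_symmetric_potential =
  fixes l :: real and S :: "cfun \<Rightarrow> cfun" and C :: real
  assumes l: "0 < l" and C: "0 \<le> C"
    and S_add: "S (u + v) = S u + S v"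
    and S_scaleR: "S (r *\<^sub>R u) = r *\<^sub>R S u"
    and S_sym: "L2_ip 0 l (S u) v = L2_ip 0 l u (S v)"
    and S_L2: "L2_ip 0 l (S u) (S u) \<le> C\<^sup>2 * L2_ip 0 l u u"
    and S_sup: "norm (S u) \<le> C * norm u"
begin

abbreviation "L \<equiv> schrodinger_op l S"

lemma form_identity:
  assumes "L u f"
  shows "L2_ip 0 l f v = L2_ip 0 l (S u) v - integral {0..l} (\<lambda>x. (S u x - f x) * v x)"
proof -
  have "integral {0..l} (\<lambda>x. (S u x - f x) * v x) = L2_ip 0 l (S u) v - L2_ip 0 l f v"
    unfolding L2_ip_def left_diff_distrib by (intro integral_diff cfun_integrable)
  then show ?thesis by simp
qed

lemma symmetric: "L2.symmetric_op 0 l L"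
  unfolding L2.symmetric_op_def
proof (intro conjI allI impI; (elim conjE)?)
  show "L 0 0"
    unfolding schrodinger_op_def using S_scaleR[of 0 0]
    by (intro dirichlet2_cong[OF dirichlet2_zero[of l]]) (use l in auto)
next
  fix u f v g assume "L u f" "L v g"
  from dirichlet2_add[OF this[unfolded schrodinger_op_def]] show "L (u + v) (f + g)"
    unfolding schrodinger_op_def
    by (rule dirichlet2_cong) (use l in \<open>auto simp: S_add\<close>)
next
  fix r u f assume "L u f"
  from dirichlet2_scale[OF this[unfolded schrodinger_op_def], of r] show "L (r *\<^sub>R u) (r *\<^sub>R f)"
    unfolding schrodinger_op_def
    by (rule dirichlet2_cong) (use l in \<open>auto simp: S_scaleR right_diff_distrib\<close>)
next
  fix u f v g assume *: "L u f" "L v g"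
  have "L2_ip 0 l f v = L2_ip 0 l (S u) v - integral {0..l} (\<lambda>x. (S u x - f x) * v x)"
    by (rule form_identity[OF *(1)])
  also have "integral {0..l} (\<lambda>x. (S u x - f x) * v x) = integral {0..l} (\<lambda>x. u x * (S v x - g x))"
    using * l unfolding schrodinger_op_def by (intro dirichlet2_green)
  also have "\<dots> = integral {0..l} (\<lambda>x. (S v x - g x) * u x)" by (simp add: mult.commute)
  also have "L2_ip 0 l (S u) v - \<dots> = L2_ip 0 l g u"
    using form_identity[OF *(2), of u] S_sym[of u v] L2.ip_commute[of 0 l u "S v"] by simp
  finally show "L2_ip 0 l f v = L2_ip 0 l u g" by (simp add: L2.ip_commute)
next
  fix u f f' assume *: "L u f" "L2_ip 0 l (f - f') (f - f') = 0"
  have "f x = f' x" if "x \<in> {0..l}" for x using L2_ip_null[OF l *(2) that] by simp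
  then show "L u f'" using dirichlet2_cong[OF *(1)[unfolded schrodinger_op_def], of u "\<lambda>x. S u x - f' x"] l
    unfolding schrodinger_op_def by simp
qed

lemma S_form: "\<bar>L2_ip 0 l (S u) u\<bar> \<le> C * L2_ip 0 l u u"
  by (rule L2.ip_le_of_bound[OF S_L2 C])

lemma holder:
  assumes "L u f" "x \<in> {0..l}" "y \<in> {0..l}"
  shows "(u y - u x)\<^sup>2 \<le> \<bar>y - x\<bar> * (L2_ip 0 l f u + C * L2_ip 0 l u u)"
proof -
  have "(u y - u x)\<^sup>2 \<le> \<bar>y - x\<bar> * (- integral {0..l} (\<lambda>x. (S u x - f x) * u x))"
    using assms l unfolding schrodinger_op_def by (intro dirichlet2_holder)
  also have "\<dots> \<le> \<bar>y - x\<bar> * (L2_ip 0 l f u + C * L2_ip 0 l u u)"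
    using form_identity[OF assms(1), of u] S_form[of u] by (intro mult_left_mono) auto
  finally show ?thesis .
qed

lemma coercive:
  assumes "L u f"
  shows "0 \<le> L2_ip 0 l f u + C * L2_ip 0 l u u"
proof -
  have "0 \<le> (u l - u 0)\<^sup>2" by simp
  also have "\<dots> \<le> \<bar>l - 0\<bar> * (L2_ip 0 l f u + C * L2_ip 0 l u u)"
    using l by (intro holder[OF assms]) auto
  finally show ?thesis using l by (simp add: zero_le_mult_iff)
qed

text \<open>
  \<open>- u'' + S u + (C + 1) u = f\<close> is the fixed-point equation \<open>u = dirichlet_green l k (f - S u)\<close> for
  \<open>k\<^sup>2 = C + 1\<close>, a contraction with factor \<open>C / (C + 1)\<close>.
\<close>

lemma resolvent_surjective: "\<exists>u. L u (f - (C + 1) *\<^sub>R u)"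
proof -
  define k where "k = sqrt (C + 1)"
  have k: "k > 0" "k\<^sup>2 = C + 1" using C by (auto simp: k_def)
  define T where "T u = clamp_ext l (dirichlet_green l k (apply_bcontfun (f - S u)))" for u
  have sol: "dirichlet2 l (dirichlet_green l k (apply_bcontfun g))
      (\<lambda>x. k\<^sup>2 * dirichlet_green l k (apply_bcontfun g) x - g x)" for g :: cfun
    by (intro dirichlet_green_solves l k continuous_on_apply_bcontfun)
  note cont = dirichlet2_continuous(1)[OF sol]
  have T: "T u x = dirichlet_green l k (apply_bcontfun (f - S u)) (max 0 (min l x))" for u x
    unfolding T_def by (rule clamp_ext_apply[OF l cont])
  have "\<exists>!u. T u = u"
  proof (rule banach_fix_type)
    show "0 \<le> C / (C + 1)" "C / (C + 1) < 1" using C by auto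
    show "\<forall>u v. dist (T u) (T v) \<le> C / (C + 1) * dist u v"
    proof (intro allI)
      fix u v
      have "dist (T u x) (T v x) \<le> C / (C + 1) * dist u v" for x
      proof -
        define y where "y = max 0 (min l x)"
        have y: "y \<in> {0..l}" using l by (auto simp: y_def)
        have eq: "(f - S u) z - (f - S v) z = - S (u - v) z" for z
          using S_add[of u "(-1) *\<^sub>R v"] S_scaleR[of "-1" v] by simp
        have "T u x - T v x = dirichlet_green l k (\<lambda>z. (f - S u) z - (f - S v) z) y"
          unfolding T y_def[symmetric]
          by (rule dirichlet_green_diff[OF y, symmetric]) (auto simp del: minus_bcontfun.rep_eq)
        also have "\<bar>\<dots>\<bar> \<le> (C * norm (u - v)) / k\<^sup>2"
        proof (rule dirichlet_green_bound[OF l k(1) _ _ y])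
          show "continuous_on {0..l} (\<lambda>z. (f - S u) z - (f - S v) z)"
            by (intro continuous_intros continuous_on_apply_bcontfun)
          show "\<bar>(f - S u) z - (f - S v) z\<bar> \<le> C * norm (u - v)" for z
            unfolding eq using norm_bounded[of "S (u - v)" z] S_sup[of "u - v"] by simp
        qed
        finally show ?thesis by (simp add: dist_real_def dist_norm k)
      qed
      then show "dist (T u) (T v) \<le> C / (C + 1) * dist u v" by (rule dist_bound)
    qed
  qed
  then obtain u where u: "T u = u" by blast
  have ux: "u x = dirichlet_green l k (apply_bcontfun (f - S u)) x" if "x \<in> {0..l}" for x
    using T[of u x] that u by simp
  have "dirichlet2 l u (\<lambda>x. S u x - (f - (C + 1) *\<^sub>R u) x)"
    by (rule dirichlet2_cong[OF sol[of "f - S u"]]) (use ux k l in \<open>auto simp: algebra_simps\<close>)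
  then show ?thesis unfolding schrodinger_op_def by blast
qed

text \<open>
  The energy of the solutions is bounded by the \<open>L\<^sup>2\<close> norm of the data, so they are uniformly
  bounded and equicontinuous, and the theorem of Arzela and Ascoli applies.
\<close>

lemma resolvent_compact:
  assumes R: "\<And>n::nat. L (u n) (f n - (C + 1) *\<^sub>R u n)" and B: "\<And>n. L2_ip 0 l (f n) (f n) \<le> B"
  shows "\<exists>r v. strict_mono r \<and> (\<lambda>n. L2_ip 0 l (u (r n) - v) (u (r n) - v)) \<longlonglongrightarrow> 0"
proof -
  have B0: "0 \<le> B" using B[of 0] L2.ip_self_nonneg[of 0 l "f 0"] by linarith
  have h: "(u n y - u n x)\<^sup>2 \<le> \<bar>y - x\<bar> * B" if "x \<in> {0..l}" "y \<in> {0..l}" for n x y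
  proof -
    have "(u n y - u n x)\<^sup>2 \<le> \<bar>y - x\<bar> * (L2_ip 0 l (f n - (C + 1) *\<^sub>R u n) (u n) + C * L2_ip 0 l (u n) (u n))"
      by (rule holder[OF R that])
    also have "\<dots> \<le> \<bar>y - x\<bar> * B"
    proof (rule mult_left_mono)
      have "L2_ip 0 l (f n - (C + 1) *\<^sub>R u n) (u n) + C * L2_ip 0 l (u n) (u n)
          = L2_ip 0 l (f n) (u n) - L2_ip 0 l (u n) (u n)"
        by (simp add: L2.ip_linear algebra_simps)
      also have "\<dots> \<le> L2_ip 0 l (f n) (f n)"
        using L2.ip_self_nonneg[of 0 l "f n - u n"] L2.ip_self_nonneg[of 0 l "f n"] L2.ip_self_nonneg[of 0 l "u n"]
        by (simp only: L2.ip_diff_self)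
      finally show "L2_ip 0 l (f n - (C + 1) *\<^sub>R u n) (u n) + C * L2_ip 0 l (u n) (u n) \<le> B"
        using B[of n] by linarith
    qed simp
    finally show ?thesis .
  qed
  have u0: "u n 0 = 0" for n using R[of n] unfolding schrodinger_op_def dirichlet2_def by blast
  obtain g r where g: "continuous_on {0..l} g" and r: "strict_mono (r :: nat \<Rightarrow> nat)" and
    lim: "\<And>e. 0 < e \<Longrightarrow> \<exists>N. \<forall>n x. n \<ge> N \<and> x \<in> {0..l} \<longrightarrow> norm (apply_bcontfun (u (r n)) x - g x) < e"
  proof (rule Arzela_Ascoli[of "{0..l}" "\<lambda>n. apply_bcontfun (u n)" "sqrt (l * B)"])
    show "norm (u n x) \<le> sqrt (l * B)" if "x \<in> {0..l}" for n x
    proof -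
      have "(u n x)\<^sup>2 \<le> \<bar>x - 0\<bar> * B" using h[of 0 x n] that l u0[of n] by simp
      also have "\<dots> \<le> l * B" using that B0 by (intro mult_right_mono) auto
      finally have "sqrt ((u n x)\<^sup>2) \<le> sqrt (l * B)" by (rule real_sqrt_le_mono)
      then show ?thesis by simp
    qed
    show "\<exists>d. 0 < d \<and> (\<forall>n y. y \<in> {0..l} \<and> norm (x - y) < d \<longrightarrow> norm (u n x - u n y) < e)"
      if x: "x \<in> {0..l}" and e: "0 < e" for x e
    proof (intro exI[of _ "e\<^sup>2 / (B + 1)"] conjI allI impI)
      show "0 < e\<^sup>2 / (B + 1)" using e B0 by simp
      fix n y assume y: "y \<in> {0..l} \<and> norm (x - y) < e\<^sup>2 / (B + 1)"
      have "(u n x - u n y)\<^sup>2 \<le> \<bar>x - y\<bar> * B" using h x y by blast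
      also have "\<dots> \<le> e\<^sup>2 / (B + 1) * B" using y B0 by (intro mult_right_mono) auto
      also have "\<dots> < e\<^sup>2" using e B0 by (simp add: field_simps)
      finally have "\<bar>u n x - u n y\<bar>\<^sup>2 < e\<^sup>2" by simp
      then show "norm (u n x - u n y) < e" using power2_less_imp_less[of "\<bar>u n x - u n y\<bar>" e] e by simp
    qed
  qed auto
  define v where "v = clamp_ext l g"
  have v: "v x = g x" if "x \<in> {0..l}" for x unfolding v_def by (rule clamp_ext_on[OF l g that])
  have "(\<lambda>n. L2_ip 0 l (u (r n) - v) (u (r n) - v)) \<longlonglongrightarrow> 0"
  proof (rule LIMSEQ_I)
    fix e :: real assume e: "0 < e"
    define d where "d = sqrt (e / (l + 1))"
    have d: "d > 0" "d * d = e / (l + 1)" using e l by (auto simp: d_def)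
    obtain N where N: "\<And>n x. n \<ge> N \<Longrightarrow> x \<in> {0..l} \<Longrightarrow> norm (u (r n) x - g x) < d" using lim[OF d(1)] by blast
    have "norm (L2_ip 0 l (u (r n) - v) (u (r n) - v) - 0) < e" if n: "n \<ge> N" for n
    proof -
      have "L2_ip 0 l (u (r n) - v) (u (r n) - v) \<le> integral {0..l} (\<lambda>_. d * d)"
        unfolding L2_ip_def
      proof (intro integral_le cfun_integrable)
        fix x assume x: "x \<in> {0..l}"
        have "\<bar>(u (r n) - v) x\<bar> \<le> d" using N[OF n x] v[OF x] by simp
        then have "\<bar>(u (r n) - v) x\<bar> * \<bar>(u (r n) - v) x\<bar> \<le> d * d" by (intro mult_mono) auto
        then show "(u (r n) - v) x * (u (r n) - v) x \<le> d * d" by (simp only: abs_mult_self_eq)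
      qed auto
      also have "\<dots> = l * (e / (l + 1))" using l d by simp
      also have "\<dots> < e" using l e by (simp add: field_simps)
      finally show ?thesis using L2.ip_self_nonneg[of 0 l "u (r n) - v"] by simp
    qed
    then show "\<exists>N. \<forall>n\<ge>N. norm (L2_ip 0 l (u (r n) - v) (u (r n) - v) - 0) < e" by blast
  qed
  with r show ?thesis by blast
qed

lemma gap_eigensystem_ex: "\<exists>E \<delta>. L2.gap_eigensystem 0 l L E \<delta>"
proof (rule L2.gap_eigensystem_exists[OF symmetric])
  show "0 < C + 1" using C by simp
  show "L2_ip 0 l u u \<le> L2_ip 0 l f u + (C + 1) * L2_ip 0 l u u" if "L u f" for u f
    using coercive[OF that] by (simp add: algebra_simps)
  show "\<exists>u. L u (f - (C + 1) *\<^sub>R u)" for f by (rule resolvent_surjective)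
  show "\<exists>r v. strict_mono r \<and> (\<lambda>n. L2_ip 0 l (u (r n) - v) (u (r n) - v)) \<longlonglongrightarrow> 0"
    if "\<And>n::nat. L (u n) (f n - (C + 1) *\<^sub>R u n)" "\<And>n. L2_ip 0 l (f n) (f n) \<le> B" for B u f
    using resolvent_compact[OF that] .
qed

end

definition multiplication_op :: "real \<Rightarrow> (real \<Rightarrow> real) \<Rightarrow> cfun \<Rightarrow> cfun" where
  "multiplication_op l q u = clamp_ext l (\<lambda>x. q x * u x)"

context
  fixes l :: real and q :: "real \<Rightarrow> real"
  assumes l: "0 < l" and q: "continuous_on {0..l} q"
begin

lemma multiplication_op_apply:
  "apply_bcontfun (multiplication_op l q u) x = q (max 0 (min l x)) * u (max 0 (min l x))"
  unfolding multiplication_op_def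
  by (subst clamp_ext_apply[OF l]) (auto intro!: continuous_on_mult q simp: continuous_on_apply_bcontfun)

lemma multiplication_op_on: "x \<in> {0..l} \<Longrightarrow> apply_bcontfun (multiplication_op l q u) x = q x * u x"
  by (simp add: multiplication_op_apply)

lemma multiplication_op_potential:
  obtains C where "bounded_symmetric_potential l (multiplication_op l q) C"
proof -
  have "bounded (q ` {0..l})" using q by (intro compact_imp_bounded compact_continuous_image) auto
  then obtain C where C: "0 < C" "\<And>x. x \<in> {0..l} \<Longrightarrow> \<bar>q x\<bar> \<le> C"
    by (auto simp: bounded_pos)
  have "bounded_symmetric_potential l (multiplication_op l q) C"
  proof
    fix u v :: cfun and r :: real
    show "multiplication_op l q (u + v) = multiplication_op l q u + multiplication_op l q v"
      by (rule bcontfun_eqI) (simp add: multiplication_op_apply distrib_left)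
    show "multiplication_op l q (r *\<^sub>R u) = r *\<^sub>R multiplication_op l q u"
      by (rule bcontfun_eqI) (simp add: multiplication_op_apply)
    show "L2_ip 0 l (multiplication_op l q u) v = L2_ip 0 l u (multiplication_op l q v)"
      unfolding L2_ip_def by (intro integral_cong) (simp add: multiplication_op_on)
    have "L2_ip 0 l (multiplication_op l q u) (multiplication_op l q u) \<le> integral {0..l} (\<lambda>x. C\<^sup>2 * (u x * u x))"
      unfolding L2_ip_def
    proof (rule integral_le)
      fix x assume x: "x \<in> {0..l}"
      have "(q x)\<^sup>2 \<le> C\<^sup>2" using C(2)[OF x] C(1) by (simp add: abs_le_square_iff[symmetric])
      then have "(q x)\<^sup>2 * (u x * u x) \<le> C\<^sup>2 * (u x * u x)" by (intro mult_right_mono) auto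
      then show "multiplication_op l q u x * multiplication_op l q u x \<le> C\<^sup>2 * (u x * u x)"
        by (simp add: multiplication_op_on[OF x] power2_eq_square mult_ac)
    next
      show "(\<lambda>x. C\<^sup>2 * (u x * u x)) integrable_on {0..l}"
        by (intro integrable_continuous_interval continuous_intros continuous_on_apply_bcontfun)
    qed (rule cfun_integrable)
    then show "L2_ip 0 l (multiplication_op l q u) (multiplication_op l q u) \<le> C\<^sup>2 * L2_ip 0 l u u"
      by (simp add: L2_ip_def)
    show "norm (multiplication_op l q u) \<le> C * norm u"
    proof (rule norm_bound)
      fix x
      have "\<bar>q (max 0 (min l x))\<bar> * norm (u (max 0 (min l x))) \<le> C * norm u"
        using C l by (intro mult_mono norm_bounded) auto
      then show "norm (multiplication_op l q u x) \<le> C * norm u"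
        by (simp add: multiplication_op_apply abs_mult)
    qed
  qed (use l C in auto)
  then show thesis by (rule that)
qed

end

section \<open>Simplicity of Dirichlet eigenvalues\<close>

text \<open>
  Gronwall's argument: \<open>(z\<^sup>2 + v\<^sup>2) exp (- (1 + M) x)\<close> is nonincreasing when \<open>\<bar>Q\<bar> \<le> M\<close>, and it
  starts at \<open>0\<close>.
\<close>

lemma second_order_ivp_unique:
  fixes z v Q :: "real \<Rightarrow> real"
  assumes l: "0 < l"
    and z: "\<And>x. x \<in> {0..l} \<Longrightarrow> (z has_real_derivative v x) (at x within {0..l})"
    and v: "\<And>x. x \<in> {0..l} \<Longrightarrow> (v has_real_derivative Q x * z x) (at x within {0..l})"
    and Q: "continuous_on {0..l} Q" and init: "z 0 = 0" "v 0 = 0" and x: "x \<in> {0..l}"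
  shows "z x = 0"
proof -
  have "bounded (Q ` {0..l})" using Q by (intro compact_imp_bounded compact_continuous_image) auto
  then obtain M where M: "0 < M" "\<And>x. x \<in> {0..l} \<Longrightarrow> \<bar>Q x\<bar> \<le> M" by (auto simp: bounded_pos)
  define F where "F x = ((z x)\<^sup>2 + (v x)\<^sup>2) * exp (- (1 + M) * x)" for x
  define F' where "F' x = (2 * (z x * v x) * (1 + Q x) - (1 + M) * ((z x)\<^sup>2 + (v x)\<^sup>2)) * exp (- (1 + M) * x)" for x
  have F: "(F has_real_derivative F' x) (at x within {0..l})" if "x \<in> {0..l}" for x
    unfolding F_def F'_def
    by (auto intro!: derivative_eq_intros z[OF that] v[OF that] simp: algebra_simps power2_eq_square)
  have F'_le: "F' x \<le> 0" if "x \<in> {0..l}" for x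
  proof -
    have "2 * (z x * v x) * (1 + Q x) \<le> \<bar>2 * (z x * v x)\<bar> * \<bar>1 + Q x\<bar>"
      by (metis abs_ge_self abs_mult)
    also have "\<dots> \<le> ((z x)\<^sup>2 + (v x)\<^sup>2) * (1 + M)"
    proof (rule mult_mono)
      show "\<bar>2 * (z x * v x)\<bar> \<le> (z x)\<^sup>2 + (v x)\<^sup>2"
        using zero_le_power2[of "z x - v x"] zero_le_power2[of "z x + v x"]
        by (simp add: power2_eq_square algebra_simps abs_le_iff)
      show "\<bar>1 + Q x\<bar> \<le> 1 + M" using M(2)[OF that] by linarith
    qed auto
    finally show ?thesis unfolding F'_def by (intro mult_nonpos_nonneg) (auto simp: mult.commute)
  qed
  have "F x \<le> F 0"
  proof (rule DERIV_nonpos_imp_decreasing_open[of 0 x F])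
    show "continuous_on {0..x} F"
      by (rule continuous_on_subset[OF DERIV_continuous_on[OF F]]) (use x in auto)
    show "\<exists>y. DERIV F t :> y \<and> y \<le> 0" if "0 < t" "t < x" for t
      using F[of t] F'_le[of t] that x by (auto simp: at_within_Icc_at)
  qed (use x in auto)
  then have "((z x)\<^sup>2 + (v x)\<^sup>2) * exp (- (1 + M) * x) \<le> 0" using init by (simp add: F_def)
  then have "(z x)\<^sup>2 + (v x)\<^sup>2 \<le> 0" by (simp add: mult_le_0_iff)
  then show ?thesis by (simp add: sum_power2_le_zero_iff)
qed

text \<open>
  Both solutions vanish at \<open>0\<close>, so a combination whose derivative also vanishes at \<open>0\<close> is zero.
\<close>

lemma dirichlet_solutions_dependent:
  assumes l: "0 < l" and Q: "continuous_on {0..l} Q"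
    and u: "dirichlet2 l u (\<lambda>x. Q x * u x)" and w: "dirichlet2 l w (\<lambda>x. Q x * w x)"
  shows "\<exists>\<alpha> \<beta>. (\<alpha> \<noteq> 0 \<or> \<beta> \<noteq> 0) \<and> (\<forall>x\<in>{0..l}. \<alpha> * u x + \<beta> * w x = 0)"
proof -
  obtain u' where u': "\<And>x. x \<in> {0..l} \<Longrightarrow> (u has_real_derivative u' x) (at x within {0..l})"
    "\<And>x. x \<in> {0..l} \<Longrightarrow> (u' has_real_derivative Q x * u x) (at x within {0..l})" "u 0 = 0"
    using u unfolding dirichlet2_def by blast
  obtain w' where w': "\<And>x. x \<in> {0..l} \<Longrightarrow> (w has_real_derivative w' x) (at x within {0..l})"
    "\<And>x. x \<in> {0..l} \<Longrightarrow> (w' has_real_derivative Q x * w x) (at x within {0..l})" "w 0 = 0"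
    using w unfolding dirichlet2_def by blast
  have zero: "\<alpha> * u x + \<beta> * w x = 0" if ab: "\<alpha> * u' 0 + \<beta> * w' 0 = 0" and x: "x \<in> {0..l}" for \<alpha> \<beta> x
  proof (rule second_order_ivp_unique[OF l _ _ Q _ _ x, of _ "\<lambda>x. \<alpha> * u' x + \<beta> * w' x"])
    fix x assume x: "x \<in> {0..l}"
    show "((\<lambda>x. \<alpha> * u x + \<beta> * w x) has_real_derivative \<alpha> * u' x + \<beta> * w' x) (at x within {0..l})"
      by (intro DERIV_add DERIV_cmult u' w' x)
    have "((\<lambda>x. \<alpha> * u' x + \<beta> * w' x) has_real_derivative \<alpha> * (Q x * u x) + \<beta> * (Q x * w x)) (at x within {0..l})"
      by (intro DERIV_add DERIV_cmult u' w' x)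
    then show "((\<lambda>x. \<alpha> * u' x + \<beta> * w' x) has_real_derivative Q x * (\<alpha> * u x + \<beta> * w x)) (at x within {0..l})"
      by (simp add: algebra_simps)
  qed (use u' w' ab in auto)
  show ?thesis
  proof (cases "u' 0 = 0")
    case True
    then show ?thesis using zero[of 1 0] by (intro exI[of _ 1] exI[of _ 0]) auto
  next
    case False
    then show ?thesis using zero[of "- w' 0" "u' 0"] by (intro exI[of _ "- w' 0"] exI[of _ "u' 0"]) auto
  qed
qed

section \<open>Weak and classical solutions\<close>

lemma AE_interval_iff:
  "(AE x in lebesgue_on {0<..<l::real}. P x) \<longleftrightarrow> negligible {x \<in> {0<..<l}. \<not> P x}"
proof -
  have "(AE x in lebesgue_on {0<..<l}. P x) \<longleftrightarrow> (AE x in lebesgue. x \<in> {0<..<l} \<longrightarrow> P x)"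
    by (rule AE_restrict_space_iff) simp
  also have "\<dots> \<longleftrightarrow> negligible {x \<in> {0<..<l}. \<not> P x}"
  proof
    assume "AE x in lebesgue. x \<in> {0<..<l} \<longrightarrow> P x"
    then obtain N where "N \<in> null_sets lebesgue" "{x \<in> space lebesgue. \<not> (x \<in> {0<..<l} \<longrightarrow> P x)} \<subseteq> N"
      unfolding eventually_ae_filter by blast
    moreover from this(1) have "negligible N" by (simp add: negligible_iff_null_sets)
    ultimately show "negligible {x \<in> {0<..<l}. \<not> P x}"
      by (elim negligible_subset) auto
  next
    assume "negligible {x \<in> {0<..<l}. \<not> P x}"
    then show "AE x in lebesgue. x \<in> {0<..<l} \<longrightarrow> P x"
      unfolding negligible_iff_null_sets by (rule AE_I') auto
  qed
  finally show ?thesis .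
qed

lemma integral_AE_cong:
  fixes u v :: "real \<Rightarrow> complex"
  assumes "AE x in lebesgue_on {0<..<l}. u x = v x" "x \<in> {0..l}"
  shows "integral {0..x} u = integral {0..x} v"
proof (rule integral_spike)
  show "negligible ({x \<in> {0<..<l}. \<not> u x = v x} \<union> {0, l})"
    using assms(1) unfolding AE_interval_iff by (intro negligible_Un) auto
qed (use assms(2) in auto)

lemma continuous_AE_eq:
  fixes u v :: "real \<Rightarrow> complex"
  assumes l: "0 < l" and ae: "AE x in lebesgue_on {0<..<l}. u x = v x"
    and c: "continuous_on {0..l} u" "continuous_on {0..l} v" and x: "x \<in> {0..l}"
  shows "u x = v x"
proof -
  define d where "d x = (cmod (u x - v x))\<^sup>2" for x
  have cd: "continuous_on {0..l} d" unfolding d_def using c by (intro continuous_intros)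
  have "integral {0..l} d = integral {0..l} (\<lambda>_. 0::real)"
  proof (rule integral_spike)
    show "negligible ({x \<in> {0<..<l}. \<not> u x = v x} \<union> {0, l})"
      using ae unfolding AE_interval_iff by (intro negligible_Un) auto
  qed (auto simp: d_def)
  then have "d x = 0" using integral_eq_0_iff[OF cd l] x by (auto simp: d_def)
  then show ?thesis by (simp add: d_def)
qed

lemma L2_continuous:
  assumes "continuous_on {0..l} (u :: real \<Rightarrow> complex)"
  shows "u \<in> L2 l"
proof -
  have "u \<in> borel_measurable (lebesgue_on {0<..<l})"
    by (intro continuous_imp_measurable_on_sets_lebesgue continuous_on_subset[OF assms]) auto
  moreover have "integrable (lebesgue_on {0<..<l}) (\<lambda>x. (cmod (u x))\<^sup>2)"
  proof -
    have "(\<lambda>x. (cmod (u x))\<^sup>2) absolutely_integrable_on {0..l}"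
      using assms by (intro absolutely_integrable_continuous_real continuous_intros)
    then have "(\<lambda>x. (cmod (u x))\<^sup>2) absolutely_integrable_on {0<..<l}"
      by (rule set_integrable_subset) auto
    then show ?thesis by (simp add: integrable_restrict_space set_integrable_def)
  qed
  ultimately show ?thesis unfolding L2_def by blast
qed

lemma L2_norm_continuous:
  assumes "u \<in> L2 l" "AE x in lebesgue_on {0<..<l}. u x = U x" "continuous_on {0..l} U"
  shows "L2_norm l u = sqrt (integral {0..l} (\<lambda>x. (cmod (U x))\<^sup>2))"
proof -
  have U: "U \<in> L2 l" by (rule L2_continuous[OF assms(3)])
  have "(LINT x|lebesgue_on {0<..<l}. (cmod (u x))\<^sup>2) = (LINT x|lebesgue_on {0<..<l}. (cmod (U x))\<^sup>2)"
  proof (rule integral_cong_AE)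
    show "AE x in lebesgue_on {0<..<l}. (cmod (u x))\<^sup>2 = (cmod (U x))\<^sup>2" using assms(2) by eventually_elim simp
  qed (use assms(1) U in \<open>auto simp: L2_def intro!: borel_measurable_integrable\<close>)
  also have "\<dots> = integral {0<..<l} (\<lambda>x. (cmod (U x))\<^sup>2)"
    using U by (intro lebesgue_integral_eq_integral) (auto simp: L2_def)
  also have "\<dots> = integral {0..l} (\<lambda>x. (cmod (U x))\<^sup>2)" by (rule integral_open_interval_real[symmetric])
  finally show ?thesis by (simp add: L2_norm_def)
qed

lemma L2_norm_of_real:
  assumes "continuous_on {0..l} y"
  shows "L2_norm l (\<lambda>x. complex_of_real (y x)) = sqrt (integral {0..l} (\<lambda>x. y x * y x))"
proof -
  have c: "continuous_on {0..l} (\<lambda>x. complex_of_real (y x))" using assms by (intro continuous_intros)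
  show ?thesis
    using L2_norm_continuous[OF L2_continuous[OF c] _ c] by (simp add: power2_eq_square)
qed

lemma has_L2_deriv_classical:
  assumes l: "0 < l" and v: "continuous_on {0..l} v"
    and u: "\<And>x. x \<in> {0..l} \<Longrightarrow> (u has_real_derivative v x) (at x within {0..l})"
  shows "has_L2_deriv l (\<lambda>x. complex_of_real (u x)) (\<lambda>x. complex_of_real (v x))"
  unfolding has_L2_deriv_def
proof (intro conjI exI)
  show "(\<lambda>x. complex_of_real (u x)) \<in> L2 l" "(\<lambda>x. complex_of_real (v x)) \<in> L2 l"
    using v DERIV_continuous_on[OF u] by (auto intro!: L2_continuous continuous_intros)
  have "complex_of_real (u x) = complex_of_real (u 0) + integral {0..x} (\<lambda>x. complex_of_real (v x))"
    if x: "x \<in> {0<..<l}" for x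
  proof -
    have "((\<lambda>x. complex_of_real (v x)) has_integral complex_of_real (u x) - complex_of_real (u 0)) {0..x}"
    proof (rule fundamental_theorem_of_calculus)
      fix t assume t: "t \<in> {0..x}"
      have "(u has_vector_derivative v t) (at t within {0..x})"
        unfolding has_real_derivative_iff_has_vector_derivative[symmetric]
        by (rule DERIV_subset[OF u]) (use t x in auto)
      then show "((\<lambda>x. complex_of_real (u x)) has_vector_derivative complex_of_real (v t)) (at t within {0..x})"
        by (rule bounded_linear.has_vector_derivative[OF bounded_linear_of_real])
    qed (use x in auto)
    then show ?thesis by (simp add: integral_unique)
  qed
  then show "AE x in lebesgue_on {0<..<l}. complex_of_real (u x) =
      complex_of_real (u 0) + integral {0..x} (\<lambda>x. complex_of_real (v x))"
    by (intro AE_I2) auto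
qed

text \<open>
  Classical solutions are weak solutions; with the next lemma, a converse, eigenvalue problems
  for \<open>Lop\<close> become boundary value problems for continuous functions.
\<close>

lemma Lop_classical:
  assumes l: "0 < l" and y: "dirichlet2 l y (\<lambda>x. - q x * y x - f x)" and q: "continuous_on {0..l} q"
  shows "Lop l q (\<lambda>x. complex_of_real (y x)) (\<lambda>x. complex_of_real (f x))"
proof -
  obtain v where v: "\<And>x. x \<in> {0..l} \<Longrightarrow> (y has_real_derivative v x) (at x within {0..l})"
    "\<And>x. x \<in> {0..l} \<Longrightarrow> (v has_real_derivative - q x * y x - f x) (at x within {0..l})"
    and bc: "y 0 = 0" "y l = 0"
    using y unfolding dirichlet2_def by blast
  have c: "continuous_on {0..l} y" "continuous_on {0..l} (\<lambda>x. - q x * y x - f x)"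
    using dirichlet2_continuous[OF y] .
  have cv: "continuous_on {0..l} v" by (rule DERIV_continuous_on[OF v(2)])
  have cf: "continuous_on {0..l} f"
  proof (rule continuous_on_eq)
    show "continuous_on {0..l} (\<lambda>x. - (- q x * y x - f x) - q x * y x)"
      by (rule continuous_on_diff[OF continuous_on_minus[OF c(2)] continuous_on_mult[OF q c(1)]])
  qed simp
  have 1: "has_L2_deriv l (\<lambda>x. complex_of_real (y x)) (\<lambda>x. complex_of_real (v x))"
    by (rule has_L2_deriv_classical[OF l cv v(1)])
  have 2: "has_L2_deriv l (\<lambda>x. complex_of_real (v x)) (\<lambda>x. complex_of_real (- q x * y x - f x))"
    by (rule has_L2_deriv_classical[OF l c(2) v(2)])
  have "continuous_on {0..l} (\<lambda>x. complex_of_real (y x))" using c by (intro continuous_intros)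
  then have "\<exists>u'. continuous_on {0..l} u' \<and>
      (AE x in lebesgue_on {0<..<l}. complex_of_real (y x) = u' x) \<and> u' 0 = 0 \<and> u' l = 0"
    using bc by (intro exI[of _ "\<lambda>x. complex_of_real (y x)"]) auto
  then have "(\<lambda>x. complex_of_real (y x)) \<in> H10 l"
    unfolding H10_def H1_def using 1 by blast
  moreover have "(\<lambda>x. complex_of_real (f x)) \<in> L2 l" by (intro L2_continuous continuous_intros cf)
  moreover have "AE x in lebesgue_on {0<..<l}. complex_of_real (f x) =
      - complex_of_real (- q x * y x - f x) - complex_of_real (q x) * complex_of_real (y x)"
    by (intro AE_I2) simp
  ultimately show ?thesis using 1 2 unfolding Lop_def H2_def by blast
qed

text \<open>
  The continuous representative \<open>U\<close> comes with the boundary condition. The second weak derivative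
  agrees almost everywhere with the continuous function \<open>W\<close>; integrating \<open>W\<close> twice recovers \<open>U\<close>,
  which is therefore twice differentiable. Since \<open>q\<close> and \<open>r\<close> are real, the real and the imaginary part
  solve the equation separately.
\<close>

lemma Lop_regularity:
  assumes l: "0 < l" and q: "continuous_on {0..l} q" and L: "Lop l q u w"
    and w: "AE x in lebesgue_on {0<..<l}. w x = of_real r * u x + \<omega> x" and \<omega>: "continuous_on {0..l} \<omega>"
  obtains U where "AE x in lebesgue_on {0<..<l}. u x = U x" "continuous_on {0..l} U"
    "dirichlet2 l (\<lambda>x. Re (U x)) (\<lambda>x. - (q x + r) * Re (U x) - Re (\<omega> x))"
    "dirichlet2 l (\<lambda>x. Im (U x)) (\<lambda>x. - (q x + r) * Im (U x) - Im (\<omega> x))"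
proof -
  have "u \<in> H10 l" using L unfolding Lop_def by blast
  then obtain U where U: "continuous_on {0..l} U" "AE x in lebesgue_on {0<..<l}. u x = U x" "U 0 = 0" "U l = 0"
    unfolding H10_def by blast
  obtain v v' where v: "has_L2_deriv l u v" "has_L2_deriv l v v'"
    and wv: "AE x in lebesgue_on {0<..<l}. w x = - v' x - of_real (q x) * u x"
    using L unfolding Lop_def by blast
  obtain c c' where c: "AE x in lebesgue_on {0<..<l}. u x = c + integral {0..x} v"
    and c': "AE x in lebesgue_on {0<..<l}. v x = c' + integral {0..x} v'"
    using v unfolding has_L2_deriv_def by blast
  define W where "W x = - of_real (q x + r) * U x - \<omega> x" for x
  have cW: "continuous_on {0..l} W" unfolding W_def using U q \<omega> by (intro continuous_intros)
  have v'W: "AE x in lebesgue_on {0<..<l}. v' x = W x"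
    using wv w U(2)
  proof eventually_elim
    case (elim x)
    have "v' x = - w x - of_real (q x) * u x" using elim(1) by simp
    also have "\<dots> = - (of_real r * U x + \<omega> x) - of_real (q x) * U x" using elim(2,3) by simp
    also have "\<dots> = W x" by (simp add: W_def algebra_simps)
    finally show ?case .
  qed
  define V where "V x = c' + integral {0..x} W" for x
  have dV: "(V has_vector_derivative W x) (at x within {0..l})" if "x \<in> {0..l}" for x
    unfolding V_def using integral_has_vector_derivative[OF cW that] by (auto intro!: derivative_eq_intros)
  have cV: "continuous_on {0..l} V"
    using dV by (rule continuous_on_vector_derivative)
  have "AE x in lebesgue_on {0<..<l}. v x = V x"
    using c' AE_space by eventually_elim (simp add: V_def integral_AE_cong[OF v'W])
  note vV = this
  define U' where "U' x = c + integral {0..x} V" for x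
  have dU': "(U' has_vector_derivative V x) (at x within {0..l})" if "x \<in> {0..l}" for x
    unfolding U'_def using integral_has_vector_derivative[OF cV that] by (auto intro!: derivative_eq_intros)
  have cU': "continuous_on {0..l} U'"
    using dU' by (rule continuous_on_vector_derivative)
  have "AE x in lebesgue_on {0<..<l}. u x = U' x"
    using c AE_space by eventually_elim (simp add: U'_def integral_AE_cong[OF vV])
  with U(2) have "AE x in lebesgue_on {0<..<l}. U x = U' x" by eventually_elim simp
  then have UU': "U x = U' x" if "x \<in> {0..l}" for x using continuous_AE_eq[OF l _ U(1) cU' that] by blast
  have dU: "(U has_vector_derivative V x) (at x within {0..l})" if "x \<in> {0..l}" for x
    using has_vector_derivative_transform[OF that _ dU'[OF that]] UU' by auto
  have "dirichlet2 l (\<lambda>x. Re (U x)) (\<lambda>x. Re (W x))"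
    unfolding dirichlet2_def
  proof (intro conjI exI[of _ "\<lambda>x. Re (V x)"] ballI)
    show "continuous_on {0..l} (\<lambda>x. Re (W x))" using cW by (intro continuous_intros)
    fix x assume x: "x \<in> {0..l}"
    show "((\<lambda>x. Re (U x)) has_real_derivative Re (V x)) (at x within {0..l})"
      unfolding has_real_derivative_iff_has_vector_derivative
      by (rule bounded_linear.has_vector_derivative[OF bounded_linear_Re dU[OF x]])
    show "((\<lambda>x. Re (V x)) has_real_derivative Re (W x)) (at x within {0..l})"
      unfolding has_real_derivative_iff_has_vector_derivative
      by (rule bounded_linear.has_vector_derivative[OF bounded_linear_Re dV[OF x]])
  qed (use U in auto)
  then have re: "dirichlet2 l (\<lambda>x. Re (U x)) (\<lambda>x. - (q x + r) * Re (U x) - Re (\<omega> x))"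
    by (rule dirichlet2_cong) (use l in \<open>auto simp: W_def\<close>)
  have "dirichlet2 l (\<lambda>x. Im (U x)) (\<lambda>x. Im (W x))"
    unfolding dirichlet2_def
  proof (intro conjI exI[of _ "\<lambda>x. Im (V x)"] ballI)
    show "continuous_on {0..l} (\<lambda>x. Im (W x))" using cW by (intro continuous_intros)
    fix x assume x: "x \<in> {0..l}"
    show "((\<lambda>x. Im (U x)) has_real_derivative Im (V x)) (at x within {0..l})"
      unfolding has_real_derivative_iff_has_vector_derivative
      by (rule bounded_linear.has_vector_derivative[OF bounded_linear_Im dU[OF x]])
    show "((\<lambda>x. Im (V x)) has_real_derivative Im (W x)) (at x within {0..l})"
      unfolding has_real_derivative_iff_has_vector_derivative
      by (rule bounded_linear.has_vector_derivative[OF bounded_linear_Im dV[OF x]])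
  qed (use U in auto)
  then have im: "dirichlet2 l (\<lambda>x. Im (U x)) (\<lambda>x. - (q x + r) * Im (U x) - Im (\<omega> x))"
    by (rule dirichlet2_cong) (use l in \<open>auto simp: W_def\<close>)
  from U(2,1) re im show thesis by (rule that)
qed

section \<open>Eigenvalue counts and inverses of Dirichlet operators\<close>

lemma schrodinger_multiplication_iff:
  assumes "0 < l" "continuous_on {0..l} q"
  shows "schrodinger_op l (multiplication_op l (\<lambda>x. - q x)) u f \<longleftrightarrow>
    dirichlet2 l u (\<lambda>x. - q x * u x - f x)"
proof -
  have c: "continuous_on {0..l} (\<lambda>x. - q x)" using assms(2) by (intro continuous_intros)
  show ?thesis unfolding schrodinger_op_def
    using dirichlet2_cong[OF _ refl _ assms(1)] multiplication_op_on[OF assms(1) c]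
    by (smt (verit))
qed

lemma schrodinger_clamp_ext:
  assumes l: "0 < l" and q: "continuous_on {0..l} q" and y: "dirichlet2 l y (\<lambda>x. - q x * y x - f x)"
    and f: "\<And>x. x \<in> {0..l} \<Longrightarrow> apply_bcontfun g x = f x"
  shows "schrodinger_op l (multiplication_op l (\<lambda>x. - q x)) (clamp_ext l y) g"
  unfolding schrodinger_multiplication_iff[OF l q]
  by (rule dirichlet2_cong[OF y])
     (use l f clamp_ext_on[OF l dirichlet2_continuous(1)[OF y]] in auto)

lemma L2_ip_clamp_ext_pos:
  assumes l: "0 < l" and c: "continuous_on {0..l} y" and x: "x \<in> {0..l}" "y x \<noteq> 0"
  shows "L2_ip 0 l (clamp_ext l y) (clamp_ext l y) \<noteq> 0"
  using L2_ip_null[OF l _ x(1)] clamp_ext_on[OF l c x(1)] x(2) by force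

lemma eigenvalues_Lop_iff:
  assumes l: "0 < l" and q: "continuous_on {0..l} q"
  shows "complex_of_real r \<in> eigenvalues (L2_norm l) (Lop l q) \<longleftrightarrow>
    (\<exists>u. schrodinger_op l (multiplication_op l (\<lambda>x. - q x)) u (r *\<^sub>R u) \<and> L2_ip 0 l u u \<noteq> 0)"
proof
  assume "complex_of_real r \<in> eigenvalues (L2_norm l) (Lop l q)"
  then obtain u where u: "Lop l q u (complex_of_real r \<odot> u)" "L2_norm l u \<noteq> 0"
    unfolding eigenvalues_def by blast
  obtain U where U: "AE x in lebesgue_on {0<..<l}. u x = U x" "continuous_on {0..l} U"
    and re: "dirichlet2 l (\<lambda>x. Re (U x)) (\<lambda>x. - (q x + r) * Re (U x) - Re 0)"
    and im: "dirichlet2 l (\<lambda>x. Im (U x)) (\<lambda>x. - (q x + r) * Im (U x) - Im 0)"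
    by (rule Lop_regularity[OF l q u(1), of r "\<lambda>_. 0"]) (auto simp: cscale_fun_def cscale_complex_def)
  have "u \<in> L2 l" using u(1) unfolding Lop_def H2_def has_L2_deriv_def by blast
  from L2_norm_continuous[OF this U] have "integral {0..l} (\<lambda>x. (cmod (U x))\<^sup>2) \<noteq> 0" using u(2) by auto
  then obtain x where x: "x \<in> {0..l}" "U x \<noteq> 0"
    using integral_cong[of "{0..l}" "\<lambda>x. (cmod (U x))\<^sup>2" "\<lambda>_. 0"] by auto
  have *: "\<exists>u. schrodinger_op l (multiplication_op l (\<lambda>x. - q x)) u (r *\<^sub>R u) \<and> L2_ip 0 l u u \<noteq> 0"
    if y: "dirichlet2 l y (\<lambda>x. - (q x + r) * y x)" and nz: "y x \<noteq> 0" for y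
  proof (intro exI conjI)
    have cy: "continuous_on {0..l} y" by (rule dirichlet2_continuous(1)[OF y])
    show "schrodinger_op l (multiplication_op l (\<lambda>x. - q x)) (clamp_ext l y) (r *\<^sub>R clamp_ext l y)"
    proof (rule schrodinger_clamp_ext[OF l q, where f = "\<lambda>x. r * y x"])
      show "dirichlet2 l y (\<lambda>x. - q x * y x - r * y x)"
        by (rule dirichlet2_cong[OF y]) (use l in \<open>auto simp: algebra_simps\<close>)
    qed (simp add: clamp_ext_on[OF l cy])
    show "L2_ip 0 l (clamp_ext l y) (clamp_ext l y) \<noteq> 0" by (rule L2_ip_clamp_ext_pos[OF l cy x(1) nz])
  qed
  have "Re (U x) \<noteq> 0 \<or> Im (U x) \<noteq> 0" using x(2) by (simp add: complex_eq_iff)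
  then show "\<exists>u. schrodinger_op l (multiplication_op l (\<lambda>x. - q x)) u (r *\<^sub>R u) \<and> L2_ip 0 l u u \<noteq> 0"
    using *[of "\<lambda>x. Re (U x)"] *[of "\<lambda>x. Im (U x)"] re im by auto
next
  assume "\<exists>u. schrodinger_op l (multiplication_op l (\<lambda>x. - q x)) u (r *\<^sub>R u) \<and> L2_ip 0 l u u \<noteq> 0"
  then obtain u :: cfun where u: "dirichlet2 l u (\<lambda>x. - q x * u x - (r *\<^sub>R u) x)" "L2_ip 0 l u u \<noteq> 0"
    unfolding schrodinger_multiplication_iff[OF l q] by blast
  have "Lop l q (\<lambda>x. complex_of_real (u x)) (\<lambda>x. complex_of_real ((r *\<^sub>R u) x))"
    by (rule Lop_classical[OF l u(1) q])
  moreover have "L2_norm l (\<lambda>x. complex_of_real (u x)) \<noteq> 0"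
    using u(2) by (subst L2_norm_of_real) (auto simp: L2_ip_def)
  ultimately show "complex_of_real r \<in> eigenvalues (L2_norm l) (Lop l q)"
    unfolding eigenvalues_def
    by (auto intro!: exI[of _ "\<lambda>x. complex_of_real (u x)"] simp: cscale_fun_def cscale_complex_def)
qed

text \<open>
  An eigenfunction for a negative eigenvalue cannot be orthogonal to all of \<open>E\<close>, by the gap,
  so \<open>E\<close> represents every negative eigenvalue; by simplicity, no eigenvalue occurs twice. In
  particular at most one element of \<open>E\<close> belongs to the eigenvalue \<open>0\<close>.
\<close>

lemma n_neg_L_eq:
  fixes q :: "real \<Rightarrow> real"
  assumes l: "0 < l" and q: "continuous_on {0..l} q"
    and gap: "L2.gap_eigensystem 0 l (schrodinger_op l (multiplication_op l (\<lambda>x. - q x))) E \<delta>"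
  shows "n_neg_L l q = card {e \<in> E. \<exists>\<nu><0. schrodinger_op l (multiplication_op l (\<lambda>x. - q x)) e (\<nu> *\<^sub>R e)}"
    and "card E \<le> n_neg_L l q + 1"
proof -
  define T where "T = schrodinger_op l (multiplication_op l (\<lambda>x. - q x))"
  define E' where "E' = {e \<in> E. \<exists>\<nu><0. T e (\<nu> *\<^sub>R e)}"
  have c: "continuous_on {0..l} (\<lambda>x. - q x)" using q by (intro continuous_intros)
  obtain C where "bounded_symmetric_potential l (multiplication_op l (\<lambda>x. - q x)) C"
    using multiplication_op_potential[OF l c] .
  then have sym: "L2.symmetric_op 0 l T" unfolding T_def by (rule bounded_symmetric_potential.symmetric)
  have E: "finite E" "L2.orthonormal 0 l E" "\<And>e. e \<in> E \<Longrightarrow> \<exists>\<nu>\<le>0. T e (\<nu> *\<^sub>R e)" "0 < \<delta>"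
    "\<And>u f. T u f \<Longrightarrow> (\<forall>e\<in>E. L2_ip 0 l u e = 0) \<Longrightarrow> \<delta> * L2_ip 0 l u u \<le> L2_ip 0 l f u"
    using gap unfolding T_def L2.gap_eigensystem_def by auto
  have unit: "L2_ip 0 l e e = 1" if "e \<in> E" for e using E(2) that unfolding L2.orthonormal_def by simp
  have orth: "L2_ip 0 l e e' = 0" if "e \<in> E" "e' \<in> E" "e \<noteq> e'" for e e'
    using E(2) that unfolding L2.orthonormal_def by simp
  obtain ev where ev: "\<And>e. e \<in> E \<Longrightarrow> ev e \<le> 0" "\<And>e. e \<in> E \<Longrightarrow> T e (ev e *\<^sub>R e)" using E(3) by metis
  have ev_unique: "\<nu> = ev e" if "e \<in> E" "T e (\<nu> *\<^sub>R e)" for e \<nu>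
    using L2.symmetric_op_sym[OF sym that(2) ev(2)[OF that(1)]] unit[OF that(1)] by (simp add: L2.ip_linear)
  have inj: "inj_on ev E"
  proof (rule inj_onI, rule ccontr)
    fix e e' assume e: "e \<in> E" "e' \<in> E" "ev e = ev e'" "e \<noteq> e'"
    have cQ: "continuous_on {0..l} (\<lambda>x. - q x - ev e)" using q by (intro continuous_intros)
    have sol: "dirichlet2 l w (\<lambda>x. (- q x - ev e) * w x)" if "T w (ev e *\<^sub>R w)" for w :: cfun
    proof (rule dirichlet2_cong)
      show "dirichlet2 l w (\<lambda>x. - q x * w x - (ev e *\<^sub>R w) x)"
        using that unfolding T_def schrodinger_multiplication_iff[OF l q] .
    qed (use l in \<open>auto simp: algebra_simps\<close>)
    have "dirichlet2 l e (\<lambda>x. (- q x - ev e) * e x)" by (rule sol[OF ev(2)[OF e(1)]])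
    moreover have "dirichlet2 l e' (\<lambda>x. (- q x - ev e) * e' x)" using ev(2)[OF e(2)] e(3) by (intro sol) simp
    ultimately obtain \<alpha> \<beta> where ab: "\<alpha> \<noteq> 0 \<or> \<beta> \<noteq> 0" "\<forall>x\<in>{0..l}. \<alpha> * e x + \<beta> * e' x = 0"
      using dirichlet_solutions_dependent[OF l cQ] by blast
    have "L2_ip 0 l (\<alpha> *\<^sub>R e + \<beta> *\<^sub>R e') (\<alpha> *\<^sub>R e + \<beta> *\<^sub>R e') = 0"
      unfolding L2_ip_def using ab(2) by (subst integral_cong[where g = "\<lambda>_. 0"]) auto
    then have "\<alpha> * \<alpha> + \<beta> * \<beta> = 0"
      using unit e orth[OF e(1,2,4)] orth[OF e(2,1)] by (simp add: L2.ip_linear)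
    then show False using ab(1) by (simp add: sum_squares_eq_zero_iff)
  qed
  have "ev ` E' = {r. r < 0 \<and> complex_of_real r \<in> eigenvalues (L2_norm l) (Lop l q)}"
  proof (intro equalityI subsetI)
    fix r assume "r \<in> ev ` E'"
    then obtain e where e: "e \<in> E" "r = ev e" "\<exists>\<nu><0. T e (\<nu> *\<^sub>R e)" unfolding E'_def by blast
    then have "r < 0" using ev_unique[OF e(1)] by auto
    moreover have "T e (r *\<^sub>R e)" "L2_ip 0 l e e \<noteq> 0" using ev e unit by auto
    ultimately show "r \<in> {r. r < 0 \<and> complex_of_real r \<in> eigenvalues (L2_norm l) (Lop l q)}"
      unfolding mem_Collect_eq eigenvalues_Lop_iff[OF l q] T_def by blast
  next
    fix r assume "r \<in> {r. r < 0 \<and> complex_of_real r \<in> eigenvalues (L2_norm l) (Lop l q)}"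
    then obtain u where u: "r < 0" "T u (r *\<^sub>R u)" "L2_ip 0 l u u \<noteq> 0"
      unfolding mem_Collect_eq eigenvalues_Lop_iff[OF l q] T_def by blast
    have pos: "0 < L2_ip 0 l u u" using u(3) L2.ip_self_nonneg[of 0 l u] by linarith
    have "\<exists>e\<in>E. L2_ip 0 l u e \<noteq> 0"
    proof (rule ccontr)
      assume "\<not> (\<exists>e\<in>E. L2_ip 0 l u e \<noteq> 0)"
      then have "\<delta> * L2_ip 0 l u u \<le> L2_ip 0 l (r *\<^sub>R u) u" using E(5)[OF u(2)] by blast
      also have "\<dots> = r * L2_ip 0 l u u" by (simp add: L2.ip_linear)
      finally show False using pos u(1) E(4) by (simp add: mult_le_cancel_right)
    qed
    then obtain e where e: "e \<in> E" "L2_ip 0 l u e \<noteq> 0" by blast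
    have "r = ev e" using L2.symmetric_op_sym[OF sym u(2) ev(2)[OF e(1)]] e(2) by (simp add: L2.ip_linear)
    moreover have "e \<in> E'" using e(1) ev(2)[OF e(1)] u(1) \<open>r = ev e\<close> unfolding E'_def by auto
    ultimately show "r \<in> ev ` E'" by blast
  qed
  moreover have "inj_on ev E'" using inj by (rule inj_on_subset) (auto simp: E'_def)
  ultimately have n: "n_neg_L l q = card E'" unfolding n_neg_L_def by (metis card_image)
  then show "n_neg_L l q = card {e \<in> E. \<exists>\<nu><0. schrodinger_op l (multiplication_op l (\<lambda>x. - q x)) e (\<nu> *\<^sub>R e)}"
    by (simp add: E'_def T_def)
  have "card (ev ` (E - E')) \<le> card {0::real}"
  proof (intro card_mono)
    show "ev ` (E - E') \<subseteq> {0}"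
    proof
      fix r assume "r \<in> ev ` (E - E')"
      then obtain e where e: "e \<in> E" "e \<notin> E'" "r = ev e" by blast
      then have "\<not> ev e < 0" using ev(2)[OF e(1)] unfolding E'_def by blast
      then show "r \<in> {0}" using ev(1)[OF e(1)] e(3) by simp
    qed
  qed simp
  moreover have "card (ev ` (E - E')) = card (E - E')"
    by (intro card_image inj_on_subset[OF inj]) auto
  moreover have "card E \<le> card E' + card (E - E')"
    using card_Un_le[of E' "E - E'"] by (simp add: Un_absorb1 E'_def Collect_conj_eq)
  ultimately show "card E \<le> n_neg_L l q + 1" using n by simp
qed

lemma bounded_symmetric_potential_combine:
  assumes "bounded_symmetric_potential l S A" "bounded_symmetric_potential l T B"
  shows "bounded_symmetric_potential l (\<lambda>u. S u + c *\<^sub>R T u) (A + \<bar>c\<bar> * B)"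
proof -
  interpret S: bounded_symmetric_potential l S A by fact
  interpret T: bounded_symmetric_potential l T B by fact
  show ?thesis
  proof
    fix u v :: cfun and r :: real
    show "S (u + v) + c *\<^sub>R T (u + v) = S u + c *\<^sub>R T u + (S v + c *\<^sub>R T v)"
      by (simp add: S.S_add T.S_add scaleR_add_right)
    show "S (r *\<^sub>R u) + c *\<^sub>R T (r *\<^sub>R u) = r *\<^sub>R (S u + c *\<^sub>R T u)"
      by (simp add: S.S_scaleR T.S_scaleR scaleR_add_right)
    show "L2_ip 0 l (S u + c *\<^sub>R T u) v = L2_ip 0 l u (S v + c *\<^sub>R T v)"
      by (simp add: L2.ip_linear S.S_sym T.S_sym)
    show "L2_ip 0 l (S u + c *\<^sub>R T u) (S u + c *\<^sub>R T u) \<le> (A + \<bar>c\<bar> * B)\<^sup>2 * L2_ip 0 l u u"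
    proof (rule L2.ip_add_bound[OF S.S_L2])
      have "c\<^sup>2 * L2_ip 0 l (T u) (T u) \<le> c\<^sup>2 * (B\<^sup>2 * L2_ip 0 l u u)"
        by (intro mult_left_mono T.S_L2) simp
      then show "L2_ip 0 l (c *\<^sub>R T u) (c *\<^sub>R T u) \<le> (\<bar>c\<bar> * B)\<^sup>2 * L2_ip 0 l u u"
        by (simp add: L2.ip_linear power2_eq_square mult_ac)
    qed (use S.C T.C in auto)
    have "norm (S u + c *\<^sub>R T u) \<le> norm (S u) + \<bar>c\<bar> * norm (T u)"
      using norm_triangle_ineq[of "S u" "c *\<^sub>R T u"] by simp
    also have "\<dots> \<le> A * norm u + \<bar>c\<bar> * (B * norm u)"
      by (intro add_mono mult_left_mono S.S_sup T.S_sup) auto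
    finally show "norm (S u + c *\<^sub>R T u) \<le> (A + \<bar>c\<bar> * B) * norm u" by (simp add: algebra_simps)
  qed (use S.l S.C T.C in auto)
qed

text \<open>
  Existence and the \<open>L\<^sup>2\<close> bound come from the definition of the resolvent set, symmetry from Green's
  identity and the supremum bound from the Hoelder estimate. Choosing the solution that is constant
  outside the interval makes it unique as a function on the line, so that \<open>G\<close> is exactly linear.
\<close>

lemma inverse_of_zero_resolvent:
  assumes l: "0 < l" and q: "continuous_on {0..l} q" and nspec: "0 \<notin> Spec_L l q"
  obtains G K where "bounded_symmetric_potential l G K"
    "\<And>f. schrodinger_op l (multiplication_op l (\<lambda>x. - q x)) (G f) f"
proof -
  define T where "T = schrodinger_op l (multiplication_op l (\<lambda>x. - q x))"
  have T_iff: "T u f \<longleftrightarrow> dirichlet2 l u (\<lambda>x. - q x * u x - f x)" for u f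
    unfolding T_def by (rule schrodinger_multiplication_iff[OF l q])
  have c: "continuous_on {0..l} (\<lambda>x. - q x)" using q by (intro continuous_intros)
  obtain C where "bounded_symmetric_potential l (multiplication_op l (\<lambda>x. - q x)) C"
    using multiplication_op_potential[OF l c] .
  then interpret M: bounded_symmetric_potential l "multiplication_op l (\<lambda>x. - q x)" C .
  have sym: "L2.symmetric_op 0 l T" unfolding T_def by (rule M.symmetric)
  have "0 \<in> resolvent_set (L2 l) (L2_norm l) (Lop l q)" using nspec unfolding Spec_L_def spectrum_def by simp
  then obtain C0 where surj: "\<And>w. w \<in> L2 l \<Longrightarrow> \<exists>u. Lop l q u (w + 0 \<odot> u)"
    and bound: "\<And>w u. w \<in> L2 l \<Longrightarrow> Lop l q u (w + 0 \<odot> u) \<Longrightarrow> L2_norm l u \<le> C0 * L2_norm l w"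
    unfolding resolvent_set_def by blast
  have zero: "w + 0 \<odot> u = w" for w u :: "real \<Rightarrow> complex"
    by (simp add: fun_eq_iff cscale_fun_def cscale_complex_def)
  have L2f: "(\<lambda>x. complex_of_real (f x)) \<in> L2 l" for f :: cfun
    by (intro L2_continuous continuous_on_of_real continuous_on_apply_bcontfun)
  have norm_f: "L2_norm l (\<lambda>x. complex_of_real (f x)) = sqrt (L2_ip 0 l f f)" for f :: cfun
    unfolding L2_ip_def by (rule L2_norm_of_real) (rule continuous_on_apply_bcontfun)
  have T_bound: "L2_ip 0 l u u \<le> C0\<^sup>2 * L2_ip 0 l f f" if "T u f" for u f
  proof -
    have "Lop l q (\<lambda>x. complex_of_real (u x)) (\<lambda>x. complex_of_real (f x))"
      using that unfolding T_iff by (intro Lop_classical l q)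
    then have "sqrt (L2_ip 0 l u u) \<le> C0 * sqrt (L2_ip 0 l f f)"
      using bound[OF L2f[of f]] zero norm_f by metis
    then have "(sqrt (L2_ip 0 l u u))\<^sup>2 \<le> (C0 * sqrt (L2_ip 0 l f f))\<^sup>2" by (intro power_mono) auto
    then show ?thesis by (simp add: power_mult_distrib)
  qed
  define clamped where "clamped u \<longleftrightarrow> (\<forall>x. apply_bcontfun u x = apply_bcontfun u (max 0 (min l x)))" for u :: cfun
  have "\<exists>u. T u f \<and> clamped u" for f
  proof -
    obtain u where u: "Lop l q u (\<lambda>x. complex_of_real (f x))" using surj[OF L2f[of f]] zero by metis
    obtain U where U: "dirichlet2 l (\<lambda>x. Re (U x)) (\<lambda>x. - (q x + 0) * Re (U x) - Re (complex_of_real (f x)))"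
      by (rule Lop_regularity[OF l q u, of 0 "\<lambda>x. complex_of_real (f x)"])
         (auto intro: continuous_on_of_real continuous_on_apply_bcontfun)
    then have "dirichlet2 l (\<lambda>x. Re (U x)) (\<lambda>x. - q x * Re (U x) - f x)" by simp
    then have "T (clamp_ext l (\<lambda>x. Re (U x))) f"
      unfolding T_def by (rule schrodinger_clamp_ext[OF l q]) simp
    moreover have "clamped (clamp_ext l (\<lambda>x. Re (U x)))"
      unfolding clamped_def using l by (simp add: clamp_ext_apply[OF l dirichlet2_continuous(1)[OF U]])
    ultimately show ?thesis by blast
  qed
  then obtain G where G: "\<And>f. T (G f) f" "\<And>f. clamped (G f)" by metis
  have unique: "u = v" if "T u f" "T v f" "clamped u" "clamped v" for u v f
  proof (rule bcontfun_eqI)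
    fix x
    have "T (u - v) 0" using L2.symmetric_op_diff[OF sym that(1,2)] by simp
    then have "L2_ip 0 l (u - v) (u - v) \<le> 0" using T_bound by fastforce
    then have "L2_ip 0 l (u - v) (u - v) = 0" using L2.ip_self_nonneg[of 0 l "u - v"] by linarith
    from L2_ip_null[OF l this, of "max 0 (min l x)"] have "u (max 0 (min l x)) = v (max 0 (min l x))"
      using l by simp
    then show "u x = v x" using that(3,4) unfolding clamped_def by metis
  qed
  \<comment> \<open>The supremum bound: \<open>(G f x)\<^sup>2\<close> is at most \<open>l\<close> times the energy of \<open>G f\<close>, which is at most
    \<open>(1 + (1 + C) C0\<^sup>2)\<close> times the squared \<open>L\<^sup>2\<close> norm of \<open>f\<close>, itself at most \<open>l (norm f)\<^sup>2\<close>.\<close>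
  define A where "A = l * sqrt (1 + (1 + C) * C0\<^sup>2)"
  have A: "0 \<le> A" "A\<^sup>2 = l * (1 + (1 + C) * C0\<^sup>2) * l"
  proof -
    have "0 \<le> 1 + (1 + C) * C0\<^sup>2" using M.C by simp
    then show "0 \<le> A" "A\<^sup>2 = l * (1 + (1 + C) * C0\<^sup>2) * l"
      unfolding A_def using l by (auto simp: power_mult_distrib power2_eq_square[of l])
  qed
  define K where "K = max \<bar>C0\<bar> A"
  have "bounded_symmetric_potential l G K"
  proof
    show "0 < l" "0 \<le> K" using l by (auto simp: K_def)
    fix u v :: cfun and r :: real
    show "G (u + v) = G u + G v"
    proof (rule unique)
      show "T (G u + G v) (u + v)" by (intro L2.symmetric_op_add[OF sym] G)
      show "clamped (G u + G v)" using G(2)[of u] G(2)[of v] by (simp add: clamped_def)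
    qed (rule G)+
    show "G (r *\<^sub>R u) = r *\<^sub>R G u"
    proof (rule unique)
      show "T (r *\<^sub>R G u) (r *\<^sub>R u)" by (intro L2.symmetric_op_scaleR[OF sym] G)
      show "clamped (r *\<^sub>R G u)" using G(2)[of u] by (simp add: clamped_def)
    qed (rule G)+
    show "L2_ip 0 l (G u) v = L2_ip 0 l u (G v)"
      using L2.symmetric_op_sym[OF sym G(1)[of u] G(1)[of v]] by simp
    have "C0\<^sup>2 \<le> K\<^sup>2" unfolding K_def by (simp add: abs_le_square_iff[symmetric])
    then show "L2_ip 0 l (G u) (G u) \<le> K\<^sup>2 * L2_ip 0 l u u"
      using T_bound[OF G(1)[of u]] mult_right_mono[of "C0\<^sup>2" "K\<^sup>2" "L2_ip 0 l u u"] L2.ip_self_nonneg[of 0 l u]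
      by linarith
    show "norm (G u) \<le> K * norm u"
    proof (rule norm_bound)
      fix x0
      define x where "x = max 0 (min l x0)"
      have x: "x \<in> {0..l}" using l by (auto simp: x_def)
      have G0: "G u 0 = 0" using G(1)[of u] unfolding T_iff dirichlet2_def by blast
      have "L2_ip 0 l u u \<le> integral {0..l} (\<lambda>_. norm u * norm u)"
        unfolding L2_ip_def
      proof (rule integral_le)
        fix t
        have "\<bar>u t\<bar> * \<bar>u t\<bar> \<le> norm u * norm u" using norm_bounded[of u t] by (intro mult_mono) auto
        then show "u t * u t \<le> norm u * norm u" by (simp only: abs_mult_self_eq)
      qed (auto intro: cfun_integrable)
      also have "\<dots> = l * (norm u)\<^sup>2" using l by (simp add: power2_eq_square)
      finally have nu: "L2_ip 0 l u u \<le> l * (norm u)\<^sup>2" .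
      have "(G u x)\<^sup>2 = (G u x - G u 0)\<^sup>2" using G0 by simp
      also have "\<dots> \<le> \<bar>x - 0\<bar> * (L2_ip 0 l u (G u) + C * L2_ip 0 l (G u) (G u))"
        using G(1)[of u] x l unfolding T_def by (intro M.holder) auto
      also have "\<dots> \<le> l * ((1 + (1 + C) * C0\<^sup>2) * L2_ip 0 l u u)"
      proof (rule mult_mono)
        have "L2_ip 0 l u (G u) \<le> L2_ip 0 l u u + L2_ip 0 l (G u) (G u)"
          using L2.ip_self_nonneg[of 0 l "u - G u"] L2.ip_self_nonneg[of 0 l u] L2.ip_self_nonneg[of 0 l "G u"]
          by (simp only: L2.ip_diff_self)
        then have "L2_ip 0 l u (G u) + C * L2_ip 0 l (G u) (G u) \<le> L2_ip 0 l u u + (1 + C) * L2_ip 0 l (G u) (G u)"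
          by (simp add: algebra_simps)
        also have "\<dots> \<le> L2_ip 0 l u u + (1 + C) * (C0\<^sup>2 * L2_ip 0 l u u)"
          using M.C by (intro add_left_mono mult_left_mono T_bound G) auto
        finally show "L2_ip 0 l u (G u) + C * L2_ip 0 l (G u) (G u) \<le> (1 + (1 + C) * C0\<^sup>2) * L2_ip 0 l u u"
          by (simp add: algebra_simps)
        show "0 \<le> L2_ip 0 l u (G u) + C * L2_ip 0 l (G u) (G u)"
          using M.coercive[of "G u" u] G(1)[of u] unfolding T_def by simp
      qed (use x l in auto)
      also have "\<dots> \<le> l * ((1 + (1 + C) * C0\<^sup>2) * (l * (norm u)\<^sup>2))"
        using l M.C by (intro mult_left_mono nu) auto
      also have "\<dots> = (A * norm u)\<^sup>2" by (simp add: A power_mult_distrib)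
      finally have "\<bar>G u x\<bar> \<le> A * norm u" using A(1) by (simp add: abs_le_square_iff[symmetric] abs_mult)
      also have "\<dots> \<le> K * norm u" unfolding K_def by (intro mult_right_mono) auto
      finally show "norm (G u x0) \<le> K * norm u" using G(2)[of u] unfolding clamped_def x_def by (metis real_norm_def)
    qed
  qed
  then show thesis using G(1) unfolding T_def by (rule that)
qed

section \<open>Positive eigenvalues and instability\<close>

text \<open>
  With \<open>w = \<sigma> G u\<close> and \<open>\<mu> = \<sigma>\<^sup>2\<close>, the system says that \<open>u\<close> is in the kernel of the pencil with
  parameter \<open>\<mu>\<close>. If there were no such \<open>\<mu>\<close>, the index theorem and the simplicity of the eigenvalues
  would bound the count for \<open>q2\<close> between the count for \<open>q1\<close> and one more.
\<close>

theorem coupled_dirichlet_solution: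
  assumes l: "0 < l" and q1: "continuous_on {0..l} q1" and q2: "continuous_on {0..l} q2"
    and nspec: "0 \<notin> Spec_L l q2"
    and n: "n_neg_L l q2 \<noteq> n_neg_L l q1" "n_neg_L l q2 \<noteq> n_neg_L l q1 + 1"
  obtains \<sigma> :: real and u w :: "real \<Rightarrow> real" and x where "0 < \<sigma>"
    "dirichlet2 l u (\<lambda>x. - q1 x * u x + \<sigma> * w x)" "dirichlet2 l w (\<lambda>x. - q2 x * w x - \<sigma> * u x)"
    "x \<in> {0..l}" "u x \<noteq> 0"
proof -
  define S1 where "S1 = multiplication_op l (\<lambda>x. - q1 x)"
  define S2 where "S2 = multiplication_op l (\<lambda>x. - q2 x)"
  have "continuous_on {0..l} (\<lambda>x. - q1 x)" "continuous_on {0..l} (\<lambda>x. - q2 x)"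
    using q1 q2 by (auto intro: continuous_intros)
  then obtain C1 C2 where S1: "bounded_symmetric_potential l S1 C1" and S2: "bounded_symmetric_potential l S2 C2"
    unfolding S1_def S2_def using multiplication_op_potential[OF l] by metis
  obtain G K where G: "bounded_symmetric_potential l G K" and GL: "\<And>f. schrodinger_op l S2 (G f) f"
    using inverse_of_zero_resolvent[OF l q2 nspec] unfolding S2_def by blast
  interpret S1: bounded_symmetric_potential l S1 C1 by fact
  interpret S2: bounded_symmetric_potential l S2 C2 by fact
  interpret G: bounded_symmetric_potential l G K by fact
  interpret B: bounded_symmetric_potential l "\<lambda>u. S1 u + (-1) *\<^sub>R S2 u" "C1 + \<bar>-1\<bar> * C2"
    by (rule bounded_symmetric_potential_combine[OF S1 S2])
  obtain E1 \<delta>1 where gap1: "L2.gap_eigensystem 0 l (schrodinger_op l S1) E1 \<delta>1"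
    using S1.gap_eigensystem_ex by blast
  obtain E2 \<delta>2 where gap2: "L2.gap_eigensystem 0 l (schrodinger_op l S2) E2 \<delta>2"
    using S2.gap_eigensystem_ex by blast
  have pencil: "schrodinger_op l (\<lambda>u. S1 u + \<mu> *\<^sub>R G u) = (\<lambda>u f. schrodinger_op l S1 u (f - \<mu> *\<^sub>R G u))" for \<mu>
    by (simp add: fun_eq_iff schrodinger_op_def algebra_simps)
  have "\<exists>\<mu> u. 0 < \<mu> \<and> schrodinger_op l S1 u (- \<mu> *\<^sub>R G u) \<and> L2_ip 0 l u u \<noteq> 0"
  proof (rule ccontr)
    assume no: "\<not> ?thesis"
    have dom: "schrodinger_op l S1 u f \<longleftrightarrow> schrodinger_op l S2 u (f - (S1 u + (-1) *\<^sub>R S2 u))" for u f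
      by (simp add: schrodinger_op_def algebra_simps)
    have gap: "\<exists>E \<delta>. L2.gap_eigensystem 0 l (\<lambda>u f. schrodinger_op l S1 u (f - \<mu> *\<^sub>R G u)) E \<delta>" for \<mu>
      using bounded_symmetric_potential.gap_eigensystem_ex[OF bounded_symmetric_potential_combine[OF S1 G, of \<mu>]]
      unfolding pencil .
    have "card {e \<in> E1. \<exists>\<nu><0. schrodinger_op l S1 e (\<nu> *\<^sub>R e)} \<le> card E2 \<and> card E2 \<le> card E1"
      using L2.kernel_free_pencil_index[OF S1.symmetric S2.symmetric GL G.S_add G.S_scaleR G.S_L2 G.C dom
          B.S_L2 B.C gap gap1 gap2] no by blast
    moreover have "n_neg_L l q1 = card {e \<in> E1. \<exists>\<nu><0. schrodinger_op l S1 e (\<nu> *\<^sub>R e)}" "card E1 \<le> n_neg_L l q1 + 1"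
      using n_neg_L_eq[OF l q1] gap1 unfolding S1_def by blast+
    moreover have "n_neg_L l q2 = card E2"
    proof -
      have "\<exists>\<nu><0. schrodinger_op l S2 e (\<nu> *\<^sub>R e)" if e: "e \<in> E2" for e
      proof -
        obtain \<nu> where \<nu>: "\<nu> \<le> 0" "schrodinger_op l S2 e (\<nu> *\<^sub>R e)" and "L2_ip 0 l e e = 1"
          using gap2 e unfolding L2.gap_eigensystem_def L2.orthonormal_def by auto
        then have "\<nu> * L2_ip 0 l e (G e) = 1"
          using L2.symmetric_op_sym[OF S2.symmetric \<nu>(2) GL[of e]] by (simp add: L2.ip_linear)
        then have "\<nu> \<noteq> 0" by auto
        with \<nu> show ?thesis by (intro exI[of _ \<nu>]) auto
      qed
      then have "{e \<in> E2. \<exists>\<nu><0. schrodinger_op l S2 e (\<nu> *\<^sub>R e)} = E2" by blast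
      then show ?thesis using n_neg_L_eq(1)[OF l q2] gap2 unfolding S2_def by simp
    qed
    ultimately show False using n by linarith
  qed
  then obtain \<mu> u where \<mu>: "0 < \<mu>" and u: "schrodinger_op l S1 u (- \<mu> *\<^sub>R G u)" "L2_ip 0 l u u \<noteq> 0" by blast
  define \<sigma> where "\<sigma> = sqrt \<mu>"
  have \<sigma>: "0 < \<sigma>" "\<sigma> * \<sigma> = \<mu>" using \<mu> by (auto simp: \<sigma>_def)
  define w where "w = \<sigma> *\<^sub>R G u"
  have "schrodinger_op l S2 w (\<sigma> *\<^sub>R u)"
    unfolding w_def by (rule L2.symmetric_op_scaleR[OF S2.symmetric GL])
  then have "dirichlet2 l w (\<lambda>x. - q2 x * w x - \<sigma> * u x)"
    unfolding S2_def schrodinger_multiplication_iff[OF l q2] by simp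
  moreover have "dirichlet2 l u (\<lambda>x. - q1 x * u x + \<sigma> * w x)"
    using u(1) \<sigma>(2) unfolding S1_def schrodinger_multiplication_iff[OF l q1] w_def by (simp add: mult.assoc[symmetric])
  moreover obtain x where "x \<in> {0..l}" "u x \<noteq> 0"
  proof -
    have "\<exists>x\<in>{0..l}. u x \<noteq> 0"
    proof (rule ccontr)
      assume "\<not> ?thesis"
      then have "L2_ip 0 l u u = 0" unfolding L2_ip_def by (subst integral_cong[where g = "\<lambda>_. 0"]) auto
      with u(2) show False by simp
    qed
    then show thesis using that by blast
  qed
  ultimately show thesis using \<sigma>(1) that[of \<sigma> "apply_bcontfun u" "apply_bcontfun w"] by blast
qed

lemma Ck_on_imp_continuous_on:
  assumes "Ck_on k f S" "0 < k"
  shows "continuous_on S f"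
proof -
  obtain D where D: "\<And>x. x \<in> S \<Longrightarrow> D 0 x = f x"
    "\<And>x. x \<in> S \<Longrightarrow> (D 0 has_real_derivative D (Suc 0) x) (at x within S)"
    using assms unfolding Ck_on_def by (metis (no_types))
  have "continuous_on S (D 0)" by (rule DERIV_continuous_on[OF D(2)])
  then show ?thesis by (rule continuous_on_eq) (rule D(1))
qed

lemma Nop_eigenvalue:
  assumes l: "0 < l" and g: "continuous_on {0..l} g" and h: "continuous_on {0..l} h"
    and u: "dirichlet2 l u (\<lambda>x. - g x * u x - \<sigma> * v x)" and v: "dirichlet2 l v (\<lambda>x. - h x * v x + \<sigma> * u x)"
    and nz: "x \<in> {0..l}" "u x \<noteq> 0 \<or> v x \<noteq> 0"
  shows "complex_of_real \<sigma> \<in> eigenvalues (L2_pair_norm l) (Nop l g h)"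
proof -
  let ?u = "\<lambda>x. complex_of_real (u x)" and ?v = "\<lambda>x. complex_of_real (v x)"
  have "Lop l g ?u (\<lambda>x. complex_of_real (\<sigma> * v x))" by (rule Lop_classical[OF l u g])
  moreover have "Lop l h ?v (\<lambda>x. complex_of_real (- \<sigma> * u x))"
    using Lop_classical[OF l _ h, of v "\<lambda>x. - \<sigma> * u x"] v by simp
  ultimately have N: "Nop l g h (?u, ?v) (complex_of_real \<sigma> \<odot> (?u, ?v))"
    by (simp add: Nop_def cscale_prod_def cscale_fun_def cscale_complex_def)
  have pos: "0 < L2_norm l (\<lambda>x. complex_of_real (y x))" if y: "continuous_on {0..l} y" "y x \<noteq> 0" for y
  proof -
    have c: "continuous_on {0..l} (\<lambda>x. y x * y x)" using y by (intro continuous_intros)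
    have "integral {0..l} (\<lambda>x. y x * y x) \<noteq> 0"
      using integral_eq_0_iff[OF c l] y(2) nz(1) by auto
    moreover have "0 \<le> integral {0..l} (\<lambda>x. y x * y x)"
      using c by (intro integral_nonneg integrable_continuous_interval) auto
    ultimately show ?thesis by (simp add: L2_norm_of_real[OF y(1)])
  qed
  have "0 < (L2_norm l ?u)\<^sup>2 + (L2_norm l ?v)\<^sup>2"
    using nz(2) pos[OF dirichlet2_continuous(1)[OF u]] pos[OF dirichlet2_continuous(1)[OF v]]
    by (auto intro: add_pos_nonneg add_nonneg_pos)
  then have "L2_pair_norm l (?u, ?v) \<noteq> 0" by (auto simp: L2_pair_norm_def)
  with N show ?thesis unfolding eigenvalues_def by blast
qed

lemma eigenvalues_subset_spectrum: "eigenvalues nrm T \<subseteq> spectrum X nrm T"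
  unfolding eigenvalues_def spectrum_def resolvent_set_def by blast

lemma Nop_cong:
  assumes l: "0 < l" and eq: "\<And>x. x \<in> {0..l} \<Longrightarrow> g x = g' x \<and> h x = h' x"
  shows "Nop l g h = Nop l g' h'"
proof -
  have "Lop l q u w \<longleftrightarrow> Lop l q' u w" if "\<And>x. x \<in> {0..l} \<Longrightarrow> q x = q' x" for q q' u w
  proof -
    have "(AE x in lebesgue_on {0<..<l}. w x = - v' x - of_real (q x) * u x) \<longleftrightarrow>
          (AE x in lebesgue_on {0<..<l}. w x = - v' x - of_real (q' x) * u x)" for v'
      by (rule AE_cong) (use that in auto)
    then show ?thesis unfolding Lop_def by simp
  qed
  from this[of g g'] this[of h h'] have "Lop l g = Lop l g'" "Lop l h = Lop l h'"
    unfolding fun_eq_iff using eq by blast+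
  then show ?thesis by (simp add: Nop_def)
qed

theorem corollary2p7:
  fixes l :: real and g h :: "real \<Rightarrow> real"
  assumes "l > 0"
    and "Ck_on 2 g {0..l}" and "Ck_on 2 h {0..l}"
    and "(0 \<in> Spec_L l g - Spec_L l h \<and> int (n_neg_L l g) - int (n_neg_L l h) \<notin> {-1, 0}) \<or>
         (0 \<in> Spec_L l h - Spec_L l g \<and> int (n_neg_L l g) - int (n_neg_L l h) \<notin> {0, 1})"
  shows "n_plus_N l g h \<ge> 1 \<and>
    (\<forall>(f :: real \<Rightarrow> real) (\<beta> :: real) (\<phi> :: real \<Rightarrow> real).
       Ck_on 3 f {0..} \<and> standing_wave l f \<beta> \<phi> \<and>
       (\<forall>x\<in>{0..l}. g x = nls_g f \<beta> \<phi> x \<and> h x = nls_h f \<beta> \<phi> x) \<and>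
       0 \<notin> Spec_L l h \<inter> Spec_L l g \<longrightarrow>
       spectrally_unstable l f \<beta> \<phi>)"
proof -
  have g: "continuous_on {0..l} g" and h: "continuous_on {0..l} h"
    using assms(2,3) by (auto intro: Ck_on_imp_continuous_on)
  have "\<exists>\<sigma>>0. complex_of_real \<sigma> \<in> eigenvalues (L2_pair_norm l) (Nop l g h)"
    using assms(4)
  proof
    assume a: "0 \<in> Spec_L l g - Spec_L l h \<and> int (n_neg_L l g) - int (n_neg_L l h) \<notin> {-1, 0}"
    then have "0 \<notin> Spec_L l h" "n_neg_L l h \<noteq> n_neg_L l g" "n_neg_L l h \<noteq> n_neg_L l g + 1" by auto
    from coupled_dirichlet_solution[OF assms(1) g h this] obtain \<sigma> u w x where *: "0 < \<sigma>"
      "dirichlet2 l u (\<lambda>x. - g x * u x + \<sigma> * w x)" "dirichlet2 l w (\<lambda>x. - h x * w x - \<sigma> * u x)"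
      "x \<in> {0..l}" "u x \<noteq> 0" .
    \<comment> \<open>Eliminating \<open>v\<close> by the inverse of \<open>L\<^sub>-\<close> gives \<open>v = - w\<close>.\<close>
    have "dirichlet2 l (\<lambda>x. - w x) (\<lambda>x. - h x * - w x + \<sigma> * u x)"
      by (rule dirichlet2_cong[OF dirichlet2_scale[OF *(3), of "-1"]]) (use assms(1) in auto)
    then have "complex_of_real \<sigma> \<in> eigenvalues (L2_pair_norm l) (Nop l g h)"
      using * by (intro Nop_eigenvalue[OF assms(1) g h, of u \<sigma> "\<lambda>x. - w x" x]) auto
    with *(1) show ?thesis by blast
  next
    assume b: "0 \<in> Spec_L l h - Spec_L l g \<and> int (n_neg_L l g) - int (n_neg_L l h) \<notin> {0, 1}"
    \<comment> \<open>The roles of \<open>u, g\<close> and \<open>v, h\<close> are exchanged.\<close>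
    then have "0 \<notin> Spec_L l g" "n_neg_L l g \<noteq> n_neg_L l h" "n_neg_L l g \<noteq> n_neg_L l h + 1" by auto
    from coupled_dirichlet_solution[OF assms(1) h g this] obtain \<sigma> v u x where *: "0 < \<sigma>"
      "dirichlet2 l v (\<lambda>x. - h x * v x + \<sigma> * u x)" "dirichlet2 l u (\<lambda>x. - g x * u x - \<sigma> * v x)"
      "x \<in> {0..l}" "v x \<noteq> 0" .
    then have "complex_of_real \<sigma> \<in> eigenvalues (L2_pair_norm l) (Nop l g h)"
      by (intro Nop_eigenvalue[OF assms(1) g h, of u \<sigma> v x]) auto
    with *(1) show ?thesis by blast
  qed
  then obtain \<sigma> where \<sigma>: "0 < \<sigma>" "complex_of_real \<sigma> \<in> eigenvalues (L2_pair_norm l) (Nop l g h)" by blast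
  define P where "P = {r::real. r > 0 \<and> complex_of_real r \<in> eigenvalues (L2_pair_norm l) (Nop l g h)}"
  have "P \<noteq> {}" using \<sigma> unfolding P_def by blast
  then have "1 \<le> card P" if "finite P" using that by (simp add: Suc_le_eq card_gt_0_iff)
  then have "n_plus_N l g h \<ge> 1"
    unfolding n_plus_N_def P_def[symmetric] Let_def by (auto simp: one_enat_def)
  moreover have "spectrally_unstable l f \<beta> \<phi>"
    if eq: "\<forall>x\<in>{0..l}. g x = nls_g f \<beta> \<phi> x \<and> h x = nls_h f \<beta> \<phi> x" for f \<beta> \<phi>
  proof -
    have "Nop l g h = Nop l (nls_g f \<beta> \<phi>) (nls_h f \<beta> \<phi>)" using Nop_cong[OF assms(1)] eq by blast
    then have "complex_of_real \<sigma> \<in> Spec_N l (nls_g f \<beta> \<phi>) (nls_h f \<beta> \<phi>)"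
      using \<sigma>(2) eigenvalues_subset_spectrum unfolding Spec_N_def by auto
    then show ?thesis unfolding spectrally_unstable_def using \<sigma>(1) by force
  qed
  ultimately show ?thesis by blast
qed

end
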